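(* Let $A$ be an associative, not necessarily unital ring. The category $\mathfrak{M}(A)$ of h-unitary left modules over $A$ is an accessible additive category.
   Context: Let $R$ be a unital associative ring containing $A$ as a two-sided ideal (for instance $\tilde A=\mathbb{Z}\ltimes A$, obtained by adjoining an identity to $A$). A left $R$-module $M$ is h-unitary if the map $\mu:A\otimes_R M\to M$, $a\otimes m\mapsto am$, is an isomorphism and $\mathrm{Tor}_i^R(A,M)=0$ for all $i\ge 1$ (for $R=\tilde A$: equivalently $\mathrm{Tor}_n^{\tilde A}(\mathbb{Z},M)=0$ for all $n\ge 0$). $\mathfrak{M}(A)$ is the full subcategory of $R$-Mod of h-unitary modules. For an infinite regular cardinal $\aleph$, an $\aleph$-direct limit is the colimit of a system indexed by a directed set $I$ in which every subset of cardinality strictly smaller than $\aleph$ has an upper bound; an object $C$ is $\aleph$-presentable if $\mathrm{Hom}(C,-)$ commutes with $\aleph$-direct limits. A category is $\aleph$-accessible if it has $\aleph$-direct limits and there is a set $\mathcal C_0$ of $\aleph$-presentable objects such that every object is an $\aleph$-direct limit of objects in $\mathcal C_0$. It is accessible if it is $\aleph$-accessible for some infinite regular cardinal $\aleph$. *)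

theory Defs
  imports "HOL-Algebra.Free_Abelian_Groups" "HOL-Algebra.Elementary_Groups" "HOL-Algebra.Module" "HOL-Algebra.Ideal"
begin

unbundle cardinal_syntax

section \<open>Universes\<close>

text \<open>
  HOL has no proper classes, so the category of all modules is taken relative to a universe
  given by a set \<open>U\<close>: a set (of any type) is small if its cardinality is strictly below that of
  \<open>U\<close>, and a small module is one whose carrier is a small subset of \<open>U\<close>.  For a Grothendieck
  universe the cardinality of \<open>U\<close> is an uncountable strongly inaccessible cardinal above the
  cardinality of \<open>R\<close>.  In place of the strong limit property we only require that
  \<open>(carrier R + nat)\<close>-indexed families in a small set form a small set: every Grothendieck universe
  that contains \<open>R\<close> qualifies (\<open>inaccessible_imp_universe_for\<close>), and moreover suitable \<open>U\<close> exist
  in plain HOL for every \<open>R\<close> (\<open>universe_for_exists\<close>).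
\<close>

definition small :: "'u set \<Rightarrow> 'a set \<Rightarrow> bool" where
  "small U X \<longleftrightarrow> |X| <o |U|"

definition universe_for :: "('r, 'x) ring_scheme \<Rightarrow> 'u set \<Rightarrow> bool" where
  "universe_for R U \<longleftrightarrow>
     regularCard |U| \<and> small U (UNIV :: nat set) \<and> small U (carrier R) \<and>
     (\<forall>X\<subseteq>U. small U X \<longrightarrow> small U (Func (Sum_Type.Plus (carrier R) (UNIV :: nat set)) X))"

lemma inaccessible_imp_universe_for:
  fixes U :: "'u set"
  assumes reg: "regularCard |U|" and unc: "small U (UNIV :: nat set)"
    and lim: "\<And>X :: 'u set. X \<subseteq> U \<Longrightarrow> small U X \<Longrightarrow> small U (Pow X)"
    and R: "small U (carrier R)"
  shows "universe_for R U"
proof -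
  have inf: "infinite U"
    using unc unfolding small_def
    by (metis card_of_ordLeq_finite infinite_UNIV_nat ordLess_imp_ordLeq)
  have "small U (Func (Sum_Type.Plus (carrier R) (UNIV :: nat set)) X)" if X: "X \<subseteq> U" "small U X" for X
  proof -
    let ?L = "Sum_Type.Plus (carrier R) (UNIV :: nat set)"
    let ?P = "?L \<times> X"
    have L: "|?L| <o |U|"
      using card_of_Plus_ordLess_infinite[OF inf] R unc unfolding small_def by blast
    have P: "|?P| <o |U|"
      using card_of_Times_ordLess_infinite[OF inf L] X unfolding small_def by blast
    obtain f where f: "inj_on f ?P" "f ` ?P \<subseteq> U"
      using ordLess_imp_ordLeq[OF P] unfolding card_of_ordLeq[symmetric] by blast
    have "|f ` ?P| <o |U|"
      by (rule ordLeq_ordLess_trans[OF card_of_image P])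
    then have pow: "|Pow (f ` ?P)| <o |U|"
      using lim[OF f(2)] unfolding small_def by blast
    define g where "g = (\<lambda>h. f ` {(l, h l) | l. l \<in> ?L})"
    have "inj_on g (Func ?L X)"
    proof (rule inj_onI)
      fix h k assume h: "h \<in> Func ?L X" and k: "k \<in> Func ?L X" and eq: "g h = g k"
      have sub: "{(l, h l) | l. l \<in> ?L} \<subseteq> ?P" "{(l, k l) | l. l \<in> ?L} \<subseteq> ?P"
        using h k unfolding Func_def by auto
      have gr: "{(l, h l) | l. l \<in> ?L} = {(l, k l) | l. l \<in> ?L}"
        using eq unfolding g_def inj_on_image_eq_iff[OF f(1) sub] .
      show "h = k"
      proof
        fix l
        show "h l = k l"
        proof (cases "l \<in> ?L")
          case True
          then have "(l, h l) \<in> {(l, k l) | l. l \<in> ?L}" using gr by blast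
          then show ?thesis by blast
        next
          case False
          then show ?thesis using h k unfolding Func_def by simp
        qed
      qed
    qed
    moreover have "g ` Func ?L X \<subseteq> Pow (f ` ?P)"
      unfolding g_def Func_def by auto
    ultimately have "|Func ?L X| \<le>o |Pow (f ` ?P)|"
      using card_of_ordLeq by blast
    then show ?thesis
      using pow ordLeq_ordLess_trans unfolding small_def by blast
  qed
  then show ?thesis
    using reg unc R unfolding universe_for_def by blast
qed

lemma universe_for_exists:
  fixes R :: "('r, 'x) ring_scheme"
  shows "\<exists>U :: ('r + nat) set set set. universe_for R U"
proof -
  let ?L = "Sum_Type.Plus (carrier R) (UNIV :: nat set)"
  let ?p = "|Pow ?L|"
  let ?U = "Field (cardSuc ?p)"
  have infL: "infinite ?L" by simp
  then have infp: "infinite (Pow ?L)" by simp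
  have CL: "Cinfinite |?L|" using infL by (simp add: cinfinite_def Field_card_of card_of_Card_order)
  have Cp: "Cinfinite ?p" using infp by (simp add: cinfinite_def Field_card_of card_of_Card_order)
  have co: "Card_order (cardSuc ?p)"
    by (simp add: cardSuc_Card_order card_of_Card_order)
  have U: "|?U| =o cardSuc ?p"
    by (rule card_of_Field_ordIso[OF co])
  have lt: "|X| <o |?U| \<longleftrightarrow> |X| \<le>o ?p" for X :: "'b set"
    using cardSuc_ordLeq_ordLess[of ?p "|X|", OF card_of_Card_order card_of_Card_order]
      ordLess_ordIso_trans[OF _ U] ordLess_ordIso_trans[OF _ ordIso_symmetric[OF U]] by blast
  have Lp: "|?L| \<le>o ?p" by (simp add: card_of_Pow ordLess_imp_ordLeq)
  have "regularCard |?U|"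
    by (rule regularCard_ordIso[OF ordIso_symmetric[OF U] Cinfinite_cardSuc[OF Cp]
          regularCard_cardSuc[OF Cp]])
  moreover have "small ?U (UNIV :: nat set)"
    unfolding small_def lt
    by (rule ordLeq_transitive[OF card_of_Plus2 Lp])
  moreover have "small ?U (carrier R)"
    unfolding small_def lt
    by (rule ordLeq_transitive[OF card_of_Plus1 Lp])
  moreover have "small ?U (Func ?L X)" if "small ?U X" for X :: "('r + nat) set set set"
  proof -
    have "|X| \<le>o ?p" using that unfolding small_def lt .
    also have "?p =o ctwo ^c |?L|"
      unfolding ctwo_def cexp_def Field_card_of by (rule card_of_Pow_Func)
    finally have 1: "|X| \<le>o ctwo ^c |?L|" .
    have "|Func ?L X| = |X| ^c |?L|" by (simp add: cexp_def Field_card_of)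
    also have "|X| ^c |?L| \<le>o (ctwo ^c |?L| ) ^c |?L|"
      by (rule cexp_mono1[OF 1 card_of_Card_order])
    also have "(ctwo ^c |?L| ) ^c |?L| =o ctwo ^c ( |?L| *c |?L| )"
      by (rule cexp_cprod[OF Card_order_ctwo])
    also have "ctwo ^c ( |?L| *c |?L| ) =o ctwo ^c |?L|"
      by (rule cexp_cong2[OF cprod_infinite[OF CL] Card_order_ctwo Card_order_cprod])
    also have "ctwo ^c |?L| =o ?p"
      unfolding ctwo_def cexp_def Field_card_of by (rule ordIso_symmetric[OF card_of_Pow_Func])
    finally show ?thesis unfolding small_def lt .
  qed
  ultimately have "universe_for R ?U" unfolding universe_for_def by simp
  then show ?thesis by (rule exI)
qed


section \<open>Categories\<close>

text \<open>
  Hom-sets of different pairs of objects need not be disjoint; therefore composition takes the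
  objects as arguments: \<open>Comp C X Y Z g f\<close> is the composite of \<open>f : X \<rightarrow> Y\<close> and \<open>g : Y \<rightarrow> Z\<close>.
\<close>

record ('o, 'm) cat =
  Ob :: "'o set"
  Hom :: "'o \<Rightarrow> 'o \<Rightarrow> 'm set"
  Idn :: "'o \<Rightarrow> 'm"
  Comp :: "'o \<Rightarrow> 'o \<Rightarrow> 'o \<Rightarrow> 'm \<Rightarrow> 'm \<Rightarrow> 'm"

definition is_category :: "('o, 'm) cat \<Rightarrow> bool" where
  "is_category C \<longleftrightarrow>
     (\<forall>X\<in>Ob C. Idn C X \<in> Hom C X X) \<and>
     (\<forall>X\<in>Ob C. \<forall>Y\<in>Ob C. \<forall>Z\<in>Ob C. \<forall>f\<in>Hom C X Y. \<forall>g\<in>Hom C Y Z.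
        Comp C X Y Z g f \<in> Hom C X Z) \<and>
     (\<forall>X\<in>Ob C. \<forall>Y\<in>Ob C. \<forall>f\<in>Hom C X Y.
        Comp C X X Y f (Idn C X) = f \<and> Comp C X Y Y (Idn C Y) f = f) \<and>
     (\<forall>W\<in>Ob C. \<forall>X\<in>Ob C. \<forall>Y\<in>Ob C. \<forall>Z\<in>Ob C.
        \<forall>f\<in>Hom C W X. \<forall>g\<in>Hom C X Y. \<forall>h\<in>Hom C Y Z.
        Comp C W X Z (Comp C X Y Z h g) f = Comp C W Y Z h (Comp C W X Y g f))"

definition full_subcategory :: "('o, 'm) cat \<Rightarrow> ('o \<Rightarrow> bool) \<Rightarrow> ('o, 'm) cat" where
  "full_subcategory C S = C\<lparr>Ob := {X \<in> Ob C. S X}\<rparr>"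


section \<open>Additive categories\<close>

text \<open>\<open>G X Y\<close> is the hom-set from \<open>X\<close> to \<open>Y\<close> with its (multiplicatively written) abelian group structure.\<close>

definition preadditive :: "('o, 'm) cat \<Rightarrow> ('o \<Rightarrow> 'o \<Rightarrow> 'm monoid) \<Rightarrow> bool" where
  "preadditive C G \<longleftrightarrow>
     (\<forall>X\<in>Ob C. \<forall>Y\<in>Ob C. comm_group (G X Y) \<and> carrier (G X Y) = Hom C X Y) \<and>
     (\<forall>X\<in>Ob C. \<forall>Y\<in>Ob C. \<forall>Z\<in>Ob C. \<forall>f\<in>Hom C X Y. \<forall>f'\<in>Hom C X Y. \<forall>g\<in>Hom C Y Z. \<forall>g'\<in>Hom C Y Z.
        Comp C X Y Z g (f \<otimes>\<^bsub>G X Y\<^esub> f') = Comp C X Y Z g f \<otimes>\<^bsub>G X Z\<^esub> Comp C X Y Z g f' \<and>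
        Comp C X Y Z (g \<otimes>\<^bsub>G Y Z\<^esub> g') f = Comp C X Y Z g f \<otimes>\<^bsub>G X Z\<^esub> Comp C X Y Z g' f)"

definition zero_object :: "('o, 'm) cat \<Rightarrow> 'o \<Rightarrow> bool" where
  "zero_object C Z \<longleftrightarrow>
     Z \<in> Ob C \<and> (\<forall>X\<in>Ob C. (\<exists>!f. f \<in> Hom C X Z) \<and> (\<exists>!f. f \<in> Hom C Z X))"

definition has_biproduct :: "('o, 'm) cat \<Rightarrow> ('o \<Rightarrow> 'o \<Rightarrow> 'm monoid) \<Rightarrow> 'o \<Rightarrow> 'o \<Rightarrow> bool" where
  "has_biproduct C G X Y \<longleftrightarrow>
     (\<exists>B\<in>Ob C. \<exists>i\<in>Hom C X B. \<exists>j\<in>Hom C Y B. \<exists>p\<in>Hom C B X. \<exists>q\<in>Hom C B Y.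
        Comp C X B X p i = Idn C X \<and> Comp C Y B Y q j = Idn C Y \<and>
        Comp C X B Y q i = \<one>\<^bsub>G X Y\<^esub> \<and> Comp C Y B X p j = \<one>\<^bsub>G Y X\<^esub> \<and>
        Comp C B X B i p \<otimes>\<^bsub>G B B\<^esub> Comp C B Y B j q = Idn C B)"

definition additive_category :: "('o, 'm) cat \<Rightarrow> bool" where
  "additive_category C \<longleftrightarrow>
     is_category C \<and>
     (\<exists>G. preadditive C G \<and> (\<exists>Z. zero_object C Z) \<and>
          (\<forall>X\<in>Ob C. \<forall>Y\<in>Ob C. has_biproduct C G X Y))"


section \<open>Accessible categories\<close>

definition directed_set :: "'k rel \<Rightarrow> 'i set \<Rightarrow> 'i rel \<Rightarrow> bool" where
  "directed_set \<kappa> I r \<longleftrightarrow>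
     preorder_on I r \<and> (\<forall>S\<subseteq>I. |S| <o \<kappa> \<longrightarrow> (\<exists>u\<in>I. \<forall>s\<in>S. (s, u) \<in> r))"

definition direct_system ::
    "('o, 'm) cat \<Rightarrow> 'i set \<Rightarrow> 'i rel \<Rightarrow> ('i \<Rightarrow> 'o) \<Rightarrow> ('i \<Rightarrow> 'i \<Rightarrow> 'm) \<Rightarrow> bool" where
  "direct_system C I r D t \<longleftrightarrow>
     (\<forall>i\<in>I. D i \<in> Ob C \<and> t i i = Idn C (D i)) \<and>
     (\<forall>i j. (i, j) \<in> r \<longrightarrow> t i j \<in> Hom C (D i) (D j)) \<and>
     (\<forall>i j k. (i, j) \<in> r \<longrightarrow> (j, k) \<in> r \<longrightarrow> Comp C (D i) (D j) (D k) (t j k) (t i j) = t i k)"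

definition is_cocone ::
    "('o, 'm) cat \<Rightarrow> 'i set \<Rightarrow> 'i rel \<Rightarrow> ('i \<Rightarrow> 'o) \<Rightarrow> ('i \<Rightarrow> 'i \<Rightarrow> 'm) \<Rightarrow> 'o \<Rightarrow> ('i \<Rightarrow> 'm) \<Rightarrow> bool" where
  "is_cocone C I r D t L c \<longleftrightarrow>
     L \<in> Ob C \<and> (\<forall>i\<in>I. c i \<in> Hom C (D i) L) \<and>
     (\<forall>i j. (i, j) \<in> r \<longrightarrow> Comp C (D i) (D j) L (c j) (t i j) = c i)"

definition is_colimit ::
    "('o, 'm) cat \<Rightarrow> 'i set \<Rightarrow> 'i rel \<Rightarrow> ('i \<Rightarrow> 'o) \<Rightarrow> ('i \<Rightarrow> 'i \<Rightarrow> 'm) \<Rightarrow> 'o \<Rightarrow> ('i \<Rightarrow> 'm) \<Rightarrow> bool" where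
  "is_colimit C I r D t L c \<longleftrightarrow>
     is_cocone C I r D t L c \<and>
     (\<forall>X d. is_cocone C I r D t X d \<longrightarrow>
        (\<exists>!h. h \<in> Hom C L X \<and> (\<forall>i\<in>I. Comp C (D i) L X h (c i) = d i)))"

text \<open>Every small directed set is isomorphic to one on a subset of the type of \<open>U\<close>, so it suffices to
  consider index sets of that type.\<close>

definition has_direct_limits :: "'u set \<Rightarrow> 'k rel \<Rightarrow> ('o, 'm) cat \<Rightarrow> bool" where
  "has_direct_limits U \<kappa> C \<longleftrightarrow>
     (\<forall>(I :: 'u set) r D t. small U I \<and> directed_set \<kappa> I r \<and> direct_system C I r D t \<longrightarrow>
        (\<exists>L c. is_colimit C I r D t L c))"

text \<open>The direct limit of a directed system of sets \<open>S i\<close> with transition maps \<open>t i j\<close>: the disjoint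
  union modulo eventual equality.\<close>

definition set_direct_limit ::
    "'i set \<Rightarrow> 'i rel \<Rightarrow> ('i \<Rightarrow> 'a set) \<Rightarrow> ('i \<Rightarrow> 'i \<Rightarrow> 'a \<Rightarrow> 'a) \<Rightarrow> ('i \<times> 'a) set set" where
  "set_direct_limit I r S t =
     Sigma I S // {((i, x), (j, y)). (i, x) \<in> Sigma I S \<and> (j, y) \<in> Sigma I S \<and>
                     (\<exists>k\<in>I. (i, k) \<in> r \<and> (j, k) \<in> r \<and> t i k x = t j k y)}"

text \<open>\<open>Hom(X,-)\<close> commutes with \<open>\<kappa>\<close>-direct limits: whenever \<open>(L, c)\<close> is the colimit of such a system \<open>D\<close>,
  the canonical map from the direct limit of the sets \<open>Hom(X, D i)\<close> to \<open>Hom(X, L)\<close>, sending the class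
  of \<open>f : X \<rightarrow> D i\<close> to \<open>c i \<circ> f\<close>, is bijective.\<close>

definition presentable :: "'u set \<Rightarrow> 'k rel \<Rightarrow> ('o, 'm) cat \<Rightarrow> 'o \<Rightarrow> bool" where
  "presentable U \<kappa> C X \<longleftrightarrow>
     X \<in> Ob C \<and>
     (\<forall>(I :: 'u set) r D t L c.
        small U I \<and> directed_set \<kappa> I r \<and> direct_system C I r D t \<and> is_colimit C I r D t L c \<longrightarrow>
        bij_betw (\<lambda>E. the_elem ((\<lambda>(i, f). Comp C X (D i) L (c i) f) ` E))
          (set_direct_limit I r (\<lambda>i. Hom C X (D i)) (\<lambda>i j f. Comp C X (D i) (D j) (t i j) f))
          (Hom C X L))"

definition accessible_at :: "'u set \<Rightarrow> 'k rel \<Rightarrow> ('o, 'm) cat \<Rightarrow> bool" where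
  "accessible_at U \<kappa> C \<longleftrightarrow>
     has_direct_limits U \<kappa> C \<and>
     (\<exists>C0. small U C0 \<and> (\<forall>X\<in>C0. presentable U \<kappa> C X) \<and>
        (\<forall>X\<in>Ob C. \<exists>(I :: 'u set) r D t c.
           small U I \<and> directed_set \<kappa> I r \<and> direct_system C I r D t \<and> (\<forall>i\<in>I. D i \<in> C0) \<and>
           is_colimit C I r D t X c))"

text \<open>The cardinal \<open>\<kappa>\<close> is itself a member of the universe.\<close>

definition accessible :: "'u set \<Rightarrow> ('o, 'm) cat \<Rightarrow> bool" where
  "accessible U C \<longleftrightarrow>
     is_category C \<and>
     (\<exists>\<kappa> :: 'u rel. Card_order \<kappa> \<and> cinfinite \<kappa> \<and> regularCard \<kappa> \<and> \<kappa> <o |U| \<and> accessible_at U \<kappa> C)"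


section \<open>Modules\<close>

text \<open>
  The locale \<open>module\<close> of HOL-Algebra requires a commutative ring.  Only the fields \<open>carrier\<close>, \<open>add\<close>,
  \<open>zero\<close> and \<open>smult\<close> of the record are relevant for a module; \<open>mult\<close> and \<open>one\<close> are unconstrained,
  which merely adds isomorphic copies of each module.
\<close>

locale left_module = R?: ring R + M?: abelian_group M
  for R :: "('r, 'x) ring_scheme" (structure) and M :: "('r, 'm) module" (structure) +
  assumes smult_closed:
      "\<lbrakk>a \<in> carrier R; x \<in> carrier M\<rbrakk> \<Longrightarrow> a \<odot>\<^bsub>M\<^esub> x \<in> carrier M"
    and smult_l_distr:
      "\<lbrakk>a \<in> carrier R; b \<in> carrier R; x \<in> carrier M\<rbrakk> \<Longrightarrow>
        (a \<oplus>\<^bsub>R\<^esub> b) \<odot>\<^bsub>M\<^esub> x = a \<odot>\<^bsub>M\<^esub> x \<oplus>\<^bsub>M\<^esub> b \<odot>\<^bsub>M\<^esub> x"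
    and smult_r_distr:
      "\<lbrakk>a \<in> carrier R; x \<in> carrier M; y \<in> carrier M\<rbrakk> \<Longrightarrow>
        a \<odot>\<^bsub>M\<^esub> (x \<oplus>\<^bsub>M\<^esub> y) = a \<odot>\<^bsub>M\<^esub> x \<oplus>\<^bsub>M\<^esub> a \<odot>\<^bsub>M\<^esub> y"
    and smult_assoc:
      "\<lbrakk>a \<in> carrier R; b \<in> carrier R; x \<in> carrier M\<rbrakk> \<Longrightarrow>
        (a \<otimes>\<^bsub>R\<^esub> b) \<odot>\<^bsub>M\<^esub> x = a \<odot>\<^bsub>M\<^esub> (b \<odot>\<^bsub>M\<^esub> x)"
    and smult_one:
      "x \<in> carrier M \<Longrightarrow> \<one>\<^bsub>R\<^esub> \<odot>\<^bsub>M\<^esub> x = x"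

text \<open>Homomorphisms are extensional functions, so that equality of morphisms is equality on the carrier.\<close>

definition module_hom ::
    "('r, 'x) ring_scheme \<Rightarrow> ('r, 'm) module \<Rightarrow> ('r, 'n) module \<Rightarrow> ('m \<Rightarrow> 'n) set" where
  "module_hom R M N =
     {f \<in> carrier M \<rightarrow>\<^sub>E carrier N.
        (\<forall>x\<in>carrier M. \<forall>y\<in>carrier M. f (x \<oplus>\<^bsub>M\<^esub> y) = f x \<oplus>\<^bsub>N\<^esub> f y) \<and>
        (\<forall>a\<in>carrier R. \<forall>x\<in>carrier M. f (a \<odot>\<^bsub>M\<^esub> x) = a \<odot>\<^bsub>N\<^esub> f x)}"

definition small_module :: "'u set \<Rightarrow> ('r, 'x) ring_scheme \<Rightarrow> ('r, 'u) module \<Rightarrow> bool" where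
  "small_module U R M \<longleftrightarrow> left_module R M \<and> carrier M \<subseteq> U \<and> small U (carrier M)"

definition module_category ::
    "'u set \<Rightarrow> ('r, 'x) ring_scheme \<Rightarrow> (('r, 'u) module, 'u \<Rightarrow> 'u) cat" where
  "module_category U R =
     \<lparr>Ob = {M. small_module U R M},
      Hom = module_hom R,
      Idn = (\<lambda>M. \<lambda>x\<in>carrier M. x),
      Comp = (\<lambda>L M N g f. compose (carrier L) g f)\<rparr>"

definition projective_module :: "'u set \<Rightarrow> ('r, 'x) ring_scheme \<Rightarrow> ('r, 'u) module \<Rightarrow> bool" where
  "projective_module U R P \<longleftrightarrow>
     small_module U R P \<and>
     (\<forall>M N f g. small_module U R M \<and> small_module U R N \<and>
        f \<in> module_hom R M N \<and> f ` carrier M = carrier N \<and> g \<in> module_hom R P N \<longrightarrow>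
        (\<exists>h\<in>module_hom R P M. compose (carrier P) f h = g))"


section \<open>Tensor products and Tor\<close>

text \<open>
  In \<open>X \<otimes>\<^sub>R M\<close> the left factor is a right module.  Right modules are encoded by the same record type,
  with \<open>r \<odot>\<^bsub>X\<^esub> x\<close> denoting the right action \<open>x r\<close>.  The tensor product is the free abelian group on
  pairs modulo the usual relations; its operation is written multiplicatively, as for every quotient
  group in HOL-Algebra.
\<close>

definition tensor_relations ::
    "('r, 'x) ring_scheme \<Rightarrow> ('r, 'a) module \<Rightarrow> ('r, 'm) module \<Rightarrow> ('a \<times> 'm \<Rightarrow>\<^sub>0 int) set" where
  "tensor_relations R X M =
     {frag_of (x \<oplus>\<^bsub>X\<^esub> y, m) - frag_of (x, m) - frag_of (y, m) | x y m.
        x \<in> carrier X \<and> y \<in> carrier X \<and> m \<in> carrier M} \<union>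
     {frag_of (x, m \<oplus>\<^bsub>M\<^esub> n) - frag_of (x, m) - frag_of (x, n) | x m n.
        x \<in> carrier X \<and> m \<in> carrier M \<and> n \<in> carrier M} \<union>
     {frag_of (r \<odot>\<^bsub>X\<^esub> x, m) - frag_of (x, r \<odot>\<^bsub>M\<^esub> m) | x r m.
        x \<in> carrier X \<and> r \<in> carrier R \<and> m \<in> carrier M}"

definition tensor_coset ::
    "('r, 'x) ring_scheme \<Rightarrow> ('r, 'a) module \<Rightarrow> ('r, 'm) module \<Rightarrow>
      ('a \<times> 'm \<Rightarrow>\<^sub>0 int) \<Rightarrow> ('a \<times> 'm \<Rightarrow>\<^sub>0 int) set" where
  "tensor_coset R X M z =
     (let F = free_Abelian_group (carrier X \<times> carrier M)
      in generate F (tensor_relations R X M) #>\<^bsub>F\<^esub> z)"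

definition tensor ::
    "('r, 'x) ring_scheme \<Rightarrow> ('r, 'a) module \<Rightarrow> ('r, 'm) module \<Rightarrow> ('a \<times> 'm \<Rightarrow>\<^sub>0 int) set monoid" where
  "tensor R X M =
     (let F = free_Abelian_group (carrier X \<times> carrier M)
      in F Mod generate F (tensor_relations R X M))"

definition pure_tensor ::
    "('r, 'x) ring_scheme \<Rightarrow> ('r, 'a) module \<Rightarrow> ('r, 'm) module \<Rightarrow> 'a \<Rightarrow> 'm \<Rightarrow> ('a \<times> 'm \<Rightarrow>\<^sub>0 int) set" where
  "pure_tensor R X M x m = tensor_coset R X M (frag_of (x, m))"

text \<open>The map \<open>X \<otimes> f : X \<otimes>\<^sub>R M \<rightarrow> X \<otimes>\<^sub>R N\<close> induced by \<open>f : M \<rightarrow> N\<close>.\<close>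

definition tensor_map ::
    "('r, 'x) ring_scheme \<Rightarrow> ('r, 'a) module \<Rightarrow> ('r, 'm) module \<Rightarrow> ('r, 'n) module \<Rightarrow> ('m \<Rightarrow> 'n) \<Rightarrow>
      ('a \<times> 'm \<Rightarrow>\<^sub>0 int) set \<Rightarrow> ('a \<times> 'n \<Rightarrow>\<^sub>0 int) set" where
  "tensor_map R X M N f T =
     the_elem ((\<lambda>z. tensor_coset R X N (frag_extend (\<lambda>(x, m). frag_of (x, f m)) z)) ` T)"

text \<open>\<open>\<cdots> \<rightarrow> P 1 \<rightarrow> P 0 \<rightarrow> M \<rightarrow> 0\<close> with \<open>d n : P (n + 1) \<rightarrow> P n\<close> and augmentation \<open>e\<close>.\<close>

definition projective_resolution ::
    "'u set \<Rightarrow> ('r, 'x) ring_scheme \<Rightarrow> ('r, 'u) module \<Rightarrow>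
      (nat \<Rightarrow> ('r, 'u) module) \<Rightarrow> (nat \<Rightarrow> 'u \<Rightarrow> 'u) \<Rightarrow> ('u \<Rightarrow> 'u) \<Rightarrow> bool" where
  "projective_resolution U R M P d e \<longleftrightarrow>
     (\<forall>n. projective_module U R (P n)) \<and>
     (\<forall>n. d n \<in> module_hom R (P (Suc n)) (P n)) \<and>
     e \<in> module_hom R (P 0) M \<and>
     e ` carrier (P 0) = carrier M \<and>
     d 0 ` carrier (P 1) = {x \<in> carrier (P 0). e x = \<zero>\<^bsub>M\<^esub>} \<and>
     (\<forall>n. d (Suc n) ` carrier (P (Suc (Suc n))) =
            {x \<in> carrier (P (Suc n)). d n x = \<zero>\<^bsub>P n\<^esub>})"

text \<open>The \<open>n\<close>-th homology group of the complex \<open>X \<otimes>\<^sub>R P\<close>.\<close>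

definition tensor_homology ::
    "('r, 'x) ring_scheme \<Rightarrow> ('r, 'a) module \<Rightarrow> (nat \<Rightarrow> ('r, 'u) module) \<Rightarrow> (nat \<Rightarrow> 'u \<Rightarrow> 'u) \<Rightarrow> nat \<Rightarrow>
      ('a \<times> 'u \<Rightarrow>\<^sub>0 int) set set monoid" where
  "tensor_homology R X P d n =
     (tensor R X (P n))
       \<lparr>carrier :=
          (case n of
             0 \<Rightarrow> carrier (tensor R X (P 0))
           | Suc m \<Rightarrow> kernel (tensor R X (P n)) (tensor R X (P m)) (tensor_map R X (P n) (P m) (d m)))\<rparr>
     Mod (tensor_map R X (P (Suc n)) (P n) (d n) ` carrier (tensor R X (P (Suc n))))"

text \<open>\<open>Tor U R X M n\<close> is the group \<open>Tor\<^sub>n\<^sup>R(X, M)\<close>, computed from a chosen projective resolution of \<open>M\<close>.\<close>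

definition Tor ::
    "'u set \<Rightarrow> ('r, 'x) ring_scheme \<Rightarrow> ('r, 'a) module \<Rightarrow> ('r, 'u) module \<Rightarrow> nat \<Rightarrow>
      ('a \<times> 'u \<Rightarrow>\<^sub>0 int) set set monoid" where
  "Tor U R X M n =
     (let (P, d, e) = (SOME (P, d, e). projective_resolution U R M P d e)
      in tensor_homology R X P d n)"


section \<open>H-unitary modules\<close>

text \<open>A two-sided ideal \<open>A\<close> of \<open>R\<close> as a right \<open>R\<close>-module.\<close>

definition ideal_right_module :: "('r, 'x) ring_scheme \<Rightarrow> 'r set \<Rightarrow> ('r, 'r) module" where
  "ideal_right_module R A =
     \<lparr>carrier = A, mult = mult R, one = one R, zero = zero R, add = add R,
      smult = (\<lambda>r a. a \<otimes>\<^bsub>R\<^esub> r)\<rparr>"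

text \<open>As the \<open>a \<otimes> m\<close> generate \<open>A \<otimes>\<^sub>R M\<close>, the map \<open>\<mu>\<close> below is determined by its values on them.\<close>

definition h_unitary ::
    "'u set \<Rightarrow> ('r, 'x) ring_scheme \<Rightarrow> 'r set \<Rightarrow> ('r, 'u) module \<Rightarrow> bool" where
  "h_unitary U R A M \<longleftrightarrow>
     (\<exists>\<mu> \<in> iso (tensor R (ideal_right_module R A) M) (add_monoid M).
        \<forall>a\<in>A. \<forall>m\<in>carrier M. \<mu> (pure_tensor R (ideal_right_module R A) M a m) = a \<odot>\<^bsub>M\<^esub> m) \<and>
     (\<forall>i\<ge>1. trivial_group (Tor U R (ideal_right_module R A) M i))"

definition h_unitary_category ::
    "'u set \<Rightarrow> ('r, 'x) ring_scheme \<Rightarrow> 'r set \<Rightarrow> (('r, 'u) module, 'u \<Rightarrow> 'u) cat" where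
  "h_unitary_category U R A = full_subcategory (module_category U R) (h_unitary U R A)"

end

theory Submission
  imports Defs
begin

text \<open>
  Write \<open>A P\<close> for the additive subgroup of \<open>P\<close> generated by the products \<open>a x\<close>.  For projective \<open>P\<close> the map
  \<open>A \<otimes>\<^sub>R P \<rightarrow> P\<close> is injective with image \<open>A P\<close>; hence \<open>M\<close> is h-unitary iff the complex
  \<open>\<cdots> \<rightarrow> A P\<^sub>1 \<rightarrow> A P\<^sub>0 \<rightarrow> M \<rightarrow> 0\<close> is exact for one, equivalently every, projective resolution of \<open>M\<close>.
  With the functorial free presentations \<open>F M \<rightarrow> M\<close> on the underlying set of \<open>M\<close> and their kernels
  \<open>\<Omega> M\<close>, this says that \<open>A M = M\<close> and that \<open>\<Omega>\<^sup>n\<^sup>+\<^sup>1 M \<inter> A F (\<Omega>\<^sup>n M) = A (\<Omega>\<^sup>n\<^sup>+\<^sup>1 M)\<close> for all \<open>n\<close>: every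
  equation of a certain kind that holds over \<open>M\<close> has a solution over \<open>M\<close>, and equations and solutions involve
  finitely many elements only.  Since \<open>\<Omega>\<close> preserves directed colimits, h-unitary modules are closed under them.
  Moreover, with \<open>\<lambda> = max(|R|, \<aleph>\<^sub>0)\<close>, adjoining solutions \<open>\<omega>\<close> times to a submodule of an h-unitary
  module with at most \<open>\<lambda>\<close> elements gives an h-unitary submodule with at most \<open>\<lambda>\<close> elements.  So every
  h-unitary module is the \<open>\<lambda>\<^sup>+\<close>-directed union of such submodules, and these are \<open>\<lambda>\<^sup>+\<close>-presentable.
\<close>

section \<open>Linear maps\<close>

definition linear_map ::
    "('r, 'x) ring_scheme \<Rightarrow> ('r, 'm) module \<Rightarrow> ('r, 'n) module \<Rightarrow> ('m \<Rightarrow> 'n) \<Rightarrow> bool" where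
  "linear_map R M N f \<longleftrightarrow>
     f \<in> carrier M \<rightarrow> carrier N \<and>
     (\<forall>x\<in>carrier M. \<forall>y\<in>carrier M. f (x \<oplus>\<^bsub>M\<^esub> y) = f x \<oplus>\<^bsub>N\<^esub> f y) \<and>
     (\<forall>a\<in>carrier R. \<forall>x\<in>carrier M. f (a \<odot>\<^bsub>M\<^esub> x) = a \<odot>\<^bsub>N\<^esub> f x)"

lemma linear_map_closed: "linear_map R M N f \<Longrightarrow> x \<in> carrier M \<Longrightarrow> f x \<in> carrier N"
  unfolding linear_map_def by blast

lemma linear_map_add:
  "linear_map R M N f \<Longrightarrow> x \<in> carrier M \<Longrightarrow> y \<in> carrier M \<Longrightarrow> f (x \<oplus>\<^bsub>M\<^esub> y) = f x \<oplus>\<^bsub>N\<^esub> f y"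
  unfolding linear_map_def by blast

lemma linear_map_smult:
  "linear_map R M N f \<Longrightarrow> a \<in> carrier R \<Longrightarrow> x \<in> carrier M \<Longrightarrow> f (a \<odot>\<^bsub>M\<^esub> x) = a \<odot>\<^bsub>N\<^esub> f x"
  unfolding linear_map_def by blast

lemma linear_map_comp:
  assumes "linear_map R L M f" "linear_map R M N g"
  shows "linear_map R L N (\<lambda>x. g (f x))"
  using assms unfolding linear_map_def by (simp add: Pi_iff)

lemma linear_map_ident: "linear_map R M M (\<lambda>x. x)"
  unfolding linear_map_def by simp

lemma linear_map_cong:
  assumes "linear_map R M N f" "\<And>x. x \<in> carrier M \<Longrightarrow> g x = f x" "left_module R M"
  shows "linear_map R M N g"
proof -
  interpret M: left_module R M by fact
  show ?thesis
    using assms(1,2) M.smult_closed M.a_closed unfolding linear_map_def by (simp add: Pi_iff)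
qed

lemma module_hom_iff:
  "f \<in> module_hom R M N \<longleftrightarrow> linear_map R M N f \<and> f \<in> extensional (carrier M)"
  unfolding module_hom_def linear_map_def by (auto simp: PiE_def)

lemma linear_map_restrict:
  assumes "left_module R M" "linear_map R M N f"
  shows "restrict f (carrier M) \<in> module_hom R M N"
  unfolding module_hom_iff using linear_map_cong[OF assms(2) _ assms(1)] by simp

lemma left_module_abelian: "left_module R M \<Longrightarrow> abelian_group M"
  unfolding left_module_def by blast

lemma small_module_left: "small_module U R M \<Longrightarrow> left_module R M"
  unfolding small_module_def by blast

lemma module_zero_smult:
  assumes "left_module R M" "x \<in> carrier M"
  shows "\<zero>\<^bsub>R\<^esub> \<odot>\<^bsub>M\<^esub> x = \<zero>\<^bsub>M\<^esub>"
proof -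
  interpret M: left_module R M by fact
  have "\<zero>\<^bsub>R\<^esub> \<odot>\<^bsub>M\<^esub> x \<oplus>\<^bsub>M\<^esub> \<zero>\<^bsub>R\<^esub> \<odot>\<^bsub>M\<^esub> x = \<zero>\<^bsub>R\<^esub> \<odot>\<^bsub>M\<^esub> x"
    using M.smult_l_distr[OF M.R.zero_closed M.R.zero_closed assms(2)] by simp
  then show ?thesis using M.add.r_cancel_one assms(2) M.smult_closed by blast
qed

lemma module_smult_zero:
  assumes "left_module R M" "a \<in> carrier R"
  shows "a \<odot>\<^bsub>M\<^esub> \<zero>\<^bsub>M\<^esub> = \<zero>\<^bsub>M\<^esub>"
proof -
  interpret M: left_module R M by fact
  have "a \<odot>\<^bsub>M\<^esub> \<zero>\<^bsub>M\<^esub> \<oplus>\<^bsub>M\<^esub> a \<odot>\<^bsub>M\<^esub> \<zero>\<^bsub>M\<^esub> = a \<odot>\<^bsub>M\<^esub> \<zero>\<^bsub>M\<^esub>"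
    using M.smult_r_distr[OF assms(2) M.M.zero_closed M.M.zero_closed] by simp
  then show ?thesis using M.add.r_cancel_one assms(2) M.smult_closed by blast
qed

lemma module_minus_smult:
  assumes "left_module R M" "a \<in> carrier R" "x \<in> carrier M"
  shows "(\<ominus>\<^bsub>R\<^esub> a) \<odot>\<^bsub>M\<^esub> x = \<ominus>\<^bsub>M\<^esub> (a \<odot>\<^bsub>M\<^esub> x)"
proof -
  interpret M: left_module R M by fact
  have "(\<ominus>\<^bsub>R\<^esub> a) \<odot>\<^bsub>M\<^esub> x \<oplus>\<^bsub>M\<^esub> a \<odot>\<^bsub>M\<^esub> x = \<zero>\<^bsub>M\<^esub>"
    using M.smult_l_distr[of "\<ominus>\<^bsub>R\<^esub> a" a x] assms module_zero_smult[OF assms(1,3)] M.R.l_neg by simp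
  then show ?thesis using assms M.smult_closed M.M.minus_equality by simp
qed

lemma module_smult_minus:
  assumes "left_module R M" "a \<in> carrier R" "x \<in> carrier M"
  shows "a \<odot>\<^bsub>M\<^esub> (\<ominus>\<^bsub>M\<^esub> x) = \<ominus>\<^bsub>M\<^esub> (a \<odot>\<^bsub>M\<^esub> x)"
proof -
  interpret M: left_module R M by fact
  have "a \<odot>\<^bsub>M\<^esub> (\<ominus>\<^bsub>M\<^esub> x) \<oplus>\<^bsub>M\<^esub> a \<odot>\<^bsub>M\<^esub> x = \<zero>\<^bsub>M\<^esub>"
    using M.smult_r_distr[of a "\<ominus>\<^bsub>M\<^esub> x" x] assms module_smult_zero[OF assms(1,2)] M.M.l_neg by simp
  then show ?thesis using assms M.smult_closed M.M.minus_equality by simp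
qed

lemma linear_map_zero:
  assumes "left_module R M" "left_module R N" "linear_map R M N f"
  shows "f \<zero>\<^bsub>M\<^esub> = \<zero>\<^bsub>N\<^esub>"
proof -
  interpret M: abelian_group M using left_module_abelian assms(1) .
  interpret N: abelian_group N using left_module_abelian assms(2) .
  have "f \<zero>\<^bsub>M\<^esub> \<oplus>\<^bsub>N\<^esub> f \<zero>\<^bsub>M\<^esub> = f \<zero>\<^bsub>M\<^esub>"
    using linear_map_add[OF assms(3) M.zero_closed M.zero_closed] by simp
  then show ?thesis using N.add.r_cancel_one linear_map_closed[OF assms(3)] by blast
qed

lemma linear_map_minus:
  assumes "left_module R M" "left_module R N" "linear_map R M N f" "x \<in> carrier M"
  shows "f (\<ominus>\<^bsub>M\<^esub> x) = \<ominus>\<^bsub>N\<^esub> f x"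
proof -
  interpret M: abelian_group M using left_module_abelian assms(1) .
  interpret N: abelian_group N using left_module_abelian assms(2) .
  have "f (\<ominus>\<^bsub>M\<^esub> x) \<oplus>\<^bsub>N\<^esub> f x = \<zero>\<^bsub>N\<^esub>"
    using linear_map_add[OF assms(3), of "\<ominus>\<^bsub>M\<^esub> x" x] assms(4) linear_map_zero[OF assms(1-3)] M.l_neg
    by simp
  then show ?thesis using N.minus_equality linear_map_closed[OF assms(3)] assms(4) by simp
qed

lemma linear_map_diff:
  assumes "left_module R M" "left_module R N" "linear_map R M N f" "x \<in> carrier M" "y \<in> carrier M"
  shows "f (x \<ominus>\<^bsub>M\<^esub> y) = f x \<ominus>\<^bsub>N\<^esub> f y"
proof -
  interpret M: abelian_group M using left_module_abelian assms(1) .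
  show ?thesis
    unfolding a_minus_def
    using linear_map_add[OF assms(3), of x "\<ominus>\<^bsub>M\<^esub> y"] linear_map_minus[OF assms(1-3,5)] assms(4,5) by simp
qed

lemma linear_map_plus:
  assumes N: "left_module R N" and f: "linear_map R M N f" and g: "linear_map R M N g"
  shows "linear_map R M N (\<lambda>x. f x \<oplus>\<^bsub>N\<^esub> g x)"
proof -
  interpret N: left_module R N by fact
  note c = linear_map_closed[OF f] linear_map_closed[OF g]
  show ?thesis
    unfolding linear_map_def
  proof (intro conjI ballI)
    show "(\<lambda>x. f x \<oplus>\<^bsub>N\<^esub> g x) \<in> carrier M \<rightarrow> carrier N" using c by simp
    fix x y assume x: "x \<in> carrier M" and y: "y \<in> carrier M"
    show "f (x \<oplus>\<^bsub>M\<^esub> y) \<oplus>\<^bsub>N\<^esub> g (x \<oplus>\<^bsub>M\<^esub> y) = (f x \<oplus>\<^bsub>N\<^esub> g x) \<oplus>\<^bsub>N\<^esub> (f y \<oplus>\<^bsub>N\<^esub> g y)"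
      using c x y by (simp add: linear_map_add[OF f x y] linear_map_add[OF g x y] N.M.a_ac)
  next
    fix a x assume a: "a \<in> carrier R" and x: "x \<in> carrier M"
    show "f (a \<odot>\<^bsub>M\<^esub> x) \<oplus>\<^bsub>N\<^esub> g (a \<odot>\<^bsub>M\<^esub> x) = a \<odot>\<^bsub>N\<^esub> (f x \<oplus>\<^bsub>N\<^esub> g x)"
      using c x a by (simp add: linear_map_smult[OF f a x] linear_map_smult[OF g a x] N.smult_r_distr)
  qed
qed

lemma linear_map_uminus:
  assumes N: "left_module R N" and f: "linear_map R M N f"
  shows "linear_map R M N (\<lambda>x. \<ominus>\<^bsub>N\<^esub> f x)"
proof -
  interpret N: left_module R N by fact
  note c = linear_map_closed[OF f]
  show ?thesis
    unfolding linear_map_def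
  proof (intro conjI ballI)
    show "(\<lambda>x. \<ominus>\<^bsub>N\<^esub> f x) \<in> carrier M \<rightarrow> carrier N" using c by simp
    fix x y assume x: "x \<in> carrier M" and y: "y \<in> carrier M"
    show "\<ominus>\<^bsub>N\<^esub> f (x \<oplus>\<^bsub>M\<^esub> y) = (\<ominus>\<^bsub>N\<^esub> f x) \<oplus>\<^bsub>N\<^esub> (\<ominus>\<^bsub>N\<^esub> f y)"
      using c x y by (simp add: linear_map_add[OF f x y] N.M.minus_add)
  next
    fix a x assume a: "a \<in> carrier R" and x: "x \<in> carrier M"
    show "\<ominus>\<^bsub>N\<^esub> f (a \<odot>\<^bsub>M\<^esub> x) = a \<odot>\<^bsub>N\<^esub> (\<ominus>\<^bsub>N\<^esub> f x)"
      using c x a by (simp add: linear_map_smult[OF f a x] module_smult_minus[OF N])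
  qed
qed

lemma linear_map_const_zero:
  assumes "left_module R N" shows "linear_map R M N (\<lambda>_. \<zero>\<^bsub>N\<^esub>)"
proof -
  interpret N: left_module R N by fact
  show ?thesis unfolding linear_map_def by (simp add: module_smult_zero[OF assms])
qed

lemma linear_map_minus_map:
  assumes N: "left_module R N" and f: "linear_map R M N f" and g: "linear_map R M N g"
  shows "linear_map R M N (\<lambda>x. f x \<ominus>\<^bsub>N\<^esub> g x)"
  unfolding a_minus_def by (rule linear_map_plus[OF N f linear_map_uminus[OF N g]])


section \<open>Submodules and the additive group \<open>A M\<close>\<close>

lemma left_module_sub:
  assumes M: "left_module R M" and S: "S \<subseteq> carrier M" and z: "\<zero>\<^bsub>M\<^esub> \<in> S"
    and add: "\<And>x y. x \<in> S \<Longrightarrow> y \<in> S \<Longrightarrow> x \<oplus>\<^bsub>M\<^esub> y \<in> S"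
    and sm: "\<And>a x. a \<in> carrier R \<Longrightarrow> x \<in> S \<Longrightarrow> a \<odot>\<^bsub>M\<^esub> x \<in> S"
  shows "left_module R (M\<lparr>carrier := S\<rparr>)"
proof -
  interpret M: left_module R M by fact
  have neg: "\<ominus>\<^bsub>M\<^esub> x \<in> S" if "x \<in> S" for x
    using sm[of "\<ominus>\<^bsub>R\<^esub> \<one>\<^bsub>R\<^esub>" x] that S module_minus_smult[OF M, of "\<one>\<^bsub>R\<^esub>" x] M.smult_one[of x]
    by auto
  have "abelian_group (M\<lparr>carrier := S\<rparr>)"
  proof (rule abelian_groupI)
    fix x assume x: "x \<in> carrier (M\<lparr>carrier := S\<rparr>)"
    show "\<exists>y\<in>carrier (M\<lparr>carrier := S\<rparr>). y \<oplus>\<^bsub>M\<lparr>carrier := S\<rparr>\<^esub> x = \<zero>\<^bsub>M\<lparr>carrier := S\<rparr>\<^esub>"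
      using x neg[of x] S M.M.l_neg by auto
  qed (use S z add M.M.a_ac in \<open>auto simp: subset_iff\<close>)
  moreover have "left_module_axioms R (M\<lparr>carrier := S\<rparr>)"
    by unfold_locales
      (use S sm in \<open>auto simp: subset_iff M.smult_l_distr M.smult_r_distr M.smult_assoc M.smult_one\<close>)
  ultimately show ?thesis
    unfolding left_module_def using M.R.ring_axioms by blast
qed

definition kernel_module :: "('r, 'm) module \<Rightarrow> ('r, 'n) module \<Rightarrow> ('m \<Rightarrow> 'n) \<Rightarrow> ('r, 'm) module" where
  "kernel_module P M p = P\<lparr>carrier := {x \<in> carrier P. p x = \<zero>\<^bsub>M\<^esub>}\<rparr>"

lemma kernel_module_simps [simp]:
  "carrier (kernel_module P M p) = {x \<in> carrier P. p x = \<zero>\<^bsub>M\<^esub>}"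
  "\<zero>\<^bsub>kernel_module P M p\<^esub> = \<zero>\<^bsub>P\<^esub>"
  "add (kernel_module P M p) = add P"
  "smult (kernel_module P M p) = smult P"
  unfolding kernel_module_def by simp_all

lemma left_module_kernel:
  assumes "left_module R P" "left_module R M" "linear_map R P M p"
  shows "left_module R (kernel_module P M p)"
proof -
  interpret P: left_module R P by fact
  interpret M: left_module R M by fact
  show ?thesis
    unfolding kernel_module_def
    by (rule left_module_sub[OF assms(1)])
      (use linear_map_zero[OF assms] in \<open>auto simp: linear_map_add[OF assms(3)] linear_map_smult[OF assms(3)]
        module_smult_zero[OF assms(2)] P.smult_closed\<close>)
qed

lemma small_subset: "small U X \<Longrightarrow> Y \<subseteq> X \<Longrightarrow> small U Y"
  unfolding small_def using card_of_mono1 ordLeq_ordLess_trans by blast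

lemma small_module_kernel:
  assumes "small_module U R P" "left_module R M" "linear_map R P M p"
  shows "small_module U R (kernel_module P M p)"
  using assms left_module_kernel[OF small_module_left assms(2,3)] small_subset[of U "carrier P"]
  unfolding small_module_def by auto

lemma linear_map_into_kernel:
  assumes "linear_map R N P f" "\<And>x. x \<in> carrier N \<Longrightarrow> p (f x) = \<zero>\<^bsub>M\<^esub>"
  shows "linear_map R N (kernel_module P M p) f"
  using assms unfolding linear_map_def by auto

lemma linear_map_from_kernel:
  assumes "linear_map R P N f"
  shows "linear_map R (kernel_module P M p) N f"
  using assms unfolding linear_map_def by auto

lemma linear_map_kernels:
  assumes "linear_map R P P' f" "\<And>x. x \<in> carrier P \<Longrightarrow> p x = \<zero>\<^bsub>M\<^esub> \<Longrightarrow> p' (f x) = \<zero>\<^bsub>M'\<^esub>"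
  shows "linear_map R (kernel_module P M p) (kernel_module P' M' p') f"
  using assms unfolding linear_map_def by auto

inductive_set ideal_times :: "'r set \<Rightarrow> ('r, 'm) module \<Rightarrow> 'm set" for A M where
  zero: "\<zero>\<^bsub>M\<^esub> \<in> ideal_times A M"
| step: "a \<in> A \<Longrightarrow> x \<in> carrier M \<Longrightarrow> y \<in> ideal_times A M \<Longrightarrow> a \<odot>\<^bsub>M\<^esub> x \<oplus>\<^bsub>M\<^esub> y \<in> ideal_times A M"

lemma ideal_times_closed:
  assumes "left_module R M" "A \<subseteq> carrier R" "x \<in> ideal_times A M"
  shows "x \<in> carrier M"
  using assms(3)
proof induction
  interpret M: left_module R M by fact
  case zero show ?case by simp
next
  interpret M: left_module R M by fact
  case (step a x y) then show ?case using assms(2) M.smult_closed by auto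
qed

lemma ideal_times_add:
  assumes "left_module R M" "A \<subseteq> carrier R" "x \<in> ideal_times A M" "y \<in> ideal_times A M"
  shows "x \<oplus>\<^bsub>M\<^esub> y \<in> ideal_times A M"
  using assms(3)
proof induction
  interpret M: left_module R M by fact
  case zero show ?case using ideal_times_closed[OF assms(1,2,4)] assms(4) by simp
next
  interpret M: left_module R M by fact
  case (step a x z)
  have "a \<odot>\<^bsub>M\<^esub> x \<oplus>\<^bsub>M\<^esub> z \<oplus>\<^bsub>M\<^esub> y = a \<odot>\<^bsub>M\<^esub> x \<oplus>\<^bsub>M\<^esub> (z \<oplus>\<^bsub>M\<^esub> y)"
    using step ideal_times_closed[OF assms(1,2)] assms(2,4) M.smult_closed
    by (intro M.M.a_assoc) auto
  then show ?case using ideal_times.step[OF step.hyps(1,2) step.IH] by simp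
qed

lemma ideal_times_smult:
  assumes "left_module R M" "A \<subseteq> carrier R" "a \<in> A" "x \<in> carrier M"
  shows "a \<odot>\<^bsub>M\<^esub> x \<in> ideal_times A M"
proof -
  interpret M: left_module R M by fact
  show ?thesis
    using ideal_times.step[OF assms(3,4) ideal_times.zero] M.smult_closed assms by auto
qed

lemma ideal_times_image:
  assumes "left_module R M" "left_module R N" "A \<subseteq> carrier R" "linear_map R M N f" "x \<in> ideal_times A M"
  shows "f x \<in> ideal_times A N"
  using assms(5)
proof induction
  case zero show ?case using linear_map_zero[OF assms(1,2,4)] ideal_times.zero by metis
next
  interpret M: left_module R M by fact
  case (step a x y)
  have "f (a \<odot>\<^bsub>M\<^esub> x \<oplus>\<^bsub>M\<^esub> y) = a \<odot>\<^bsub>N\<^esub> f x \<oplus>\<^bsub>N\<^esub> f y"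
    using step(1,2) assms(3) ideal_times_closed[OF assms(1,3) step.hyps(3)] M.smult_closed
    by (subst linear_map_add[OF assms(4)]) (auto simp: linear_map_smult[OF assms(4)])
  then show ?case
    using ideal_times.step[OF step(1) linear_map_closed[OF assms(4) step(2)] step.IH] by simp
qed

lemma ideal_times_surj:
  assumes "left_module R M" "left_module R N" "A \<subseteq> carrier R" "linear_map R M N f"
    and "f ` carrier M = carrier N" "y \<in> ideal_times A N"
  shows "\<exists>x\<in>ideal_times A M. f x = y"
  using assms(6)
proof induction
  case zero show ?case using linear_map_zero[OF assms(1,2,4)] ideal_times.zero by metis
next
  interpret M: left_module R M by fact
  case (step a x y)
  obtain x' where x': "x' \<in> carrier M" "f x' = x"
    using step(2) assms(5) by (metis imageE)
  obtain y' where y': "y' \<in> ideal_times A M" "f y' = y" using step.IH by blast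
  have "f (a \<odot>\<^bsub>M\<^esub> x' \<oplus>\<^bsub>M\<^esub> y') = a \<odot>\<^bsub>N\<^esub> x \<oplus>\<^bsub>N\<^esub> y"
    using step(1) assms(3) x' y' ideal_times_closed[OF assms(1,3) y'(1)] M.smult_closed
    by (subst linear_map_add[OF assms(4)]) (auto simp: linear_map_smult[OF assms(4)])
  then show ?case using ideal_times.step[OF step(1) x'(1) y'(1)] by blast
qed


section \<open>Comparison of projective presentations\<close>

definition pure_presentation ::
    "'r set \<Rightarrow> ('r, 'm) module \<Rightarrow> ('r, 'n) module \<Rightarrow> ('m \<Rightarrow> 'n) \<Rightarrow> bool" where
  "pure_presentation A P M p \<longleftrightarrow>
     (\<forall>x\<in>ideal_times A P. p x = \<zero>\<^bsub>M\<^esub> \<longrightarrow> x \<in> ideal_times A (kernel_module P M p))"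

definition projective_presentation ::
    "'u set \<Rightarrow> ('r, 'x) ring_scheme \<Rightarrow> ('r, 'u) module \<Rightarrow> ('r, 'u) module \<Rightarrow> ('u \<Rightarrow> 'u) \<Rightarrow> bool" where
  "projective_presentation U R P M p \<longleftrightarrow>
     projective_module U R P \<and> small_module U R M \<and> linear_map R P M p \<and> p ` carrier P = carrier M"

lemma projective_lift:
  assumes P: "projective_module U R P" and M: "small_module U R M" and N: "small_module U R N"
    and f: "linear_map R M N f" and surj: "f ` carrier M = carrier N" and g: "linear_map R P N g"
  shows "\<exists>h. linear_map R P M h \<and> (\<forall>x\<in>carrier P. f (h x) = g x)"
proof -
  have lm: "left_module R M" "left_module R P"
    using M P unfolding projective_module_def small_module_def by blast+
  have "\<exists>h\<in>module_hom R P M. compose (carrier P) (restrict f (carrier M)) h = restrict g (carrier P)"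
    using P M N linear_map_restrict[OF lm(1) f] linear_map_restrict[OF lm(2) g] surj
    unfolding projective_module_def by (simp add: image_restrict_eq)
  then obtain h where h: "h \<in> module_hom R P M"
      "compose (carrier P) (restrict f (carrier M)) h = restrict g (carrier P)" by blast
  have "f (h x) = g x" if "x \<in> carrier P" for x
    using fun_cong[OF h(2), of x] that h(1) linear_map_closed unfolding module_hom_iff
    by (fastforce simp: compose_def)
  then show ?thesis using h(1) unfolding module_hom_iff by blast
qed

text \<open>\<open>K\<close> is a direct summand of \<open>K' \<oplus> K'' \<oplus> Q\<close> with \<open>Q\<close> projective.\<close>

definition stable_retract ::
    "'u set \<Rightarrow> ('r, 'x) ring_scheme \<Rightarrow> ('r, 'u) module \<Rightarrow> ('r, 'u) module \<Rightarrow> ('r, 'u) module \<Rightarrow> bool" where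
  "stable_retract U R K K' K'' \<longleftrightarrow>
     (\<exists>f g f' g' Q a b.
        linear_map R K K' f \<and> linear_map R K' K g \<and> linear_map R K K'' f' \<and> linear_map R K'' K g' \<and>
        projective_module U R Q \<and> linear_map R K Q a \<and> linear_map R Q K b \<and>
        (\<forall>x\<in>carrier K. x = g (f x) \<oplus>\<^bsub>K\<^esub> (g' (f' x) \<oplus>\<^bsub>K\<^esub> b (a x))))"

text \<open>Lifting the summand data to the presentations leaves an error term that factors through \<open>P\<close>
  and takes values in the kernel; hence the relation passes to kernels.\<close>

lemma stable_retract_step:
  assumes AR: "A \<subseteq> carrier R"
    and P: "projective_presentation U R P K p"
    and P': "projective_presentation U R P' K' p'"
    and P'': "projective_presentation U R P'' K'' p''"
    and ret: "stable_retract U R K K' K''"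
  shows "stable_retract U R (kernel_module P K p) (kernel_module P' K' p') (kernel_module P'' K'' p'')"
    and "pure_presentation A P' K' p' \<Longrightarrow> pure_presentation A P'' K'' p'' \<Longrightarrow> pure_presentation A P K p"
proof -
  let ?L = "kernel_module P K p" and ?L' = "kernel_module P' K' p'" and ?L'' = "kernel_module P'' K'' p''"
  have pr: "projective_module U R P" "small_module U R K" "linear_map R P K p" "p ` carrier P = carrier K"
    "projective_module U R P'" "small_module U R K'" "linear_map R P' K' p'" "p' ` carrier P' = carrier K'"
    "projective_module U R P''" "small_module U R K''" "linear_map R P'' K'' p''" "p'' ` carrier P'' = carrier K''"
    using P P' P'' unfolding projective_presentation_def by blast+
  have sP: "small_module U R P" "small_module U R P'" "small_module U R P''"
    using pr unfolding projective_module_def by blast+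
  have lm: "left_module R K" "left_module R K'" "left_module R K''"
    "left_module R P" "left_module R P'" "left_module R P''"
    using small_module_left[OF pr(2)] small_module_left[OF pr(6)] small_module_left[OF pr(10)]
      small_module_left[OF sP(1)] small_module_left[OF sP(2)] small_module_left[OF sP(3)] by simp_all
  have lL: "left_module R ?L" "left_module R ?L'" "left_module R ?L''"
    by (rule left_module_kernel, rule lm, rule lm, rule pr)+
  interpret K: abelian_group K using left_module_abelian lm(1) .
  interpret P: abelian_group P using left_module_abelian lm(4) .
  obtain f g f' g' Q a b where fg: "linear_map R K K' f" "linear_map R K' K g"
      "linear_map R K K'' f'" "linear_map R K'' K g'"
      "projective_module U R Q" "linear_map R K Q a" "linear_map R Q K b"
    and eq: "\<And>x. x \<in> carrier K \<Longrightarrow> x = g (f x) \<oplus>\<^bsub>K\<^esub> (g' (f' x) \<oplus>\<^bsub>K\<^esub> b (a x))"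
    using ret unfolding stable_retract_def by metis
  have lQ: "left_module R Q" using fg(5) unfolding projective_module_def small_module_def by blast
  obtain F where F: "linear_map R P P' F" "\<And>x. x \<in> carrier P \<Longrightarrow> p' (F x) = f (p x)"
    using projective_lift[OF pr(1) sP(2) pr(6,7,8) linear_map_comp[OF pr(3) fg(1)]] by blast
  obtain F' where F': "linear_map R P P'' F'" "\<And>x. x \<in> carrier P \<Longrightarrow> p'' (F' x) = f' (p x)"
    using projective_lift[OF pr(1) sP(3) pr(10,11,12) linear_map_comp[OF pr(3) fg(3)]] by blast
  obtain G where G: "linear_map R P' P G" "\<And>x. x \<in> carrier P' \<Longrightarrow> p (G x) = g (p' x)"
    using projective_lift[OF pr(5) sP(1) pr(2,3,4) linear_map_comp[OF pr(7) fg(2)]] by blast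
  obtain G' where G': "linear_map R P'' P G'" "\<And>x. x \<in> carrier P'' \<Longrightarrow> p (G' x) = g' (p'' x)"
    using projective_lift[OF pr(9) sP(1) pr(2,3,4) linear_map_comp[OF pr(11) fg(4)]] by blast
  obtain B where B: "linear_map R Q P B" "\<And>x. x \<in> carrier Q \<Longrightarrow> p (B x) = b x"
    using projective_lift[OF fg(5) sP(1) pr(2,3,4) fg(7)] by blast
  define s where "s = (\<lambda>x. G (F x) \<oplus>\<^bsub>P\<^esub> (G' (F' x) \<oplus>\<^bsub>P\<^esub> B (a (p x))))"
  define e where "e = (\<lambda>x. x \<ominus>\<^bsub>P\<^esub> s x)"
  have s: "linear_map R P P s"
    unfolding s_def
    by (intro linear_map_plus lm linear_map_comp[OF F(1) G(1)] linear_map_comp[OF F'(1) G'(1)]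
        linear_map_comp[OF pr(3) linear_map_comp[OF fg(6) B(1)]])
  have e: "linear_map R P P e"
    unfolding e_def by (rule linear_map_minus_map[OF lm(4) linear_map_ident s])
  note cl = linear_map_closed[OF F(1)] linear_map_closed[OF G(1)] linear_map_closed[OF F'(1)]
    linear_map_closed[OF G'(1)] linear_map_closed[OF B(1)] linear_map_closed[OF fg(6)]
    linear_map_closed[OF pr(3)] linear_map_closed[OF s] linear_map_closed[OF e]
  have ps: "p (s x) = p x" if x: "x \<in> carrier P" for x
  proof -
    have "p (s x) = p (G (F x)) \<oplus>\<^bsub>K\<^esub> (p (G' (F' x)) \<oplus>\<^bsub>K\<^esub> p (B (a (p x))))"
      unfolding s_def using x cl by (simp add: linear_map_add[OF pr(3)])
    also have "\<dots> = g (f (p x)) \<oplus>\<^bsub>K\<^esub> (g' (f' (p x)) \<oplus>\<^bsub>K\<^esub> b (a (p x)))"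
      using x cl F(2) G(2) F'(2) G'(2) B(2) by simp
    also have "\<dots> = p x" using eq[of "p x"] x cl by simp
    finally show ?thesis .
  qed
  have pe: "p (e x) = \<zero>\<^bsub>K\<^esub>" if x: "x \<in> carrier P" for x
    unfolding e_def
    using linear_map_diff[OF lm(4,1) pr(3) x cl(8)[OF x]] ps[OF x] x cl
    by (simp add: a_minus_def K.r_neg)
  have eL: "linear_map R P ?L e"
    using linear_map_into_kernel[OF e, where p = p and M = K] pe by blast
  have lz: "f \<zero>\<^bsub>K\<^esub> = \<zero>\<^bsub>K'\<^esub>" "f' \<zero>\<^bsub>K\<^esub> = \<zero>\<^bsub>K''\<^esub>" "g \<zero>\<^bsub>K'\<^esub> = \<zero>\<^bsub>K\<^esub>" "g' \<zero>\<^bsub>K''\<^esub> = \<zero>\<^bsub>K\<^esub>"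
    "a \<zero>\<^bsub>K\<^esub> = \<zero>\<^bsub>Q\<^esub>" "B \<zero>\<^bsub>Q\<^esub> = \<zero>\<^bsub>P\<^esub>"
    by (rule linear_map_zero[of R], rule lm lQ, rule lm lQ, rule fg B(1))+
  have FL: "linear_map R ?L ?L' F" "linear_map R ?L ?L'' F'" "linear_map R ?L' ?L G" "linear_map R ?L'' ?L G'"
    by (rule linear_map_kernels, rule F F' G G', simp add: F(2) F'(2) G(2) G'(2) lz)+
  have dec: "x = G (F x) \<oplus>\<^bsub>P\<^esub> (G' (F' x) \<oplus>\<^bsub>P\<^esub> e x)" if x: "x \<in> carrier P" "p x = \<zero>\<^bsub>K\<^esub>" for x
  proof -
    have "s x = G (F x) \<oplus>\<^bsub>P\<^esub> G' (F' x)" unfolding s_def using x lz cl by simp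
    moreover have "x = s x \<oplus>\<^bsub>P\<^esub> e x"
      unfolding e_def a_minus_def using x(1) cl(8)[OF x(1)] P.a_lcomm[of "s x" x "\<ominus>\<^bsub>P\<^esub> s x"]
      by (simp add: P.r_neg)
    ultimately show ?thesis using x cl by (simp add: P.a_assoc)
  qed
  show "stable_retract U R ?L ?L' ?L''"
    unfolding stable_retract_def
  proof (intro exI conjI)
    show "linear_map R ?L ?L' F" "linear_map R ?L ?L'' F'" "linear_map R ?L' ?L G" "linear_map R ?L'' ?L G'"
      by (rule FL)+
    show "projective_module U R P" by (rule pr)
    show "linear_map R ?L P (\<lambda>x. x)" by (rule linear_map_from_kernel[OF linear_map_ident])
    show "linear_map R P ?L e" by (rule eL)
    show "\<forall>x\<in>carrier ?L. x = G (F x) \<oplus>\<^bsub>?L\<^esub> (G' (F' x) \<oplus>\<^bsub>?L\<^esub> e x)"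
      using dec by simp
  qed
  show "pure_presentation A P K p"
    if pure: "pure_presentation A P' K' p'" "pure_presentation A P'' K'' p''"
    unfolding pure_presentation_def
  proof (intro ballI impI)
    fix x assume x: "x \<in> ideal_times A P" and px: "p x = \<zero>\<^bsub>K\<^esub>"
    have xP: "x \<in> carrier P" using ideal_times_closed[OF lm(4) AR x] .
    have "F x \<in> ideal_times A ?L'"
      using pure(1) ideal_times_image[OF lm(4,5) AR F(1) x] F(2)[OF xP] px lz
      unfolding pure_presentation_def by simp
    then have 1: "G (F x) \<in> ideal_times A ?L" by (rule ideal_times_image[OF lL(2,1) AR FL(3)])
    have "F' x \<in> ideal_times A ?L''"
      using pure(2) ideal_times_image[OF lm(4,6) AR F'(1) x] F'(2)[OF xP] px lz
      unfolding pure_presentation_def by simp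
    then have 2: "G' (F' x) \<in> ideal_times A ?L" by (rule ideal_times_image[OF lL(3,1) AR FL(4)])
    have 3: "e x \<in> ideal_times A ?L" by (rule ideal_times_image[OF lm(4) lL(1) AR eL x])
    show "x \<in> ideal_times A ?L"
      using ideal_times_add[OF lL(1) AR 1 ideal_times_add[OF lL(1) AR 2 3]] dec[OF xP px] by simp
  qed
qed

definition presentation_sequence ::
    "'u set \<Rightarrow> ('r, 'x) ring_scheme \<Rightarrow> (nat \<Rightarrow> ('r, 'u) module) \<Rightarrow> (nat \<Rightarrow> ('r, 'u) module) \<Rightarrow> (nat \<Rightarrow> 'u \<Rightarrow> 'u) \<Rightarrow> bool" where
  "presentation_sequence U R P K p \<longleftrightarrow>
     (\<forall>n. projective_presentation U R (P n) (K n) (p n) \<and> K (Suc n) = kernel_module (P n) (K n) (p n))"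

lemma presentation_sequence_compare:
  assumes AR: "A \<subseteq> carrier R"
    and P: "presentation_sequence U R P K p"
    and P': "presentation_sequence U R P' K' p'"
    and P'': "presentation_sequence U R P'' K'' p''"
    and ret: "stable_retract U R (K 0) (K' 0) (K'' 0)"
    and pure: "pure_presentation A (P' n) (K' n) (p' n)" "pure_presentation A (P'' n) (K'' n) (p'' n)"
  shows "pure_presentation A (P n) (K n) (p n)"
proof -
  note step = stable_retract_step[OF AR, of U "P m" "K m" "p m" "P' m" "K' m" "p' m" "P'' m" "K'' m" "p'' m" for m]
  have "stable_retract U R (K m) (K' m) (K'' m)" for m
  proof (induction m)
    case 0 then show ?case by (rule ret)
  next
    case (Suc m) then show ?case
      using step(1)[of m] P P' P'' unfolding presentation_sequence_def by simp
  qed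
  then show ?thesis
    using step(2)[of n] P P' P'' pure unfolding presentation_sequence_def by simp
qed


section \<open>Free modules inside the universe\<close>

definition fin_funs :: "('r, 'x) ring_scheme \<Rightarrow> 'u set \<Rightarrow> ('u \<Rightarrow> 'r) set" where
  "fin_funs R X = {g. (\<forall>x. g x \<in> carrier R) \<and> finite {x. g x \<noteq> \<zero>\<^bsub>R\<^esub>} \<and> {x. g x \<noteq> \<zero>\<^bsub>R\<^esub>} \<subseteq> X}"

lemma card_fin_funs:
  fixes R :: "('r, 'x) ring_scheme" and X :: "'u set"
  assumes W: "infinite W" and X: "|X| \<le>o |W|" and R: "|carrier R| \<le>o |W|"
  shows "|fin_funs R X| \<le>o |W|"
proof -
  define gr where "gr = (\<lambda>g :: 'u \<Rightarrow> 'r. {(x, g x) | x. g x \<noteq> \<zero>\<^bsub>R\<^esub>})"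
  have "inj_on gr (fin_funs R X)"
  proof (rule inj_onI, rule ext)
    fix g h x assume eq: "gr g = gr h"
    have "(x, y) \<in> gr g \<longleftrightarrow> g x = y \<and> y \<noteq> \<zero>\<^bsub>R\<^esub>" "(x, y) \<in> gr h \<longleftrightarrow> h x = y \<and> y \<noteq> \<zero>\<^bsub>R\<^esub>" for y
      unfolding gr_def by auto
    then show "g x = h x" using eq by (metis (no_types))
  qed
  moreover have "gr ` fin_funs R X \<subseteq> Fpow (X \<times> carrier R)"
  proof
    fix s assume "s \<in> gr ` fin_funs R X"
    then obtain g where g: "g \<in> fin_funs R X" "s = gr g" by blast
    have "s = (\<lambda>x. (x, g x)) ` {x. g x \<noteq> \<zero>\<^bsub>R\<^esub>}" unfolding g(2) gr_def by blast
    then show "s \<in> Fpow (X \<times> carrier R)" using g(1) unfolding fin_funs_def Fpow_def by auto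
  qed
  ultimately have "|fin_funs R X| \<le>o |Fpow (X \<times> carrier R)|"
    using card_of_ordLeq by blast
  also have "|Fpow (X \<times> carrier R)| \<le>o |Fpow W|"
    by (rule card_of_Fpow_mono[OF card_of_Times_ordLeq_infinite[OF W X R]])
  also have "|Fpow W| =o |W|" by (rule card_of_Fpow_infinite[OF W])
  finally show ?thesis .
qed

locale ideal_in_universe =
  fixes R :: "('r, 'x) ring_scheme" (structure) and A :: "'r set" and U :: "'u set"
  assumes R_ring: "ring R" and A_ideal: "ideal A R" and universe: "universe_for R U"

sublocale ideal_in_universe \<subseteq> R: ring R by (rule R_ring)

context ideal_in_universe
begin

lemma A_sub: "A \<subseteq> carrier R"
  by (auto intro: ideal.Icarr[OF A_ideal])

lemma infinite_U: "infinite U"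
  using universe unfolding universe_for_def small_def
  by (metis card_of_ordLeq_finite infinite_UNIV_nat ordLess_imp_ordLeq)

lemma regular_U: "regularCard |U|"
  and small_nat: "small U (UNIV :: nat set)"
  and small_R: "small U (carrier R)"
  using universe unfolding universe_for_def by auto

definition \<Lambda> :: "('r + nat) set" where "\<Lambda> = Sum_Type.Plus (carrier R) (UNIV :: nat set)"

lemma infinite_\<Lambda>: "infinite \<Lambda>"
  unfolding \<Lambda>_def by simp

lemma R_le_\<Lambda>: "|carrier R| \<le>o |\<Lambda>|"
  unfolding \<Lambda>_def by (rule card_of_Plus1)

lemma nat_le_\<Lambda>: "|UNIV :: nat set| \<le>o |\<Lambda>|"
  unfolding \<Lambda>_def by (rule card_of_Plus2)

lemma small_\<Lambda>: "small U \<Lambda>"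
  using card_of_Plus_ordLess_infinite[OF infinite_U] small_R small_nat
  unfolding small_def \<Lambda>_def by blast

text \<open>One fixed encoding of all finitely supported functions makes \<open>X \<mapsto> free_module X\<close> iterable within \<open>U\<close>.\<close>

definition enc :: "('u \<Rightarrow> 'r) \<Rightarrow> 'u" where
  "enc = (SOME e. inj_on e (fin_funs R U) \<and> e ` fin_funs R U \<subseteq> U)"

definition dec :: "'u \<Rightarrow> 'u \<Rightarrow> 'r" where
  "dec = inv_into (fin_funs R U) enc"

lemma enc: "inj_on enc (fin_funs R U)" "enc ` fin_funs R U \<subseteq> U"
proof -
  have "|fin_funs R U| \<le>o |U|"
    using card_fin_funs[OF infinite_U card_of_mono1[OF subset_refl]] small_R ordLess_imp_ordLeq
    unfolding small_def by blast
  then have "\<exists>e. inj_on e (fin_funs R U) \<and> e ` fin_funs R U \<subseteq> U"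
    using card_of_ordLeq by blast
  then have "inj_on enc (fin_funs R U) \<and> enc ` fin_funs R U \<subseteq> U"
    unfolding enc_def by (rule someI_ex)
  then show "inj_on enc (fin_funs R U)" "enc ` fin_funs R U \<subseteq> U" by blast+
qed

lemma fin_funs_mono: "X \<subseteq> Y \<Longrightarrow> fin_funs R X \<subseteq> fin_funs R Y"
  unfolding fin_funs_def by blast

lemma dec_enc: "g \<in> fin_funs R U \<Longrightarrow> dec (enc g) = g"
  unfolding dec_def by (rule inv_into_f_f[OF enc(1)])

definition free_module :: "'u set \<Rightarrow> ('r, 'u) module" where
  "free_module X =
     \<lparr>carrier = enc ` fin_funs R X, mult = undefined, one = undefined,
      zero = enc (\<lambda>_. \<zero>), add = (\<lambda>u v. enc (\<lambda>x. dec u x \<oplus> dec v x)),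
      smult = (\<lambda>a u. enc (\<lambda>x. a \<otimes> dec u x))\<rparr>"

lemma fin_funs_zero: "(\<lambda>_. \<zero>) \<in> fin_funs R X"
  unfolding fin_funs_def by simp

lemma fin_funs_add:
  assumes "g \<in> fin_funs R X" "h \<in> fin_funs R X"
  shows "(\<lambda>x. g x \<oplus> h x) \<in> fin_funs R X"
proof -
  have "{x. g x \<oplus> h x \<noteq> \<zero>} \<subseteq> {x. g x \<noteq> \<zero>} \<union> {x. h x \<noteq> \<zero>}" by auto
  then show ?thesis
    using assms unfolding fin_funs_def by (auto intro: finite_subset)
qed

lemma fin_funs_smult:
  assumes "g \<in> fin_funs R X" "a \<in> carrier R"
  shows "(\<lambda>x. a \<otimes> g x) \<in> fin_funs R X"
proof -
  have "{x. a \<otimes> g x \<noteq> \<zero>} \<subseteq> {x. g x \<noteq> \<zero>}" using assms(2) by auto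
  then show ?thesis
    using assms unfolding fin_funs_def by (auto intro: finite_subset)
qed

lemma fin_funs_delta:
  assumes "x \<in> X"
  shows "(\<lambda>y. if y = x then \<one> else \<zero>) \<in> fin_funs R X"
proof -
  have "{y. (if y = x then \<one> else \<zero>) \<noteq> \<zero>} \<subseteq> {x}" by auto
  then show ?thesis using assms finite_subset unfolding fin_funs_def by fastforce
qed

lemma in_free_module_iff:
  assumes "X \<subseteq> U"
  shows "u \<in> carrier (free_module X) \<longleftrightarrow> (dec u \<in> fin_funs R X \<and> enc (dec u) = u)"
proof
  assume "u \<in> carrier (free_module X)"
  then obtain g where "g \<in> fin_funs R X" "u = enc g" unfolding free_module_def by auto
  then show "dec u \<in> fin_funs R X \<and> enc (dec u) = u"
    using dec_enc fin_funs_mono[OF assms] by auto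
next
  assume "dec u \<in> fin_funs R X \<and> enc (dec u) = u"
  then show "u \<in> carrier (free_module X)" unfolding free_module_def by (metis imageI partial_object.select_convs(1))
qed

lemma dec_free:
  assumes "X \<subseteq> U"
  shows "u \<in> carrier (free_module X) \<Longrightarrow> dec u \<in> fin_funs R X"
    and "dec \<zero>\<^bsub>free_module X\<^esub> = (\<lambda>_. \<zero>)"
    and "u \<in> carrier (free_module X) \<Longrightarrow> v \<in> carrier (free_module X) \<Longrightarrow>
      dec (u \<oplus>\<^bsub>free_module X\<^esub> v) = (\<lambda>x. dec u x \<oplus> dec v x)"
    and "a \<in> carrier R \<Longrightarrow> u \<in> carrier (free_module X) \<Longrightarrow>
      dec (a \<odot>\<^bsub>free_module X\<^esub> u) = (\<lambda>x. a \<otimes> dec u x)"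
  using in_free_module_iff[OF assms] fin_funs_mono[OF assms] dec_enc[OF fin_funs_zero]
    dec_enc[OF fin_funs_add] dec_enc[OF fin_funs_smult]
  unfolding free_module_def by (auto simp: subset_iff)

lemma dec_eq_iff:
  assumes "X \<subseteq> U" "u \<in> carrier (free_module X)" "v \<in> carrier (free_module X)"
  shows "u = v \<longleftrightarrow> (\<forall>x. dec u x = dec v x)"
  using in_free_module_iff[OF assms(1)] assms(2,3) by (metis ext)

lemma dec_closed: "X \<subseteq> U \<Longrightarrow> u \<in> carrier (free_module X) \<Longrightarrow> dec u x \<in> carrier R"
  using dec_free(1) unfolding fin_funs_def by blast

lemma finite_dec_support: "X \<subseteq> U \<Longrightarrow> u \<in> carrier (free_module X) \<Longrightarrow> finite {x. dec u x \<noteq> \<zero>}"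
  using dec_free(1) unfolding fin_funs_def by blast

lemma dec_support: "X \<subseteq> U \<Longrightarrow> u \<in> carrier (free_module X) \<Longrightarrow> {x. dec u x \<noteq> \<zero>} \<subseteq> X"
  using dec_free(1) unfolding fin_funs_def by blast

lemma left_module_free:
  assumes X: "X \<subseteq> U"
  shows "left_module R (free_module X)"
proof -
  let ?F = "free_module X"
  note eq = dec_eq_iff[OF X] and dc = dec_closed[OF X] and d = dec_free(2,3,4)[OF X]
  have c: "enc g \<in> carrier ?F" if "g \<in> fin_funs R X" for g
    using that unfolding free_module_def by simp
  have z: "\<zero>\<^bsub>?F\<^esub> \<in> carrier ?F"
    using c[OF fin_funs_zero] by (simp add: free_module_def)
  have pl: "u \<oplus>\<^bsub>?F\<^esub> v \<in> carrier ?F" if "u \<in> carrier ?F" "v \<in> carrier ?F" for u v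
    using c[OF fin_funs_add[OF dec_free(1)[OF X that(1)] dec_free(1)[OF X that(2)]]]
    by (simp add: free_module_def)
  have sm: "a \<odot>\<^bsub>?F\<^esub> u \<in> carrier ?F" if "a \<in> carrier R" "u \<in> carrier ?F" for a u
    using c[OF fin_funs_smult[OF dec_free(1)[OF X that(2)] that(1)]] by (simp add: free_module_def)
  note cl = z pl sm
  have "abelian_group ?F"
  proof (rule abelian_groupI)
    fix u assume u: "u \<in> carrier ?F"
    have m: "(\<ominus> \<one>) \<odot>\<^bsub>?F\<^esub> u \<in> carrier ?F" by (rule sm[OF R.a_inv_closed[OF R.one_closed] u])
    show "\<exists>v\<in>carrier ?F. v \<oplus>\<^bsub>?F\<^esub> u = \<zero>\<^bsub>?F\<^esub>"
      by (rule bexI[OF _ m])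
        (use u m cl dc in \<open>simp add: eq d R.l_minus R.l_neg\<close>)
  next
    fix u v w assume "u \<in> carrier ?F" "v \<in> carrier ?F" "w \<in> carrier ?F"
    then show "(u \<oplus>\<^bsub>?F\<^esub> v) \<oplus>\<^bsub>?F\<^esub> w = u \<oplus>\<^bsub>?F\<^esub> (v \<oplus>\<^bsub>?F\<^esub> w)"
      using cl dc by (simp add: eq d R.a_assoc)
  next
    fix u v assume "u \<in> carrier ?F" "v \<in> carrier ?F"
    then show "u \<oplus>\<^bsub>?F\<^esub> v = v \<oplus>\<^bsub>?F\<^esub> u"
      using cl dc by (simp add: eq d R.a_comm)
  next
    fix u assume "u \<in> carrier ?F"
    then show "\<zero>\<^bsub>?F\<^esub> \<oplus>\<^bsub>?F\<^esub> u = u" using cl dc by (simp add: eq d)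
  qed (simp_all add: cl)
  moreover have "left_module_axioms R ?F"
    by unfold_locales (use cl dc in \<open>simp_all add: eq d R.l_distr R.r_distr R.m_assoc\<close>)
  ultimately show ?thesis unfolding left_module_def using R.ring_axioms by blast
qed

lemma card_free_module:
  assumes "infinite W" "|X| \<le>o |W|" "|carrier R| \<le>o |W|"
  shows "|carrier (free_module X)| \<le>o |W|"
  using ordLeq_transitive[OF card_of_image card_fin_funs[OF assms]] unfolding free_module_def by simp

lemma small_union: "small U X \<Longrightarrow> small U Y \<Longrightarrow> small U (Sum_Type.Plus X Y)"
  unfolding small_def using card_of_Plus_ordLess_infinite[OF infinite_U] by blast

lemma small_le: "|X| \<le>o |Y| \<Longrightarrow> small U Y \<Longrightarrow> small U X"
  unfolding small_def by (rule ordLeq_ordLess_trans)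

lemma small_module_free:
  assumes X: "X \<subseteq> U" "small U X"
  shows "small_module U R (free_module X)"
proof -
  have W: "small U (Sum_Type.Plus X \<Lambda>)" by (rule small_union[OF X(2) small_\<Lambda>])
  have "|carrier (free_module X)| \<le>o |Sum_Type.Plus X \<Lambda>|"
    by (rule card_free_module)
      (use infinite_\<Lambda> card_of_Plus1 ordLeq_transitive[OF R_le_\<Lambda> card_of_Plus2] in simp_all)
  moreover have "carrier (free_module X) \<subseteq> U"
    using enc(2) fin_funs_mono[OF X(1)] unfolding free_module_def by auto
  ultimately show ?thesis
    unfolding small_module_def using left_module_free[OF X(1)] small_le[OF _ W] by blast
qed

definition basis :: "'u \<Rightarrow> 'u" where
  "basis x = enc (\<lambda>y. if y = x then \<one> else \<zero>)"

lemma basis_closed: "x \<in> X \<Longrightarrow> basis x \<in> carrier (free_module X)"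
  unfolding basis_def free_module_def by (simp, rule imageI, rule fin_funs_delta)

lemma dec_basis: "x \<in> U \<Longrightarrow> dec (basis x) = (\<lambda>y. if y = x then \<one> else \<zero>)"
  unfolding basis_def by (rule dec_enc[OF fin_funs_delta])

lemma free_module_induct [consumes 2, case_names zero step]:
  assumes X: "X \<subseteq> U" and u: "u \<in> carrier (free_module X)"
    and zero: "P \<zero>\<^bsub>free_module X\<^esub>"
    and step: "\<And>r x v. r \<in> carrier R \<Longrightarrow> x \<in> X \<Longrightarrow> v \<in> carrier (free_module X) \<Longrightarrow> P v \<Longrightarrow>
      P (r \<odot>\<^bsub>free_module X\<^esub> basis x \<oplus>\<^bsub>free_module X\<^esub> v)"
  shows "P u"
proof -
  let ?F = "free_module X"
  interpret F: left_module R ?F by (rule left_module_free[OF X])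
  have "\<forall>u\<in>carrier ?F. {x. dec u x \<noteq> \<zero>} \<subseteq> B \<longrightarrow> P u" if "finite B" for B
    using that
  proof induction
    case empty
    have "u = \<zero>\<^bsub>?F\<^esub>" if "u \<in> carrier ?F" "{x. dec u x \<noteq> \<zero>} \<subseteq> {}" for u
      using dec_eq_iff[OF X that(1) F.M.zero_closed] that(2) dec_free(2)[OF X] by auto
    then show ?case using zero by blast
  next
    case (insert b B)
    show ?case
    proof (intro ballI impI)
      fix u assume u: "u \<in> carrier ?F" and sup: "{x. dec u x \<noteq> \<zero>} \<subseteq> insert b B"
      show "P u"
      proof (cases "dec u b = \<zero>")
        case True
        then have "{x. dec u x \<noteq> \<zero>} \<subseteq> B" using sup by auto
        then show ?thesis using insert.IH u by blast
      next
        case False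
        then have b: "b \<in> X" using dec_support[OF X u] by blast
        let ?r = "dec u b"
        have r: "?r \<in> carrier R" by (rule dec_closed[OF X u])
        have bc: "basis b \<in> carrier ?F" by (rule basis_closed[OF b])
        have db: "dec (basis b) = (\<lambda>y. if y = b then \<one> else \<zero>)" using dec_basis b X by blast
        define v where "v = (\<ominus> ?r) \<odot>\<^bsub>?F\<^esub> basis b \<oplus>\<^bsub>?F\<^esub> u"
        have rb: "(\<ominus> ?r) \<odot>\<^bsub>?F\<^esub> basis b \<in> carrier ?F" "?r \<odot>\<^bsub>?F\<^esub> basis b \<in> carrier ?F"
          using F.smult_closed r bc by simp_all
        have v: "v \<in> carrier ?F" unfolding v_def using rb u by simp
        have dv: "dec v x = (if x = b then \<zero> else dec u x)" for x
          unfolding v_def using r bc rb u db dec_closed[OF X u]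
          by (simp add: dec_free(3,4)[OF X] R.l_neg)
        then have "{x. dec v x \<noteq> \<zero>} \<subseteq> B" using sup by auto
        then have "P v" using insert.IH v by blast
        then have "P (?r \<odot>\<^bsub>?F\<^esub> basis b \<oplus>\<^bsub>?F\<^esub> v)" by (rule step[OF r b v])
        moreover have "?r \<odot>\<^bsub>?F\<^esub> basis b \<oplus>\<^bsub>?F\<^esub> v = u"
          using r bc rb u v db dv dec_closed[OF X u]
          by (simp add: dec_eq_iff[OF X] dec_free(3,4)[OF X])
        ultimately show ?thesis by simp
      qed
    qed
  qed
  then show ?thesis using finite_dec_support[OF X u] u by blast
qed

lemma free_map_unique:
  assumes X: "X \<subseteq> U" and N: "left_module R N"
    and f: "linear_map R (free_module X) N f" and g: "linear_map R (free_module X) N g"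
    and eq: "\<And>x. x \<in> X \<Longrightarrow> f (basis x) = g (basis x)" and u: "u \<in> carrier (free_module X)"
  shows "f u = g u"
  using X u
proof (induction rule: free_module_induct)
  case zero
  show ?case
    using linear_map_zero[OF left_module_free[OF X] N] f g by metis
next
  case (step r x v)
  interpret F: left_module R "free_module X" by (rule left_module_free[OF X])
  have b: "basis x \<in> carrier (free_module X)" by (rule basis_closed[OF step(2)])
  show ?case
    using step b F.smult_closed eq
    by (simp add: linear_map_add[OF f] linear_map_add[OF g] linear_map_smult[OF f] linear_map_smult[OF g])
qed

definition free_lift :: "('r, 'n) module \<Rightarrow> ('u \<Rightarrow> 'n) \<Rightarrow> 'u \<Rightarrow> 'n" where
  "free_lift N h u = (\<Oplus>\<^bsub>N\<^esub>x\<in>{x. dec u x \<noteq> \<zero>}. dec u x \<odot>\<^bsub>N\<^esub> h x)"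

lemma free_lift_superset:
  assumes X: "X \<subseteq> U" and N: "left_module R N" and h: "h \<in> X \<rightarrow> carrier N"
    and u: "u \<in> carrier (free_module X)" and B: "finite B" "{x. dec u x \<noteq> \<zero>} \<subseteq> B" "B \<subseteq> X"
  shows "free_lift N h u = (\<Oplus>\<^bsub>N\<^esub>x\<in>B. dec u x \<odot>\<^bsub>N\<^esub> h x)"
proof -
  interpret N: left_module R N by (rule N)
  have c: "dec u x \<odot>\<^bsub>N\<^esub> h x \<in> carrier N" if "x \<in> X" for x
    using N.smult_closed dec_closed[OF X u] h that by blast
  show ?thesis
    unfolding free_lift_def
    by (rule N.M.add.finprod_mono_neutral_cong_left)
      (use B c module_zero_smult[OF N] h in \<open>auto simp: Pi_iff subset_iff\<close>)
qed

lemma module_smult_finsum: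
  assumes N: "left_module R N" and "finite B" "a \<in> carrier R" "f \<in> B \<rightarrow> carrier N"
  shows "a \<odot>\<^bsub>N\<^esub> (\<Oplus>\<^bsub>N\<^esub>x\<in>B. f x) = (\<Oplus>\<^bsub>N\<^esub>x\<in>B. a \<odot>\<^bsub>N\<^esub> f x)"
  using assms(2,4)
proof induction
  interpret N: left_module R N by (rule N)
  case empty then show ?case using module_smult_zero[OF N assms(3)] by simp
next
  interpret N: left_module R N by (rule N)
  case (insert b B)
  then show ?case
    using assms(3) N.smult_closed
    by (subst (1 2) N.M.finsum_insert) (auto simp: N.smult_r_distr Pi_iff)
qed

lemma free_lift_linear:
  assumes X: "X \<subseteq> U" and N: "left_module R N" and h: "h \<in> X \<rightarrow> carrier N"
  shows "linear_map R (free_module X) N (free_lift N h)"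
proof -
  let ?F = "free_module X"
  interpret N: left_module R N by (rule N)
  interpret F: left_module R ?F by (rule left_module_free[OF X])
  note sup = free_lift_superset[OF X N h]
  note S = finite_dec_support[OF X] dec_support[OF X]
  have c: "dec u x \<odot>\<^bsub>N\<^esub> h x \<in> carrier N" if "x \<in> X" "u \<in> carrier ?F" for x u
    using N.smult_closed dec_closed[OF X that(2)] h that by blast
  show ?thesis
    unfolding linear_map_def
  proof (intro conjI ballI)
    show "free_lift N h \<in> carrier ?F \<rightarrow> carrier N"
      unfolding free_lift_def using S(2) c by (auto intro!: N.M.finsum_closed)
  next
    fix u v assume u: "u \<in> carrier ?F" and v: "v \<in> carrier ?F"
    let ?B = "{x. dec u x \<noteq> \<zero>} \<union> {x. dec v x \<noteq> \<zero>}"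
    have uv: "u \<oplus>\<^bsub>?F\<^esub> v \<in> carrier ?F" using u v by simp
    have d: "dec (u \<oplus>\<^bsub>?F\<^esub> v) = (\<lambda>x. dec u x \<oplus> dec v x)" by (rule dec_free(3)[OF X u v])
    have B: "finite ?B" "?B \<subseteq> X" using S u v by blast+
    have "{x. dec (u \<oplus>\<^bsub>?F\<^esub> v) x \<noteq> \<zero>} \<subseteq> ?B" unfolding d by auto
    then have "free_lift N h (u \<oplus>\<^bsub>?F\<^esub> v) = (\<Oplus>\<^bsub>N\<^esub>x\<in>?B. (dec u x \<oplus> dec v x) \<odot>\<^bsub>N\<^esub> h x)"
      using sup[OF uv B(1) _ B(2)] unfolding d by blast
    also have "\<dots> = (\<Oplus>\<^bsub>N\<^esub>x\<in>?B. dec u x \<odot>\<^bsub>N\<^esub> h x \<oplus>\<^bsub>N\<^esub> dec v x \<odot>\<^bsub>N\<^esub> h x)"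
      using B c u v h dec_closed[OF X]
      by (intro N.M.finsum_cong') (auto intro!: N.smult_l_distr)
    also have "\<dots> = (\<Oplus>\<^bsub>N\<^esub>x\<in>?B. dec u x \<odot>\<^bsub>N\<^esub> h x) \<oplus>\<^bsub>N\<^esub> (\<Oplus>\<^bsub>N\<^esub>x\<in>?B. dec v x \<odot>\<^bsub>N\<^esub> h x)"
      using B c u v by (intro N.M.finsum_addf) auto
    also have "\<dots> = free_lift N h u \<oplus>\<^bsub>N\<^esub> free_lift N h v"
      using sup[OF u B(1) _ B(2)] sup[OF v B(1) _ B(2)] by simp
    finally show "free_lift N h (u \<oplus>\<^bsub>?F\<^esub> v) = free_lift N h u \<oplus>\<^bsub>N\<^esub> free_lift N h v" .
  next
    fix a u assume a: "a \<in> carrier R" and u: "u \<in> carrier ?F"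
    let ?B = "{x. dec u x \<noteq> \<zero>}"
    have au: "a \<odot>\<^bsub>?F\<^esub> u \<in> carrier ?F" using a u F.smult_closed by simp
    have d: "dec (a \<odot>\<^bsub>?F\<^esub> u) = (\<lambda>x. a \<otimes> dec u x)" by (rule dec_free(4)[OF X a u])
    have B: "finite ?B" "?B \<subseteq> X" using S u by blast+
    have "{x. dec (a \<odot>\<^bsub>?F\<^esub> u) x \<noteq> \<zero>} \<subseteq> ?B" unfolding d using a by auto
    then have "free_lift N h (a \<odot>\<^bsub>?F\<^esub> u) = (\<Oplus>\<^bsub>N\<^esub>x\<in>?B. (a \<otimes> dec u x) \<odot>\<^bsub>N\<^esub> h x)"
      using sup[OF au B(1) _ B(2)] unfolding d by blast
    also have "\<dots> = (\<Oplus>\<^bsub>N\<^esub>x\<in>?B. a \<odot>\<^bsub>N\<^esub> (dec u x \<odot>\<^bsub>N\<^esub> h x))"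
      using B c u a h dec_closed[OF X u] N.smult_closed
      by (intro N.M.finsum_cong') (auto intro!: N.smult_assoc simp: subset_iff)
    also have "\<dots> = a \<odot>\<^bsub>N\<^esub> free_lift N h u"
      unfolding free_lift_def using B c u a
      by (intro module_smult_finsum[OF N, symmetric]) auto
    finally show "free_lift N h (a \<odot>\<^bsub>?F\<^esub> u) = a \<odot>\<^bsub>N\<^esub> free_lift N h u" .
  qed
qed

lemma free_lift_basis:
  assumes X: "X \<subseteq> U" and N: "left_module R N" and h: "h \<in> X \<rightarrow> carrier N" and x: "x \<in> X"
  shows "free_lift N h (basis x) = h x"
proof -
  interpret N: left_module R N by (rule N)
  have d: "dec (basis x) = (\<lambda>y. if y = x then \<one> else \<zero>)" using dec_basis x X by blast
  have hx: "h x \<in> carrier N" using h x by blast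
  have "free_lift N h (basis x) = (\<Oplus>\<^bsub>N\<^esub>y\<in>{x}. dec (basis x) y \<odot>\<^bsub>N\<^esub> h y)"
    by (rule free_lift_superset[OF X N h basis_closed[OF x]]) (use x d in auto)
  also have "\<dots> = h x"
    using hx N.smult_one[OF hx] N.M.finsum_insert[of "{}" x] unfolding d by simp
  finally show ?thesis .
qed

lemma projective_free:
  assumes X: "X \<subseteq> U" "small U X"
  shows "projective_module U R (free_module X)"
  unfolding projective_module_def
proof (intro conjI allI impI)
  let ?F = "free_module X"
  show "small_module U R ?F" by (rule small_module_free[OF X])
  fix M N :: "('r, 'u) module" and f g
  assume a: "small_module U R M \<and> small_module U R N \<and> f \<in> module_hom R M N \<and> f ` carrier M = carrier N \<and>
    g \<in> module_hom R ?F N"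
  have M: "left_module R M" and N: "left_module R N" using a small_module_left by blast+
  have F: "left_module R ?F" by (rule left_module_free[OF X(1)])
  have f: "linear_map R M N f" and g: "linear_map R ?F N g" using a unfolding module_hom_iff by blast+
  define h where "h = (\<lambda>x. inv_into (carrier M) f (g (basis x)))"
  have gb: "g (basis x) \<in> f ` carrier M" if "x \<in> X" for x
    using a linear_map_closed[OF g basis_closed[OF that]] by simp
  have h: "h \<in> X \<rightarrow> carrier M" and fh: "\<And>x. x \<in> X \<Longrightarrow> f (h x) = g (basis x)"
    unfolding h_def using inv_into_into[OF gb] f_inv_into_f[OF gb] by blast+
  have k: "linear_map R ?F M (free_lift M h)" by (rule free_lift_linear[OF X(1) M h])
  have "f (free_lift M h u) = g u" if "u \<in> carrier ?F" for u
    by (rule free_map_unique[OF X(1) N linear_map_comp[OF k f] g _ that])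
      (simp add: free_lift_basis[OF X(1) M h] fh)
  then have "compose (carrier ?F) f (restrict (free_lift M h) (carrier ?F)) = g"
    using a unfolding module_hom_iff extensional_def compose_def by auto
  then show "\<exists>h\<in>module_hom R ?F M. compose (carrier ?F) f h = g"
    using linear_map_restrict[OF F k] by blast
qed

definition counit :: "('r, 'u) module \<Rightarrow> 'u \<Rightarrow> 'u" where
  "counit M = free_lift M (\<lambda>x. x)"

definition syzygy :: "('r, 'u) module \<Rightarrow> ('r, 'u) module" where
  "syzygy M = kernel_module (free_module (carrier M)) M (counit M)"

lemma small_module_carrier: "small_module U R M \<Longrightarrow> carrier M \<subseteq> U" "small_module U R M \<Longrightarrow> small U (carrier M)"
  unfolding small_module_def by blast+

lemma counit_presentation:
  assumes M: "small_module U R M"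
  shows "projective_presentation U R (free_module (carrier M)) M (counit M)"
proof -
  note c = small_module_carrier[OF M] and lm = small_module_left[OF M]
  have "counit M ` carrier (free_module (carrier M)) = carrier M"
  proof
    show "counit M ` carrier (free_module (carrier M)) \<subseteq> carrier M"
      using linear_map_closed[OF free_lift_linear[OF c(1) lm]] unfolding counit_def by fastforce
    show "carrier M \<subseteq> counit M ` carrier (free_module (carrier M))"
    proof
      fix x assume x: "x \<in> carrier M"
      then have "counit M (basis x) = x"
        unfolding counit_def by (intro free_lift_basis[OF c(1) lm]) auto
      then show "x \<in> counit M ` carrier (free_module (carrier M))" using basis_closed[OF x] by (metis imageI)
    qed
  qed
  then show ?thesis
    unfolding projective_presentation_def
    using projective_free[OF c] M free_lift_linear[OF c(1) lm, of "\<lambda>x. x"] unfolding counit_def by simp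
qed

lemma small_module_syzygy:
  assumes M: "small_module U R M" shows "small_module U R (syzygy M)"
proof -
  have "small_module U R (free_module (carrier M))" "linear_map R (free_module (carrier M)) M (counit M)"
    using counit_presentation[OF M] unfolding projective_presentation_def projective_module_def by simp_all
  then show ?thesis
    unfolding syzygy_def by (rule small_module_kernel[OF _ small_module_left[OF M]])
qed

lemma small_module_syzygies: "small_module U R M \<Longrightarrow> small_module U R ((syzygy ^^ n) M)"
  by (induction n) (auto intro: small_module_syzygy)

text \<open>The first condition says that \<open>R/A \<otimes> M = 0\<close>, the \<open>n\<close>-th instance of the second one that
  \<open>Tor\<^sub>1(R/A, \<Omega>\<^sup>n M) = 0\<close>, that is, \<open>Tor\<^sub>n\<^sub>+\<^sub>1(R/A, M) = 0\<close>.\<close>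

definition h_exact :: "('r, 'u) module \<Rightarrow> bool" where
  "h_exact M \<longleftrightarrow> carrier M \<subseteq> ideal_times A M \<and>
     (\<forall>n. pure_presentation A (free_module (carrier ((syzygy ^^ n) M))) ((syzygy ^^ n) M) (counit ((syzygy ^^ n) M)))"

lemma canonical_sequence:
  assumes M: "small_module U R M"
  shows "presentation_sequence U R (\<lambda>n. free_module (carrier ((syzygy ^^ n) M))) (\<lambda>n. (syzygy ^^ n) M)
    (\<lambda>n. counit ((syzygy ^^ n) M))"
  unfolding presentation_sequence_def
  using counit_presentation[OF small_module_syzygies[OF M]] by (simp add: syzygy_def)

end


section \<open>Tensor products with the ideal\<close>

lemma ideal_times_uminus:
  assumes A: "ideal A R" and M: "left_module R M" and x: "x \<in> ideal_times A M"
  shows "\<ominus>\<^bsub>M\<^esub> x \<in> ideal_times A M"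
  using x
proof induction
  interpret M: left_module R M by (rule M)
  case zero
  have "\<ominus>\<^bsub>M\<^esub> \<zero>\<^bsub>M\<^esub> = \<zero>\<^bsub>M\<^esub>" using M.M.minus_equality[of "\<zero>\<^bsub>M\<^esub>" "\<zero>\<^bsub>M\<^esub>"] by simp
  then show ?case by (metis ideal_times.zero)
next
  interpret M: left_module R M by (rule M)
  interpret A: ideal A R by (rule A)
  case (step a x y)
  have y: "y \<in> carrier M" by (rule ideal_times_closed[OF M _ step(3)]) (rule A.a_subset)
  have a: "a \<in> carrier R" by (rule A.Icarr[OF step(1)])
  have ax: "a \<odot>\<^bsub>M\<^esub> x \<in> carrier M" by (rule M.smult_closed[OF a step(2)])
  have "\<ominus>\<^bsub>M\<^esub> (a \<odot>\<^bsub>M\<^esub> x \<oplus>\<^bsub>M\<^esub> y) = (\<ominus>\<^bsub>R\<^esub> a) \<odot>\<^bsub>M\<^esub> x \<oplus>\<^bsub>M\<^esub> (\<ominus>\<^bsub>M\<^esub> y)"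
    using ax y by (simp add: M.M.minus_add module_minus_smult[OF M a step(2)])
  moreover have "\<ominus>\<^bsub>R\<^esub> a \<in> A" using step(1) by (rule A.a_inv_closed)
  ultimately show ?case using ideal_times.step[OF _ step(2) step.IH] by simp
qed

definition frag_lift :: "('r, 'n) module \<Rightarrow> 'b set \<Rightarrow> ('b \<Rightarrow> 'n) \<Rightarrow> ('b \<Rightarrow>\<^sub>0 int) \<Rightarrow> 'n" where
  "frag_lift N S f =
     (SOME h. h \<in> hom (free_Abelian_group S) (add_monoid N) \<and> (\<forall>x\<in>S. h (frag_of x) = f x))"

lemma frag_lift:
  assumes N: "abelian_group N" and f: "\<And>x. x \<in> S \<Longrightarrow> f x \<in> carrier N"
  shows "frag_lift N S f \<in> hom (free_Abelian_group S) (add_monoid N)"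
    and frag_lift_of: "\<And>x. x \<in> S \<Longrightarrow> frag_lift N S f (frag_of x) = f x"
proof -
  interpret N: abelian_group N by (rule N)
  have "f ` S \<subseteq> carrier (add_monoid N)" using f by auto
  then obtain h where h: "h \<in> hom (free_Abelian_group S) (add_monoid N)" "\<And>x. x \<in> S \<Longrightarrow> h (frag_of x) = f x"
    by (rule comm_group.free_Abelian_group_universal[OF N.a_comm_group]) blast
  have "frag_lift N S f \<in> hom (free_Abelian_group S) (add_monoid N) \<and> (\<forall>x\<in>S. frag_lift N S f (frag_of x) = f x)"
    unfolding frag_lift_def by (rule someI[of _ h]) (use h in simp)
  then show "frag_lift N S f \<in> hom (free_Abelian_group S) (add_monoid N)"
    "\<And>x. x \<in> S \<Longrightarrow> frag_lift N S f (frag_of x) = f x" by blast+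
qed

lemma frag_lift_props:
  assumes N: "abelian_group N" and f: "\<And>x. x \<in> S \<Longrightarrow> f x \<in> carrier N"
  shows frag_lift_closed: "Poly_Mapping.keys z \<subseteq> S \<Longrightarrow> frag_lift N S f z \<in> carrier N"
    and frag_lift_zero: "frag_lift N S f 0 = \<zero>\<^bsub>N\<^esub>"
    and frag_lift_add: "Poly_Mapping.keys z \<subseteq> S \<Longrightarrow> Poly_Mapping.keys z' \<subseteq> S \<Longrightarrow>
      frag_lift N S f (z + z') = frag_lift N S f z \<oplus>\<^bsub>N\<^esub> frag_lift N S f z'"
    and frag_lift_minus: "Poly_Mapping.keys z \<subseteq> S \<Longrightarrow> frag_lift N S f (- z) = \<ominus>\<^bsub>N\<^esub> frag_lift N S f z"
    and frag_lift_diff: "Poly_Mapping.keys z \<subseteq> S \<Longrightarrow> Poly_Mapping.keys z' \<subseteq> S \<Longrightarrow>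
      frag_lift N S f (z - z') = frag_lift N S f z \<ominus>\<^bsub>N\<^esub> frag_lift N S f z'"
proof -
  interpret N: abelian_group N by (rule N)
  have h: "frag_lift N S f \<in> hom (free_Abelian_group S) (add_monoid N)" by (rule frag_lift(1)[OF N f])
  interpret h: group_hom "free_Abelian_group S" "add_monoid N" "frag_lift N S f"
    using h N.a_group by (simp add: group_hom_def group_hom_axioms_def)
  show cl: "frag_lift N S f z \<in> carrier N" if "Poly_Mapping.keys z \<subseteq> S" for z
    using h.hom_closed[of z] that by simp
  show "frag_lift N S f 0 = \<zero>\<^bsub>N\<^esub>" using h.hom_one by simp
  show add: "frag_lift N S f (z + z') = frag_lift N S f z \<oplus>\<^bsub>N\<^esub> frag_lift N S f z'"
    if "Poly_Mapping.keys z \<subseteq> S" "Poly_Mapping.keys z' \<subseteq> S" for z z'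
    using h.hom_mult[of z z'] that by simp
  show mi: "frag_lift N S f (- z) = \<ominus>\<^bsub>N\<^esub> frag_lift N S f z" if "Poly_Mapping.keys z \<subseteq> S" for z
    using h.hom_inv[of z] that by (simp add: a_inv_def)
  show "frag_lift N S f (z - z') = frag_lift N S f z \<ominus>\<^bsub>N\<^esub> frag_lift N S f z'"
    if "Poly_Mapping.keys z \<subseteq> S" "Poly_Mapping.keys z' \<subseteq> S" for z z'
    using add[OF that(1), of "- z'"] mi[OF that(2)] that(2) by (simp add: a_minus_def)
qed

lemma keys_diff_subset:
  "Poly_Mapping.keys x \<subseteq> S \<Longrightarrow> Poly_Mapping.keys y \<subseteq> S \<Longrightarrow> Poly_Mapping.keys (x - y) \<subseteq> S"
  using keys_diff[of x y] by blast

lemma keys_add_subset: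
  "Poly_Mapping.keys x \<subseteq> S \<Longrightarrow> Poly_Mapping.keys y \<subseteq> S \<Longrightarrow> Poly_Mapping.keys (x + y) \<subseteq> S"
  using Poly_Mapping.keys_add[of x y] by blast

context ideal_in_universe
begin

abbreviation AR :: "('r, 'r) module" where "AR \<equiv> ideal_right_module R A"

lemma AR_simps [simp]:
  "carrier AR = A" "add AR = add R" "r \<odot>\<^bsub>AR\<^esub> a = a \<otimes> r"
  unfolding ideal_right_module_def by simp_all

text \<open>\<open>A \<otimes>\<^sub>R M\<close> is the quotient of \<open>A_chains M\<close> by \<open>null_chains M\<close>, and \<open>eval_chain\<close> induces the map to \<open>M\<close>.\<close>

definition A_chains :: "('r, 'u) module \<Rightarrow> ('r \<times> 'u \<Rightarrow>\<^sub>0 int) set" where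
  "A_chains M = {z. Poly_Mapping.keys z \<subseteq> A \<times> carrier M}"

definition null_chains :: "('r, 'u) module \<Rightarrow> ('r \<times> 'u \<Rightarrow>\<^sub>0 int) set" where
  "null_chains M = generate (free_Abelian_group (A \<times> carrier M)) (tensor_relations R AR M)"

definition eval_chain :: "('r, 'u) module \<Rightarrow> ('r \<times> 'u \<Rightarrow>\<^sub>0 int) \<Rightarrow> 'u" where
  "eval_chain M = frag_lift M (A \<times> carrier M) (\<lambda>(a, m). a \<odot>\<^bsub>M\<^esub> m)"

lemma chains_intros:
  "0 \<in> A_chains M" "a \<in> A \<Longrightarrow> m \<in> carrier M \<Longrightarrow> frag_of (a, m) \<in> A_chains M"
  "z \<in> A_chains M \<Longrightarrow> z' \<in> A_chains M \<Longrightarrow> z + z' \<in> A_chains M"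
  "z \<in> A_chains M \<Longrightarrow> - z \<in> A_chains M"
  "z \<in> A_chains M \<Longrightarrow> z' \<in> A_chains M \<Longrightarrow> z - z' \<in> A_chains M"
  unfolding A_chains_def mem_Collect_eq by (simp_all add: keys_diff_subset keys_add_subset)

lemma chains_induct [consumes 1, case_names zero of diff]:
  assumes "z \<in> A_chains M" "P 0" "\<And>a m. a \<in> A \<Longrightarrow> m \<in> carrier M \<Longrightarrow> P (frag_of (a, m))"
    "\<And>x y. x \<in> A_chains M \<Longrightarrow> y \<in> A_chains M \<Longrightarrow> P x \<Longrightarrow> P y \<Longrightarrow> P (x - y)"
  shows "P z"
  using assms(1) unfolding A_chains_def mem_Collect_eq
  by (rule free_Abelian_group_induct) (use assms(2-4) in \<open>auto simp: A_chains_def\<close>)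

lemma A_closed:
  "a \<in> A \<Longrightarrow> b \<in> A \<Longrightarrow> a \<oplus> b \<in> A" "\<zero> \<in> A" "a \<in> A \<Longrightarrow> r \<in> carrier R \<Longrightarrow> a \<otimes> r \<in> A"
  "a \<in> A \<Longrightarrow> a \<in> carrier R"
proof -
  interpret A: ideal A R by (rule A_ideal)
  show "a \<in> A \<Longrightarrow> b \<in> A \<Longrightarrow> a \<oplus> b \<in> A" "\<zero> \<in> A" "a \<in> A \<Longrightarrow> r \<in> carrier R \<Longrightarrow> a \<otimes> r \<in> A"
    "a \<in> A \<Longrightarrow> a \<in> carrier R"
    by (simp_all add: A.I_r_closed A.Icarr)
qed

lemma tensor_relations_chains:
  assumes M: "left_module R M"
  shows "tensor_relations R AR M \<subseteq> A_chains M"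
proof -
  interpret M: left_module R M by (rule M)
  show ?thesis
    unfolding tensor_relations_def
    by (auto intro!: chains_intros A_closed M.smult_closed)
qed

lemma null_chains_intros:
  "0 \<in> null_chains M"
  "z \<in> null_chains M \<Longrightarrow> z' \<in> null_chains M \<Longrightarrow> z + z' \<in> null_chains M"
  "z \<in> tensor_relations R AR M \<Longrightarrow> z \<in> null_chains M"
  unfolding null_chains_def
  using generate.one[of "free_Abelian_group (A \<times> carrier M)"]
    generate.eng[of z "free_Abelian_group (A \<times> carrier M)" _ z']
  by (auto intro: generate.incl)

lemma null_chains_sub:
  assumes "left_module R M"
  shows "subgroup (null_chains M) (free_Abelian_group (A \<times> carrier M))"
  unfolding null_chains_def
  by (rule group.generate_is_subgroup[OF group_free_Abelian_group])
    (use tensor_relations_chains[OF assms] in \<open>auto simp: A_chains_def\<close>)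

lemma null_chains_chains:
  assumes "left_module R M" "z \<in> null_chains M"
  shows "z \<in> A_chains M"
proof -
  have "z \<in> carrier (free_Abelian_group (A \<times> carrier M))"
    using subgroup.subset[OF null_chains_sub[OF assms(1)]] assms(2) by (rule subsetD)
  then show ?thesis unfolding A_chains_def by simp
qed

lemma null_chains_minus:
  assumes M: "left_module R M" and z: "z \<in> null_chains M"
  shows "- z \<in> null_chains M"
  using subgroup.m_inv_closed[OF null_chains_sub[OF M] z] null_chains_chains[OF M z]
  unfolding A_chains_def by simp

lemma null_chains_diff:
  assumes "left_module R M" "z \<in> null_chains M" "z' \<in> null_chains M"
  shows "z - z' \<in> null_chains M"
  using null_chains_intros(2)[OF assms(2) null_chains_minus[OF assms(1,3)]] by simp

lemma null_chains_sum:
  "(\<And>i. i \<in> B \<Longrightarrow> f i \<in> null_chains M) \<Longrightarrow> sum f B \<in> null_chains M"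
  by (induction B rule: infinite_finite_induct) (auto intro: null_chains_intros)

lemma null_chains_induct [consumes 2, case_names zero add minus ladd radd balance]:
  assumes M: "left_module R M" and "z \<in> null_chains M" "P 0"
    and add: "\<And>x y. x \<in> null_chains M \<Longrightarrow> y \<in> null_chains M \<Longrightarrow> P x \<Longrightarrow> P y \<Longrightarrow> P (x + y)"
    and minus: "\<And>x. x \<in> null_chains M \<Longrightarrow> P x \<Longrightarrow> P (- x)"
    and ladd: "\<And>a b m. a \<in> A \<Longrightarrow> b \<in> A \<Longrightarrow> m \<in> carrier M \<Longrightarrow>
      P (frag_of (a \<oplus> b, m) - frag_of (a, m) - frag_of (b, m))"
    and radd: "\<And>a m n. a \<in> A \<Longrightarrow> m \<in> carrier M \<Longrightarrow> n \<in> carrier M \<Longrightarrow>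
      P (frag_of (a, m \<oplus>\<^bsub>M\<^esub> n) - frag_of (a, m) - frag_of (a, n))"
    and bal: "\<And>a r m. a \<in> A \<Longrightarrow> r \<in> carrier R \<Longrightarrow> m \<in> carrier M \<Longrightarrow>
      P (frag_of (a \<otimes> r, m) - frag_of (a, r \<odot>\<^bsub>M\<^esub> m))"
  shows "P z"
proof -
  have rel: "P h" if "h \<in> tensor_relations R AR M" for h
    using that unfolding tensor_relations_def AR_simps by (auto intro: ladd radd bal)
  show ?thesis
    using assms(2) unfolding null_chains_def
  proof (induction rule: generate.induct)
    case one then show ?case using assms(3) by simp
  next
    case (incl h) then show ?case by (rule rel)
  next
    case (inv h)
    have h: "h \<in> null_chains M" by (rule null_chains_intros(3)[OF inv])
    then show ?case
      using minus[OF h rel[OF inv]] null_chains_chains[OF M h] unfolding A_chains_def by simp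
  next
    case (eng x y) then show ?case using add[of x y] unfolding null_chains_def by simp
  qed
qed

lemma null_ladd: "a \<in> A \<Longrightarrow> b \<in> A \<Longrightarrow> m \<in> carrier M \<Longrightarrow>
    frag_of (a \<oplus> b, m) - frag_of (a, m) - frag_of (b, m) \<in> null_chains M"
  and null_radd: "a \<in> A \<Longrightarrow> m \<in> carrier M \<Longrightarrow> n \<in> carrier M \<Longrightarrow>
    frag_of (a, m \<oplus>\<^bsub>M\<^esub> n) - frag_of (a, m) - frag_of (a, n) \<in> null_chains M"
  and null_balance: "a \<in> A \<Longrightarrow> r \<in> carrier R \<Longrightarrow> m \<in> carrier M \<Longrightarrow>
    frag_of (a \<otimes> r, m) - frag_of (a, r \<odot>\<^bsub>M\<^esub> m) \<in> null_chains M"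
  by (rule null_chains_intros(3), unfold tensor_relations_def AR_simps, blast)+

lemma null_zero_left:
  assumes M: "left_module R M" and m: "m \<in> carrier M"
  shows "frag_of (\<zero>, m) \<in> null_chains M"
  using null_chains_minus[OF M null_ladd[OF A_closed(2) A_closed(2) m]] by simp

lemma null_zero_right:
  assumes M: "left_module R M" and a: "a \<in> A"
  shows "frag_of (a, \<zero>\<^bsub>M\<^esub>) \<in> null_chains M"
proof -
  interpret M: left_module R M by (rule M)
  show ?thesis using null_chains_minus[OF M null_radd[OF a M.M.zero_closed M.M.zero_closed]] by simp
qed

lemma eval_chain_props:
  assumes M: "left_module R M"
  shows eval_chain_closed: "z \<in> A_chains M \<Longrightarrow> eval_chain M z \<in> carrier M"
    and eval_chain_zero: "eval_chain M 0 = \<zero>\<^bsub>M\<^esub>"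
    and eval_chain_of: "a \<in> A \<Longrightarrow> m \<in> carrier M \<Longrightarrow> eval_chain M (frag_of (a, m)) = a \<odot>\<^bsub>M\<^esub> m"
    and eval_chain_add: "z \<in> A_chains M \<Longrightarrow> z' \<in> A_chains M \<Longrightarrow>
      eval_chain M (z + z') = eval_chain M z \<oplus>\<^bsub>M\<^esub> eval_chain M z'"
    and eval_chain_minus: "z \<in> A_chains M \<Longrightarrow> eval_chain M (- z) = \<ominus>\<^bsub>M\<^esub> eval_chain M z"
    and eval_chain_diff: "z \<in> A_chains M \<Longrightarrow> z' \<in> A_chains M \<Longrightarrow>
      eval_chain M (z - z') = eval_chain M z \<ominus>\<^bsub>M\<^esub> eval_chain M z'"
proof -
  interpret M: left_module R M by (rule M)
  have f: "(case x of (a, m) \<Rightarrow> a \<odot>\<^bsub>M\<^esub> m) \<in> carrier M" if "x \<in> A \<times> carrier M" for x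
    using that M.smult_closed A_closed(4) by auto
  note l = frag_lift_props[OF M.M.abelian_group_axioms f, of "A \<times> carrier M"]
  show "z \<in> A_chains M \<Longrightarrow> eval_chain M z \<in> carrier M"
    "eval_chain M 0 = \<zero>\<^bsub>M\<^esub>"
    "z \<in> A_chains M \<Longrightarrow> z' \<in> A_chains M \<Longrightarrow> eval_chain M (z + z') = eval_chain M z \<oplus>\<^bsub>M\<^esub> eval_chain M z'"
    "z \<in> A_chains M \<Longrightarrow> eval_chain M (- z) = \<ominus>\<^bsub>M\<^esub> eval_chain M z"
    "z \<in> A_chains M \<Longrightarrow> z' \<in> A_chains M \<Longrightarrow> eval_chain M (z - z') = eval_chain M z \<ominus>\<^bsub>M\<^esub> eval_chain M z'"
    unfolding eval_chain_def A_chains_def mem_Collect_eq by (rule l; assumption)+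
  show "eval_chain M (frag_of (a, m)) = a \<odot>\<^bsub>M\<^esub> m" if "a \<in> A" "m \<in> carrier M"
    unfolding eval_chain_def using frag_lift_of[OF M.M.abelian_group_axioms f] that by force
qed

lemma ideal_times_diff:
  assumes M: "left_module R M" and x: "x \<in> ideal_times A M" and y: "y \<in> ideal_times A M"
  shows "x \<ominus>\<^bsub>M\<^esub> y \<in> ideal_times A M"
  unfolding a_minus_def
  by (rule ideal_times_add[OF M A_sub x ideal_times_uminus[OF A_ideal M y]])

lemma eval_chain_ideal_times:
  assumes M: "left_module R M" and z: "z \<in> A_chains M"
  shows "eval_chain M z \<in> ideal_times A M"
  using z
proof (induction rule: chains_induct)
  case zero then show ?case using ideal_times.zero eval_chain_zero[OF M] by metis
next
  case (of a m) then show ?case using ideal_times_smult[OF M A_sub] eval_chain_of[OF M] by metis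
next
  case (diff x y) then show ?case using ideal_times_diff[OF M] eval_chain_diff[OF M] by metis
qed

lemma eval_chain_onto:
  assumes M: "left_module R M" and x: "x \<in> ideal_times A M"
  shows "\<exists>z\<in>A_chains M. eval_chain M z = x"
  using x
proof induction
  case zero then show ?case using eval_chain_zero[OF M] chains_intros(1) by blast
next
  case (step a x y)
  then obtain z where z: "z \<in> A_chains M" "eval_chain M z = y" by blast
  have f: "frag_of (a, x) \<in> A_chains M" by (rule chains_intros(2)[OF step(1,2)])
  show ?case
    by (rule bexI[OF _ chains_intros(3)[OF f z(1)]])
      (simp add: eval_chain_add[OF M f z(1)] eval_chain_of[OF M step(1,2)] z(2))
qed

lemma eval_chain_null:
  assumes M: "left_module R M" and z: "z \<in> null_chains M"
  shows "eval_chain M z = \<zero>\<^bsub>M\<^esub>"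
  using M z
proof (induction rule: null_chains_induct)
  case zero show ?case by (rule eval_chain_zero[OF M])
next
  interpret M: left_module R M by (rule M)
  case (add x y) then show ?case using null_chains_chains[OF M] by (simp add: eval_chain_add[OF M])
next
  interpret M: left_module R M by (rule M)
  case (minus x) then show ?case using null_chains_chains[OF M] by (simp add: eval_chain_minus[OF M])
next
  interpret M: left_module R M by (rule M)
  case (ladd a b m)
  have s: "a \<odot>\<^bsub>M\<^esub> m \<in> carrier M" "b \<odot>\<^bsub>M\<^esub> m \<in> carrier M" using ladd A_closed(4) M.smult_closed by simp_all
  show ?case
    using ladd s A_closed
    by (simp add: eval_chain_diff[OF M] chains_intros eval_chain_of[OF M] M.smult_l_distr a_minus_def
        M.M.a_assoc M.M.a_comm[of "b \<odot>\<^bsub>M\<^esub> m" "\<ominus>\<^bsub>M\<^esub> (a \<odot>\<^bsub>M\<^esub> m) \<oplus>\<^bsub>M\<^esub> \<ominus>\<^bsub>M\<^esub> (b \<odot>\<^bsub>M\<^esub> m)"] M.M.l_neg M.M.r_neg)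
next
  interpret M: left_module R M by (rule M)
  case (radd a m n)
  have s: "a \<odot>\<^bsub>M\<^esub> m \<in> carrier M" "a \<odot>\<^bsub>M\<^esub> n \<in> carrier M" using radd A_closed(4) M.smult_closed by simp_all
  show ?case
    using radd s A_closed
    by (simp add: eval_chain_diff[OF M] chains_intros eval_chain_of[OF M] M.smult_r_distr a_minus_def
        M.M.a_assoc M.M.a_comm[of "a \<odot>\<^bsub>M\<^esub> n" "\<ominus>\<^bsub>M\<^esub> (a \<odot>\<^bsub>M\<^esub> m) \<oplus>\<^bsub>M\<^esub> \<ominus>\<^bsub>M\<^esub> (a \<odot>\<^bsub>M\<^esub> n)"] M.M.l_neg M.M.r_neg)
next
  interpret M: left_module R M by (rule M)
  case (balance a r m)
  then show ?case
    using M.smult_closed A_closed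
    by (simp add: eval_chain_diff[OF M] chains_intros eval_chain_of[OF M] M.smult_assoc a_minus_def M.M.r_neg)
qed

text \<open>A chain on \<open>N\<close> that represents \<open>\<Sum> a\<^sub>x \<otimes> h x\<close>, for an element \<open>\<Sum> a\<^sub>x x\<close> of the free module with
  coefficients in \<open>A\<close>.\<close>

definition section_chain :: "('u \<Rightarrow> 'u) \<Rightarrow> 'u \<Rightarrow> ('r \<times> 'u \<Rightarrow>\<^sub>0 int)" where
  "section_chain h u = (\<Sum>x\<in>{x. dec u x \<noteq> \<zero>}. frag_of (dec u x, h x))"

lemma section_chain_superset:
  assumes X: "X \<subseteq> U" and N: "left_module R N" and h: "h \<in> X \<rightarrow> carrier N"
    and B: "finite B" "{x. dec u x \<noteq> \<zero>} \<subseteq> B" "B \<subseteq> X"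
  shows "(\<Sum>x\<in>B. frag_of (dec u x, h x)) - section_chain h u \<in> null_chains N"
proof -
  have "(\<Sum>x\<in>B. frag_of (dec u x, h x)) - section_chain h u = (\<Sum>x\<in>B - {x. dec u x \<noteq> \<zero>}. frag_of (dec u x, h x))"
    unfolding section_chain_def by (subst sum.subset_diff[OF B(2,1)]) simp
  also have "\<dots> \<in> null_chains N"
    by (rule null_chains_sum) (use null_zero_left[OF N] h B(3) in \<open>auto simp: Pi_iff subset_iff\<close>)
  finally show ?thesis .
qed

lemma dec_ideal_times:
  assumes X: "X \<subseteq> U" and u: "u \<in> ideal_times A (free_module X)"
  shows "dec u x \<in> A"
  using u
proof induction
  case zero show ?case using dec_free(2)[OF X] A_closed(2) by simp
next
  interpret F: left_module R "free_module X" by (rule left_module_free[OF X])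
  case (step a v w)
  then show ?case
    using ideal_times_closed[OF F.left_module_axioms A_sub step(3)] F.smult_closed A_closed dec_closed[OF X step(2)]
    by (simp add: dec_free(3,4)[OF X])
qed

lemma section_chain_add:
  assumes X: "X \<subseteq> U" and N: "left_module R N" and h: "h \<in> X \<rightarrow> carrier N"
    and u: "u \<in> ideal_times A (free_module X)" and v: "v \<in> ideal_times A (free_module X)"
  shows "section_chain h (u \<oplus>\<^bsub>free_module X\<^esub> v) - section_chain h u - section_chain h v \<in> null_chains N"
proof -
  let ?F = "free_module X"
  interpret F: left_module R ?F by (rule left_module_free[OF X])
  have uF: "u \<in> carrier ?F" and vF: "v \<in> carrier ?F"
    using ideal_times_closed[OF F.left_module_axioms A_sub] u v by blast+
  let ?B = "{x. dec u x \<noteq> \<zero>} \<union> {x. dec v x \<noteq> \<zero>}"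
  let ?s = "\<lambda>w. \<Sum>x\<in>?B. frag_of (dec w x, h x)"
  let ?w = "u \<oplus>\<^bsub>?F\<^esub> v"
  have B: "finite ?B" "?B \<subseteq> X"
    using finite_dec_support[OF X] dec_support[OF X] uF vF by blast+
  have d: "dec ?w = (\<lambda>x. dec u x \<oplus> dec v x)" by (rule dec_free(3)[OF X uF vF])
  have sub: "{x. dec u x \<noteq> \<zero>} \<subseteq> ?B" "{x. dec v x \<noteq> \<zero>} \<subseteq> ?B" "{x. dec ?w x \<noteq> \<zero>} \<subseteq> ?B"
    unfolding d by auto
  have 1: "?s ?w - ?s u - ?s v \<in> null_chains N"
  proof -
    have "?s ?w - ?s u - ?s v = (\<Sum>x\<in>?B. frag_of (dec u x \<oplus> dec v x, h x) - frag_of (dec u x, h x) - frag_of (dec v x, h x))"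
      unfolding d by (simp add: sum_subtractf)
    also have "\<dots> \<in> null_chains N"
      by (rule null_chains_sum, rule null_ladd) (use dec_ideal_times[OF X] u v h B(2) in auto)
    finally show ?thesis .
  qed
  note s = section_chain_superset[OF X N h B(1) _ B(2)]
  have "section_chain h ?w - section_chain h u - section_chain h v =
      (?s ?w - ?s u - ?s v) - (?s ?w - section_chain h ?w) + (?s u - section_chain h u) + (?s v - section_chain h v)"
    by simp
  also have "\<dots> \<in> null_chains N"
    by (rule null_chains_intros(2)[OF null_chains_intros(2)[OF null_chains_diff[OF N 1 s[OF sub(3)]] s[OF sub(1)]] s[OF sub(2)]])
  finally show ?thesis .
qed

lemma section_chain_smult:
  assumes X: "X \<subseteq> U" and N: "left_module R N" and h: "h \<in> X \<rightarrow> carrier N"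
    and a: "a \<in> A" and u: "u \<in> carrier (free_module X)"
  shows "section_chain h (a \<odot>\<^bsub>free_module X\<^esub> u) - frag_of (a, free_lift N h u) \<in> null_chains N"
proof -
  let ?F = "free_module X"
  interpret F: left_module R ?F by (rule left_module_free[OF X])
  interpret N: left_module R N by (rule N)
  note aR = A_closed(4)[OF a]
  let ?B = "{x. dec u x \<noteq> \<zero>}"
  have B: "finite ?B" "?B \<subseteq> X"
    using finite_dec_support[OF X] dec_support[OF X] u by blast+
  have d: "dec (a \<odot>\<^bsub>?F\<^esub> u) = (\<lambda>x. a \<otimes> dec u x)" by (rule dec_free(4)[OF X aR u])
  have sub: "{x. dec (a \<odot>\<^bsub>?F\<^esub> u) x \<noteq> \<zero>} \<subseteq> ?B" unfolding d using aR by auto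
  have *: "(\<Sum>x\<in>C. frag_of (a \<otimes> dec u x, h x)) - frag_of (a, \<Oplus>\<^bsub>N\<^esub>x\<in>C. dec u x \<odot>\<^bsub>N\<^esub> h x) \<in> null_chains N"
    if "finite C" "C \<subseteq> X" for C
    using that
  proof induction
    case empty show ?case using null_chains_minus[OF N null_zero_right[OF N a]] by simp
  next
    case (insert b C)
    let ?t = "\<lambda>x. dec u x \<odot>\<^bsub>N\<^esub> h x"
    have cl: "?t \<in> C \<rightarrow> carrier N" "?t b \<in> carrier N" "h b \<in> carrier N" "dec u b \<in> carrier R"
      using insert.prems h N.smult_closed dec_closed[OF X u] by (auto simp: Pi_iff subset_iff)
    have "(\<Sum>x\<in>insert b C. frag_of (a \<otimes> dec u x, h x)) - frag_of (a, \<Oplus>\<^bsub>N\<^esub>x\<in>insert b C. ?t x) =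
      (frag_of (a \<otimes> dec u b, h b) - frag_of (a, ?t b)) +
      ((\<Sum>x\<in>C. frag_of (a \<otimes> dec u x, h x)) - frag_of (a, \<Oplus>\<^bsub>N\<^esub>x\<in>C. ?t x)) -
      (frag_of (a, ?t b \<oplus>\<^bsub>N\<^esub> (\<Oplus>\<^bsub>N\<^esub>x\<in>C. ?t x)) - frag_of (a, ?t b) - frag_of (a, \<Oplus>\<^bsub>N\<^esub>x\<in>C. ?t x))"
      using insert.hyps cl by (simp add: N.M.finsum_insert)
    also have "\<dots> \<in> null_chains N"
      using insert.IH insert.prems
        null_radd[OF a cl(2) N.M.finsum_closed[OF cl(1)]] null_balance[OF a cl(4,3)]
      by (intro null_chains_diff[OF N _ null_radd[OF a cl(2) N.M.finsum_closed[OF cl(1)]]]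
          null_chains_intros(2)[OF null_balance[OF a cl(4,3)]]) simp
    finally show ?case .
  qed
  have "section_chain h (a \<odot>\<^bsub>?F\<^esub> u) - frag_of (a, free_lift N h u) =
    ((\<Sum>x\<in>?B. frag_of (a \<otimes> dec u x, h x)) - frag_of (a, free_lift N h u)) -
    ((\<Sum>x\<in>?B. frag_of (dec (a \<odot>\<^bsub>?F\<^esub> u) x, h x)) - section_chain h (a \<odot>\<^bsub>?F\<^esub> u))"
    unfolding d by simp
  also have "\<dots> \<in> null_chains N"
    by (rule null_chains_diff[OF N _ section_chain_superset[OF X N h B(1) sub B(2)]])
      (use *[OF B] in \<open>simp add: free_lift_def\<close>)
  finally show ?thesis .
qed

lemma section_chain_zero: "X \<subseteq> U \<Longrightarrow> section_chain h \<zero>\<^bsub>free_module X\<^esub> = 0"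
  unfolding section_chain_def using dec_free(2) by simp

lemma section_chain_lift:
  assumes X: "X \<subseteq> U" and N: "left_module R N" and h: "h \<in> X \<rightarrow> carrier N"
    and l: "\<And>n. n \<in> carrier N \<Longrightarrow> l n \<in> carrier (free_module X) \<and> free_lift N h (l n) = n"
    and w: "w = frag_lift (free_module X) (A \<times> carrier N) (\<lambda>(a, n). a \<odot>\<^bsub>free_module X\<^esub> l n)"
    and z: "z \<in> A_chains N"
  shows "w z \<in> ideal_times A (free_module X) \<and> section_chain h (w z) - z \<in> null_chains N"
proof -
  let ?F = "free_module X"
  interpret F: left_module R ?F by (rule left_module_free[OF X])
  have c: "(case x of (a, n) \<Rightarrow> a \<odot>\<^bsub>?F\<^esub> l n) \<in> carrier ?F" if "x \<in> A \<times> carrier N" for x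
    using that l F.smult_closed A_closed(4) by auto
  note fl = frag_lift_props[OF F.M.abelian_group_axioms c, of "A \<times> carrier N"]
  show ?thesis
    using z
  proof (induction rule: chains_induct)
    case zero
    have e: "w 0 = \<zero>\<^bsub>?F\<^esub>" unfolding w by (rule fl(2))
    show ?case
      unfolding e section_chain_zero[OF X] using null_chains_intros(1) ideal_times.zero[of ?F A] by simp
  next
    case (of a n)
    have e: "w (frag_of (a, n)) = a \<odot>\<^bsub>?F\<^esub> l n"
      unfolding w using frag_lift_of[OF F.M.abelian_group_axioms c] of by force
    show ?case
      unfolding e using ideal_times_smult[OF F.left_module_axioms A_sub of(1)] l[OF of(2)]
        section_chain_smult[OF X N h of(1), of "l n"] by simp
  next
    case (diff x y)
    have d: "w (x - y) = w x \<ominus>\<^bsub>?F\<^esub> w y"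
      unfolding w using fl(5) diff(1,2) unfolding A_chains_def by simp
    have it: "w x \<ominus>\<^bsub>?F\<^esub> w y \<in> ideal_times A ?F"
      using ideal_times_diff[OF F.left_module_axioms] diff by blast
    have cl: "w x \<in> carrier ?F" "w y \<in> carrier ?F"
      using ideal_times_closed[OF F.left_module_axioms A_sub] diff by blast+
    have s: "(w x \<ominus>\<^bsub>?F\<^esub> w y) \<oplus>\<^bsub>?F\<^esub> w y = w x"
      using cl by (simp add: a_minus_def F.M.a_assoc F.M.l_neg)
    have "section_chain h (w x \<ominus>\<^bsub>?F\<^esub> w y) - (x - y) =
      (section_chain h (w x) - x) - (section_chain h (w y) - y) -
      (section_chain h ((w x \<ominus>\<^bsub>?F\<^esub> w y) \<oplus>\<^bsub>?F\<^esub> w y) - section_chain h (w x \<ominus>\<^bsub>?F\<^esub> w y) - section_chain h (w y))"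
      unfolding s by simp
    also have "\<dots> \<in> null_chains N"
      by (rule null_chains_diff[OF N null_chains_diff[OF N] section_chain_add[OF X N h it]]) (use diff in blast)+
    finally show ?case unfolding d using it by blast
  qed
qed

text \<open>Flatness: \<open>A \<otimes> P \<rightarrow> P\<close> is injective, first for free and then for projective modules.\<close>

lemma free_flat:
  assumes X: "X \<subseteq> U" and z: "z \<in> A_chains (free_module X)" and e: "eval_chain (free_module X) z = \<zero>\<^bsub>free_module X\<^esub>"
  shows "z \<in> null_chains (free_module X)"
proof -
  let ?F = "free_module X"
  have F: "left_module R ?F" by (rule left_module_free[OF X])
  have h: "basis \<in> X \<rightarrow> carrier ?F" using basis_closed by blast
  have "free_lift ?F basis n = n" if "n \<in> carrier ?F" for n
    by (rule free_map_unique[OF X F free_lift_linear[OF X F h] linear_map_ident _ that])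
      (rule free_lift_basis[OF X F h])
  then have "section_chain basis (eval_chain ?F z) - z \<in> null_chains ?F"
    using section_chain_lift[OF X F h, of "\<lambda>n. n"] z unfolding eval_chain_def by blast
  then show ?thesis
    using null_chains_minus[OF F] unfolding e section_chain_zero[OF X] by force
qed

definition map_chain :: "('u \<Rightarrow> 'u) \<Rightarrow> ('r \<times> 'u \<Rightarrow>\<^sub>0 int) \<Rightarrow> ('r \<times> 'u \<Rightarrow>\<^sub>0 int)" where
  "map_chain f = frag_extend (\<lambda>(a, m). frag_of (a, f m))"

lemma map_chain_chains:
  assumes f: "linear_map R M N f" and z: "z \<in> A_chains M"
  shows "map_chain f z \<in> A_chains N"
  using z
proof (induction rule: chains_induct)
  case zero show ?case unfolding map_chain_def by (simp add: chains_intros)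
next
  case (of a m) then show ?case
    unfolding map_chain_def using linear_map_closed[OF f] by (simp add: chains_intros)
next
  case (diff x y) then show ?case unfolding map_chain_def by (simp add: frag_extend_diff chains_intros)
qed

lemma map_chain_null:
  assumes M: "left_module R M" and N: "left_module R N" and f: "linear_map R M N f" and z: "z \<in> null_chains M"
  shows "map_chain f z \<in> null_chains N"
  using M z
proof (induction rule: null_chains_induct)
  case zero show ?case by (simp add: map_chain_def null_chains_intros)
next
  case (add x y) then show ?case by (simp add: map_chain_def frag_extend_add null_chains_intros)
next
  case (minus x) then show ?case by (simp add: map_chain_def frag_extend_minus null_chains_minus[OF N])
next
  case (ladd a b m) then show ?case using null_ladd[of a b "f m"] linear_map_closed[OF f] by (simp add: map_chain_def frag_extend_diff)
next
  case (radd a m n)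
  then show ?case using null_radd[of a "f m" N "f n"] linear_map_closed[OF f] by (simp add: map_chain_def frag_extend_diff linear_map_add[OF f])
next
  case (balance a r m)
  then show ?case using null_balance[of a r "f m" N] linear_map_closed[OF f] by (simp add: map_chain_def frag_extend_diff linear_map_smult[OF f])
qed

lemma eval_map_chain:
  assumes M: "left_module R M" and N: "left_module R N" and f: "linear_map R M N f" and z: "z \<in> A_chains M"
  shows "eval_chain N (map_chain f z) = f (eval_chain M z)"
  using z
proof (induction rule: chains_induct)
  case zero show ?case
    unfolding map_chain_def by (simp add: eval_chain_zero[OF M] eval_chain_zero[OF N] linear_map_zero[OF M N f])
next
  case (of a m) then show ?case
    unfolding map_chain_def using linear_map_closed[OF f] A_closed(4)
    by (simp add: eval_chain_of[OF M] eval_chain_of[OF N] linear_map_smult[OF f])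
next
  case (diff x y)
  have "map_chain f (x - y) = map_chain f x - map_chain f y" unfolding map_chain_def by (rule frag_extend_diff)
  then show ?case
    using diff map_chain_chains[OF f] eval_chain_closed[OF M]
    by (simp add: eval_chain_diff[OF M] eval_chain_diff[OF N] linear_map_diff[OF M N f])
qed

lemma projective_flat:
  assumes P: "projective_module U R P" and z: "z \<in> A_chains P" and e: "eval_chain P z = \<zero>\<^bsub>P\<^esub>"
  shows "z \<in> null_chains P"
proof -
  have sP: "small_module U R P" using P unfolding projective_module_def by simp
  have lP: "left_module R P" by (rule small_module_left[OF sP])
  note X = small_module_carrier[OF sP]
  let ?F = "free_module (carrier P)"
  have F: "left_module R ?F" by (rule left_module_free[OF X(1)])
  have c: "linear_map R ?F P (counit P)" "counit P ` carrier ?F = carrier P"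
    using counit_presentation[OF sP] unfolding projective_presentation_def by simp_all
  obtain s where s: "linear_map R P ?F s" "\<And>x. x \<in> carrier P \<Longrightarrow> counit P (s x) = x"
    using projective_lift[OF P small_module_free[OF X] sP c linear_map_ident] by blast
  have "eval_chain ?F (map_chain s z) = \<zero>\<^bsub>?F\<^esub>"
    using eval_map_chain[OF lP F s(1) z] e linear_map_zero[OF lP F s(1)] by simp
  then have "map_chain s z \<in> null_chains ?F"
    by (rule free_flat[OF X(1) map_chain_chains[OF s(1) z]])
  then have "map_chain (counit P) (map_chain s z) \<in> null_chains P"
    by (rule map_chain_null[OF F lP c(1)])
  moreover have "map_chain (counit P) (map_chain s z) = z"
    using z
  proof (induction rule: chains_induct)
    case zero show ?case unfolding map_chain_def by simp
  next
    case (of a m) then show ?case unfolding map_chain_def using s(2) by simp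
  next
    case (diff x y) then show ?case unfolding map_chain_def by (simp add: frag_extend_diff)
  qed
  ultimately show ?thesis by simp
qed


section \<open>H-unitarity in terms of syzygies\<close>


lemma tensor_coset_eq: "tensor_coset R AR M z = (\<lambda>h. h + z) ` null_chains M"
  unfolding tensor_coset_def null_chains_def Let_def r_coset_def AR_simps by auto

lemma tensor_coset_eq_iff:
  assumes M: "left_module R M"
  shows "tensor_coset R AR M z = tensor_coset R AR M z' \<longleftrightarrow> z - z' \<in> null_chains M"
proof
  assume "tensor_coset R AR M z = tensor_coset R AR M z'"
  moreover have "z \<in> tensor_coset R AR M z"
    unfolding tensor_coset_eq using null_chains_intros(1)[of M] by force
  ultimately obtain h where "h \<in> null_chains M" "z = h + z'" unfolding tensor_coset_eq by blast
  then show "z - z' \<in> null_chains M" by simp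
next
  assume d: "z - z' \<in> null_chains M"
  show "tensor_coset R AR M z = tensor_coset R AR M z'"
  proof
    show "tensor_coset R AR M z \<subseteq> tensor_coset R AR M z'"
    proof
      fix y assume "y \<in> tensor_coset R AR M z"
      then obtain h where h: "h \<in> null_chains M" "y = h + z" unfolding tensor_coset_eq by blast
      have "h + (z - z') \<in> null_chains M" by (rule null_chains_intros(2)[OF h(1) d])
      moreover have "y = (h + (z - z')) + z'" using h(2) by simp
      ultimately show "y \<in> tensor_coset R AR M z'" unfolding tensor_coset_eq by (rule rev_image_eqI)
    qed
    show "tensor_coset R AR M z' \<subseteq> tensor_coset R AR M z"
    proof
      fix y assume "y \<in> tensor_coset R AR M z'"
      then obtain h where h: "h \<in> null_chains M" "y = h + z'" unfolding tensor_coset_eq by blast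
      have "h - (z - z') \<in> null_chains M" by (rule null_chains_diff[OF M h(1) d])
      moreover have "y = (h - (z - z')) + z" using h(2) by simp
      ultimately show "y \<in> tensor_coset R AR M z" unfolding tensor_coset_eq by (rule rev_image_eqI)
    qed
  qed
qed

lemma tensor_eq: "tensor R AR M = free_Abelian_group (A \<times> carrier M) Mod null_chains M"
  unfolding tensor_def null_chains_def Let_def AR_simps ..

lemma tensor_carrier: "carrier (tensor R AR M) = tensor_coset R AR M ` A_chains M"
  unfolding tensor_eq carrier_FactGroup A_chains_def tensor_coset_def null_chains_def Let_def AR_simps by auto

lemma tensor_comm_group:
  fixes M :: "('r, 'u) module"
  shows "left_module R M \<Longrightarrow> comm_group (tensor R AR M)"
  unfolding tensor_eq
  by (rule comm_group.abelian_FactGroup[OF abelian_free_Abelian_group null_chains_sub])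

lemma tensor_one:
  fixes M :: "('r, 'u) module"
  shows "\<one>\<^bsub>tensor R AR M\<^esub> = tensor_coset R AR M 0"
  unfolding tensor_eq tensor_coset_eq by simp

lemma tensor_mult:
  assumes M: "left_module R M" and "z \<in> A_chains M" "z' \<in> A_chains M"
  shows "tensor_coset R AR M z \<otimes>\<^bsub>tensor R AR M\<^esub> tensor_coset R AR M z' = tensor_coset R AR M (z + z')"
proof -
  let ?F = "free_Abelian_group (A \<times> carrier M)"
  interpret n: normal "null_chains M" ?F
    using comm_group.normal_iff_subgroup[OF abelian_free_Abelian_group] null_chains_sub[OF M] by blast
  have "tensor_coset R AR M y = null_chains M #>\<^bsub>?F\<^esub> y" for y
    unfolding tensor_coset_def null_chains_def Let_def AR_simps ..
  then show ?thesis
    using n.rcos_sum[of z z'] assms(2,3) unfolding tensor_eq A_chains_def by simp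
qed

lemma tensor_map_coset:
  assumes M: "left_module R M" and N: "left_module R N" and f: "linear_map R M N f"
  shows "tensor_map R AR M N f (tensor_coset R AR M z) = tensor_coset R AR N (map_chain f z)"
proof -
  have "(\<lambda>z. tensor_coset R AR N (frag_extend (\<lambda>(x, m). frag_of (x, f m)) z)) ` tensor_coset R AR M z =
      {tensor_coset R AR N (map_chain f z)}"
  proof -
    have "tensor_coset R AR N (map_chain f (h + z)) = tensor_coset R AR N (map_chain f z)"
      if "h \<in> null_chains M" for h
      unfolding tensor_coset_eq_iff[OF N] using map_chain_null[OF M N f that]
      by (simp add: map_chain_def frag_extend_add)
    then show ?thesis
      unfolding tensor_coset_eq[of M] using null_chains_intros(1)[of M] unfolding map_chain_def by auto
  qed
  then show ?thesis unfolding tensor_map_def by simp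
qed

lemma trivial_quotient_iff:
  assumes G: "comm_group G" and I: "subgroup I G"
  shows "trivial_group (G Mod I) \<longleftrightarrow> carrier G \<subseteq> I"
proof -
  interpret G: comm_group G by (rule G)
  interpret I: subgroup I G by (rule I)
  have g: "group (G Mod I)" using G.abelian_FactGroup[OF I] by (rule comm_group.axioms(2))
  have c: "I #>\<^bsub>G\<^esub> x = I \<longleftrightarrow> x \<in> I" if "x \<in> carrier G" for x
    using G.coset_join1[OF _ that I] G.coset_join2[OF that I] I.subset by blast
  show ?thesis
    unfolding trivial_group_def carrier_FactGroup one_FactGroup
    using g c G.one_closed by blast
qed

lemma trivial_homology_iff:
  fixes L M N :: "('r, 'u) module"
  assumes L: "left_module R L" and M: "projective_module U R M" and N: "projective_module U R N"
    and f: "linear_map R L M f" and g: "linear_map R M N g"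
    and ex: "f ` carrier L = {x \<in> carrier M. g x = \<zero>\<^bsub>N\<^esub>}"
  shows "trivial_group ((tensor R AR M)\<lparr>carrier := kernel (tensor R AR M) (tensor R AR N) (tensor_map R AR M N g)\<rparr>
      Mod (tensor_map R AR L M f ` carrier (tensor R AR L))) \<longleftrightarrow> pure_presentation A M N g"
proof -
  let ?T = "tensor R AR" and ?c = "tensor_coset R AR"
  let ?K = "kernel (?T M) (?T N) (tensor_map R AR M N g)"
  let ?I = "tensor_map R AR L M f ` carrier (?T L)"
  have lM: "left_module R M" and lN: "left_module R N"
    using M N unfolding projective_module_def small_module_def by simp_all
  interpret TM: comm_group "?T M" by (rule tensor_comm_group[OF lM])
  interpret TN: comm_group "?T N" by (rule tensor_comm_group[OF lN])
  interpret TL: comm_group "?T L" by (rule tensor_comm_group[OF L])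
  have hom: "tensor_map R AR P Q h \<in> hom (?T P) (?T Q)"
    if P: "left_module R P" and Q: "left_module R Q" and h: "linear_map R P Q h"
    for P Q :: "('r, 'u) module" and h
  proof (rule homI)
    fix x assume "x \<in> carrier (?T P)"
    then show "tensor_map R AR P Q h x \<in> carrier (?T Q)"
      unfolding tensor_carrier using tensor_map_coset[OF P Q h] map_chain_chains[OF h] by auto
  next
    fix x y assume "x \<in> carrier (?T P)" "y \<in> carrier (?T P)"
    then obtain z z' where z: "z \<in> A_chains P" "z' \<in> A_chains P" "x = ?c P z" "y = ?c P z'"
      unfolding tensor_carrier by blast
    show "tensor_map R AR P Q h (x \<otimes>\<^bsub>?T P\<^esub> y) =
        tensor_map R AR P Q h x \<otimes>\<^bsub>?T Q\<^esub> tensor_map R AR P Q h y"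
      unfolding z(3,4) tensor_mult[OF P z(1,2)] tensor_map_coset[OF P Q h]
        tensor_mult[OF Q map_chain_chains[OF h z(1)] map_chain_chains[OF h z(2)]]
      by (simp add: map_chain_def frag_extend_add)
  qed
  interpret g: group_hom "?T M" "?T N" "tensor_map R AR M N g"
    using hom[OF lM lN g] by unfold_locales
  interpret f: group_hom "?T L" "?T M" "tensor_map R AR L M f"
    using hom[OF L lM f] by unfold_locales
  have K: "?c M z \<in> ?K \<longleftrightarrow> g (eval_chain M z) = \<zero>\<^bsub>N\<^esub>" if z: "z \<in> A_chains M" for z
  proof -
    have "?c M z \<in> ?K \<longleftrightarrow> ?c N (map_chain g z) = ?c N 0"
      unfolding kernel_def using z by (auto simp: tensor_carrier tensor_map_coset[OF lM lN g] tensor_one)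
    also have "\<dots> \<longleftrightarrow> map_chain g z \<in> null_chains N"
      by (simp add: tensor_coset_eq_iff[OF lN])
    also have "\<dots> \<longleftrightarrow> eval_chain N (map_chain g z) = \<zero>\<^bsub>N\<^esub>"
      using projective_flat[OF N map_chain_chains[OF g z]] eval_chain_null[OF lN] by blast
    finally show ?thesis unfolding eval_map_chain[OF lM lN g z] .
  qed
  have I: "?c M z \<in> ?I \<longleftrightarrow> eval_chain M z \<in> ideal_times A (kernel_module M N g)" if z: "z \<in> A_chains M" for z
  proof
    have fk: "linear_map R L (kernel_module M N g) f"
      by (rule linear_map_into_kernel[OF f]) (use ex in auto)
    note lk = left_module_kernel[OF lM lN g]
    {
      assume "?c M z \<in> ?I"
      then obtain y where y: "y \<in> A_chains L" "?c M z = ?c M (map_chain f y)"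
        unfolding tensor_carrier using tensor_map_coset[OF L lM f] by auto
      have "z - map_chain f y \<in> null_chains M" using y(2) unfolding tensor_coset_eq_iff[OF lM] .
      then have "eval_chain M (z - map_chain f y) = \<zero>\<^bsub>M\<^esub>" by (rule eval_chain_null[OF lM])
      moreover have "eval_chain M z = eval_chain M (z - map_chain f y) \<oplus>\<^bsub>M\<^esub> eval_chain M (map_chain f y)"
        using eval_chain_add[OF lM chains_intros(5)[OF z map_chain_chains[OF f y(1)]] map_chain_chains[OF f y(1)]]
        by simp
      ultimately have "eval_chain M z = f (eval_chain L y)"
        using eval_map_chain[OF L lM f y(1)] eval_chain_closed[OF lM map_chain_chains[OF f y(1)]]
          abelian_monoid.l_zero[OF abelian_group.axioms(1)[OF left_module_abelian[OF lM]]] by simp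
      then show "eval_chain M z \<in> ideal_times A (kernel_module M N g)"
        using ideal_times_image[OF L lk A_sub fk eval_chain_ideal_times[OF L y(1)]] by simp
    }
    assume ev: "eval_chain M z \<in> ideal_times A (kernel_module M N g)"
    have "f ` carrier L = carrier (kernel_module M N g)" using ex by simp
    from ideal_times_surj[OF L lk A_sub fk this ev]
    obtain x where x: "x \<in> ideal_times A L" "f x = eval_chain M z" by blast
    obtain y where y: "y \<in> A_chains L" "eval_chain L y = x" using eval_chain_onto[OF L x(1)] by blast
    have my: "map_chain f y \<in> A_chains M" by (rule map_chain_chains[OF f y(1)])
    have "eval_chain M (z - map_chain f y) = eval_chain M z \<ominus>\<^bsub>M\<^esub> eval_chain M z"
      using eval_chain_diff[OF lM z my] eval_map_chain[OF L lM f y(1)] y(2) x(2) by simp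
    also have "\<dots> = \<zero>\<^bsub>M\<^esub>"
      using abelian_group.r_neg[OF left_module_abelian[OF lM] eval_chain_closed[OF lM z]]
      by (simp add: a_minus_def)
    finally have "z - map_chain f y \<in> null_chains M"
      by (rule projective_flat[OF M chains_intros(5)[OF z my]])
    then have "?c M z = tensor_map R AR L M f (?c L y)"
      unfolding tensor_map_coset[OF L lM f] tensor_coset_eq_iff[OF lM] .
    then show "?c M z \<in> ?I" unfolding tensor_carrier using y(1) by blast
  qed
  have IK: "?I \<subseteq> ?K"
  proof
    fix t assume t: "t \<in> ?I"
    then obtain z where z: "z \<in> A_chains M" "t = ?c M z"
      using f.hom_closed unfolding tensor_carrier by blast
    have "eval_chain M z \<in> carrier (kernel_module M N g)"
      using I[OF z(1)] t z(2) ideal_times_closed[OF left_module_kernel[OF lM lN g] A_sub] by blast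
    then show "t \<in> ?K" using K[OF z(1)] z(2) by simp
  qed
  let ?G = "(?T M)\<lparr>carrier := ?K\<rparr>"
  have subK: "subgroup ?K (?T M)" by (rule g.subgroup_kernel)
  have subI: "subgroup ?I (?T M)" by (rule f.img_is_subgroup)
  have G: "comm_group ?G"
    by (rule group.group_comm_groupI[OF TM.subgroup_imp_group[OF subK]])
      (use subgroup.subset[OF subK] TM.m_comm in auto)
  have sI: "subgroup ?I ?G"
    by (rule TM.subgroup_incl[OF subI subK IK])
  then have "trivial_group (?G Mod ?I) \<longleftrightarrow> ?K \<subseteq> ?I"
    unfolding trivial_quotient_iff[OF G sI] by simp
  also have "\<dots> \<longleftrightarrow> (\<forall>z\<in>A_chains M. g (eval_chain M z) = \<zero>\<^bsub>N\<^esub> \<longrightarrow> eval_chain M z \<in> ideal_times A (kernel_module M N g))"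
  proof -
    have "?K \<subseteq> ?c M ` A_chains M" unfolding kernel_def tensor_carrier by blast
    then have "?K \<subseteq> ?I \<longleftrightarrow> (\<forall>z\<in>A_chains M. ?c M z \<in> ?K \<longrightarrow> ?c M z \<in> ?I)" by blast
    then show ?thesis using K I by simp
  qed
  also have "\<dots> \<longleftrightarrow> pure_presentation A M N g"
    unfolding pure_presentation_def
    using eval_chain_onto[OF lM] eval_chain_ideal_times[OF lM] by metis
  finally show ?thesis .
qed

lemma free_syzygy_props:
  assumes M: "small_module U R M"
  shows "left_module R M" "left_module R (free_module (carrier M))" "left_module R (syzygy M)"
    "linear_map R (free_module (carrier M)) M (counit M)"
    "\<And>x. x \<in> carrier M \<Longrightarrow> counit M (basis x) = x"
    "carrier M \<subseteq> U"
proof -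
  show M': "left_module R M" by (rule small_module_left[OF M])
  show U: "carrier M \<subseteq> U" by (rule small_module_carrier[OF M])
  show "left_module R (free_module (carrier M))" by (rule left_module_free[OF U])
  show "left_module R (syzygy M)" by (rule small_module_left[OF small_module_syzygy[OF M]])
  show "linear_map R (free_module (carrier M)) M (counit M)"
    unfolding counit_def by (rule free_lift_linear[OF U M']) simp
  show "counit M (basis x) = x" if "x \<in> carrier M" for x
    unfolding counit_def by (rule free_lift_basis[OF U M' _ that]) simp
qed

definition lift_chain :: "('r, 'u) module \<Rightarrow> ('r \<times> 'u \<Rightarrow>\<^sub>0 int) \<Rightarrow> 'u" where
  "lift_chain M = frag_lift (free_module (carrier M)) (A \<times> carrier M) (\<lambda>(a, m). a \<odot>\<^bsub>free_module (carrier M)\<^esub> basis m)"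

lemma lift_chain_props:
  assumes M: "small_module U R M"
  shows lift_chain_closed: "z \<in> A_chains M \<Longrightarrow> lift_chain M z \<in> carrier (free_module (carrier M))"
    and lift_chain_zero: "lift_chain M 0 = \<zero>\<^bsub>free_module (carrier M)\<^esub>"
    and lift_chain_of: "a \<in> A \<Longrightarrow> m \<in> carrier M \<Longrightarrow>
      lift_chain M (frag_of (a, m)) = a \<odot>\<^bsub>free_module (carrier M)\<^esub> basis m"
    and lift_chain_add: "z \<in> A_chains M \<Longrightarrow> z' \<in> A_chains M \<Longrightarrow>
      lift_chain M (z + z') = lift_chain M z \<oplus>\<^bsub>free_module (carrier M)\<^esub> lift_chain M z'"
    and lift_chain_minus: "z \<in> A_chains M \<Longrightarrow>
      lift_chain M (- z) = \<ominus>\<^bsub>free_module (carrier M)\<^esub> lift_chain M z"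
    and lift_chain_diff: "z \<in> A_chains M \<Longrightarrow> z' \<in> A_chains M \<Longrightarrow>
      lift_chain M (z - z') = lift_chain M z \<ominus>\<^bsub>free_module (carrier M)\<^esub> lift_chain M z'"
proof -
  let ?F = "free_module (carrier M)"
  interpret F: left_module R ?F by (rule free_syzygy_props(2)[OF M])
  have f: "(case x of (a, m) \<Rightarrow> a \<odot>\<^bsub>?F\<^esub> basis m) \<in> carrier ?F" if "x \<in> A \<times> carrier M" for x
    using that F.smult_closed A_closed(4) basis_closed by auto
  note l = frag_lift_props[OF F.M.abelian_group_axioms f, of "A \<times> carrier M"]
  show "z \<in> A_chains M \<Longrightarrow> lift_chain M z \<in> carrier ?F"
    "lift_chain M 0 = \<zero>\<^bsub>?F\<^esub>"
    "z \<in> A_chains M \<Longrightarrow> z' \<in> A_chains M \<Longrightarrow> lift_chain M (z + z') = lift_chain M z \<oplus>\<^bsub>?F\<^esub> lift_chain M z'"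
    "z \<in> A_chains M \<Longrightarrow> lift_chain M (- z) = \<ominus>\<^bsub>?F\<^esub> lift_chain M z"
    "z \<in> A_chains M \<Longrightarrow> z' \<in> A_chains M \<Longrightarrow> lift_chain M (z - z') = lift_chain M z \<ominus>\<^bsub>?F\<^esub> lift_chain M z'"
    unfolding lift_chain_def A_chains_def mem_Collect_eq by (rule l; assumption)+
  show "lift_chain M (frag_of (a, m)) = a \<odot>\<^bsub>?F\<^esub> basis m" if "a \<in> A" "m \<in> carrier M"
    unfolding lift_chain_def using frag_lift_of[OF F.M.abelian_group_axioms f] that by force
qed

lemma counit_lift_chain:
  assumes M: "small_module U R M" and z: "z \<in> A_chains M"
  shows "counit M (lift_chain M z) = eval_chain M z"
  using z
proof (induction rule: chains_induct)
  note p = free_syzygy_props[OF M]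
  case zero show ?case using linear_map_zero[OF p(2,1,4)] lift_chain_zero[OF M] eval_chain_zero[OF p(1)] by simp
next
  note p = free_syzygy_props[OF M]
  case (of a m)
  then show ?case
    using linear_map_smult[OF p(4) A_closed(4) basis_closed] p(5)
    by (simp add: lift_chain_of[OF M] eval_chain_of[OF p(1)])
next
  note p = free_syzygy_props[OF M]
  case (diff x y)
  then show ?case
    using linear_map_diff[OF p(2,1,4) lift_chain_closed[OF M] lift_chain_closed[OF M]]
    by (simp add: lift_chain_diff[OF M] eval_chain_diff[OF p(1)])
qed

lemma lift_chain_onto:
  assumes M: "small_module U R M" and x: "x \<in> ideal_times A (free_module (carrier M))"
  shows "\<exists>z\<in>A_chains M. lift_chain M z = x"
proof -
  let ?F = "free_module (carrier M)"
  note p = free_syzygy_props[OF M]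
  interpret F: left_module R ?F by (rule p(2))
  have single: "\<exists>z\<in>A_chains M. lift_chain M z = a \<odot>\<^bsub>?F\<^esub> u" if a: "a \<in> A" and u: "u \<in> carrier ?F" for a u
    using p(6) u
  proof (induction rule: free_module_induct)
    case zero
    show ?case
      using lift_chain_zero[OF M] chains_intros(1) module_smult_zero[OF p(2) A_closed(4)[OF a]] by metis
  next
    case (step r x v)
    then obtain z where z: "z \<in> A_chains M" "lift_chain M z = a \<odot>\<^bsub>?F\<^esub> v" by blast
    have ar: "a \<otimes> r \<in> A" by (rule A_closed(3)[OF a step(1)])
    note f = chains_intros(2)[OF ar step(2)]
    have "lift_chain M (frag_of (a \<otimes> r, x) + z) = a \<odot>\<^bsub>?F\<^esub> (r \<odot>\<^bsub>?F\<^esub> basis x \<oplus>\<^bsub>?F\<^esub> v)"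
      using step(1-3) a A_closed(4)[OF a] z F.smult_closed basis_closed[OF step(2)]
      by (simp add: lift_chain_add[OF M f z(1)] lift_chain_of[OF M ar step(2)] F.smult_assoc F.smult_r_distr)
    then show ?case using chains_intros(3)[OF f z(1)] by blast
  qed
  show ?thesis
    using x
  proof induction
    case zero show ?case using lift_chain_zero[OF M] chains_intros(1) by blast
  next
    case (step a u y)
    obtain z z' where "z \<in> A_chains M" "lift_chain M z = a \<odot>\<^bsub>?F\<^esub> u" "z' \<in> A_chains M" "lift_chain M z' = y"
      using single[OF step(1,2)] step.IH by blast
    then show ?case using lift_chain_add[OF M] chains_intros(3) by metis
  qed
qed

lemma lift_chain_null:
  assumes M: "small_module U R M" and z: "z \<in> null_chains M"
  shows "lift_chain M z \<in> ideal_times A (syzygy M)"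
proof -
  let ?F = "free_module (carrier M)"
  note p = free_syzygy_props[OF M]
  interpret F: left_module R ?F by (rule p(2))
  interpret M: left_module R M by (rule p(1))
  have add: "add (syzygy M) = add ?F" "smult (syzygy M) = smult ?F" "\<zero>\<^bsub>syzygy M\<^esub> = \<zero>\<^bsub>?F\<^esub>"
    and car: "carrier (syzygy M) = {x \<in> carrier ?F. counit M x = \<zero>\<^bsub>M\<^esub>}"
    unfolding syzygy_def by simp_all
  note b = basis_closed[of _ "carrier M"]
  have one: "a \<odot>\<^bsub>?F\<^esub> u \<in> ideal_times A (syzygy M)" if "a \<in> A" "u \<in> carrier ?F" "counit M u = \<zero>\<^bsub>M\<^esub>" for a u
    using ideal_times_smult[OF p(3) A_sub that(1), of u] that unfolding car add by simp
  note c = linear_map_add[OF p(4)] linear_map_smult[OF p(4)] linear_map_diff[OF p(2,1,4)] p(5)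
  have m3: "x \<ominus>\<^bsub>M\<^esub> y \<ominus>\<^bsub>M\<^esub> z = \<zero>\<^bsub>M\<^esub>" if "x = y \<oplus>\<^bsub>M\<^esub> z" "y \<in> carrier M" "z \<in> carrier M" for x y z
    using that by (simp add: a_minus_def M.M.a_assoc M.M.a_comm[of z "\<ominus>\<^bsub>M\<^esub> y \<oplus>\<^bsub>M\<^esub> \<ominus>\<^bsub>M\<^esub> z"] M.M.l_neg M.M.r_neg)
  have F3: "x \<ominus>\<^bsub>?F\<^esub> y \<ominus>\<^bsub>?F\<^esub> z = \<zero>\<^bsub>?F\<^esub>" if "x = y \<oplus>\<^bsub>?F\<^esub> z" "y \<in> carrier ?F" "z \<in> carrier ?F" for x y z
    using that by (simp add: a_minus_def F.M.a_assoc F.M.a_comm[of z "\<ominus>\<^bsub>?F\<^esub> y \<oplus>\<^bsub>?F\<^esub> \<ominus>\<^bsub>?F\<^esub> z"] F.M.l_neg F.M.r_neg)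
  have sd: "a \<odot>\<^bsub>?F\<^esub> (u \<ominus>\<^bsub>?F\<^esub> v) = a \<odot>\<^bsub>?F\<^esub> u \<ominus>\<^bsub>?F\<^esub> a \<odot>\<^bsub>?F\<^esub> v"
    if "a \<in> A" "u \<in> carrier ?F" "v \<in> carrier ?F" for a u v
    using that A_closed(4)[OF that(1)]
    by (simp add: a_minus_def F.smult_r_distr module_smult_minus[OF p(2)])
  show ?thesis
    using p(1) z
  proof (induction rule: null_chains_induct)
    case zero show ?case unfolding lift_chain_zero[OF M] using ideal_times.zero[of "syzygy M" A] add by simp
  next
    case (add x y)
    have "lift_chain M x \<oplus>\<^bsub>syzygy M\<^esub> lift_chain M y \<in> ideal_times A (syzygy M)"
      by (rule ideal_times_add[OF p(3) A_sub add(3,4)])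
    then show ?case
      using lift_chain_add[OF M] null_chains_chains[OF p(1)] add(1,2) \<open>add (syzygy M) = add ?F\<close> by simp
  next
    case (minus x)
    have m: "\<ominus>\<^bsub>syzygy M\<^esub> lift_chain M x = \<ominus>\<^bsub>?F\<^esub> lift_chain M x"
    proof -
      have xs: "lift_chain M x \<in> carrier (syzygy M)" by (rule ideal_times_closed[OF p(3) A_sub minus(2)])
      have "linear_map R (syzygy M) ?F (\<lambda>x. x)"
        unfolding syzygy_def by (rule linear_map_from_kernel[OF linear_map_ident])
      from linear_map_minus[OF p(3,2) this xs] show ?thesis .
    qed
    show ?case
      using ideal_times_uminus[OF A_ideal p(3) minus(2)] lift_chain_minus[OF M]
        null_chains_chains[OF p(1) minus(1)] m by simp
  next
    case (ladd a b m)
    have "lift_chain M (frag_of (a \<oplus> b, m) - frag_of (a, m) - frag_of (b, m)) = \<zero>\<^bsub>?F\<^esub>"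
      using ladd A_closed basis_closed[of m "carrier M"] F.smult_closed
      by (simp add: lift_chain_diff[OF M] chains_intros lift_chain_of[OF M] F.smult_l_distr F3)
    then show ?case using ideal_times.zero[of "syzygy M" A] \<open>\<zero>\<^bsub>syzygy M\<^esub> = \<zero>\<^bsub>?F\<^esub>\<close> by simp
  next
    case (radd a m n)
    let ?u = "basis (m \<oplus>\<^bsub>M\<^esub> n) \<ominus>\<^bsub>?F\<^esub> basis m \<ominus>\<^bsub>?F\<^esub> basis n"
    have bs: "basis (m \<oplus>\<^bsub>M\<^esub> n) \<in> carrier ?F" "basis m \<in> carrier ?F" "basis n \<in> carrier ?F"
      using radd basis_closed by simp_all
    have "lift_chain M (frag_of (a, m \<oplus>\<^bsub>M\<^esub> n) - frag_of (a, m) - frag_of (a, n)) = a \<odot>\<^bsub>?F\<^esub> ?u"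
      using radd bs by (simp add: lift_chain_diff[OF M] chains_intros lift_chain_of[OF M] sd)
    moreover have "counit M ?u = \<zero>\<^bsub>M\<^esub>" using bs radd by (simp add: c m3)
    ultimately show ?case using one[OF radd(1), of ?u] bs by simp
  next
    case (balance a r m)
    let ?u = "r \<odot>\<^bsub>?F\<^esub> basis m \<ominus>\<^bsub>?F\<^esub> basis (r \<odot>\<^bsub>M\<^esub> m)"
    have rm: "r \<odot>\<^bsub>M\<^esub> m \<in> carrier M" using balance M.smult_closed by simp
    have bs: "basis (r \<odot>\<^bsub>M\<^esub> m) \<in> carrier ?F" "basis m \<in> carrier ?F" "r \<odot>\<^bsub>?F\<^esub> basis m \<in> carrier ?F"
      using balance basis_closed F.smult_closed rm by simp_all
    have "lift_chain M (frag_of (a \<otimes> r, m) - frag_of (a, r \<odot>\<^bsub>M\<^esub> m)) = a \<odot>\<^bsub>?F\<^esub> ?u"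
      using balance bs rm A_closed
      by (simp add: lift_chain_diff[OF M] chains_intros lift_chain_of[OF M] sd F.smult_assoc)
    moreover have "counit M ?u = \<zero>\<^bsub>M\<^esub>" using bs balance rm M.M.r_neg[OF rm] by (simp add: c) (simp add: a_minus_def)
    ultimately show ?case using one[OF balance(1), of ?u] bs by simp
  qed
qed

lemma counit_section_null:
  assumes M: "small_module U R M" and u: "u \<in> ideal_times A (syzygy M)"
  shows "section_chain (\<lambda>x. x) u \<in> null_chains M"
proof -
  let ?F = "free_module (carrier M)"
  note p = free_syzygy_props[OF M]
  have add: "add (syzygy M) = add ?F" "smult (syzygy M) = smult ?F" "\<zero>\<^bsub>syzygy M\<^esub> = \<zero>\<^bsub>?F\<^esub>"
    and car: "carrier (syzygy M) = {x \<in> carrier ?F. counit M x = \<zero>\<^bsub>M\<^esub>}"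
    unfolding syzygy_def by simp_all
  have incl: "linear_map R (syzygy M) ?F (\<lambda>x. x)"
    unfolding syzygy_def by (rule linear_map_from_kernel[OF linear_map_ident])
  have h: "(\<lambda>x. x) \<in> carrier M \<rightarrow> carrier M" by simp
  show ?thesis
    using u
  proof induction
    case zero
    then show ?case unfolding add section_chain_zero[OF p(6)] by (rule null_chains_intros(1))
  next
    case (step a x y)
    have x: "x \<in> carrier ?F" "counit M x = \<zero>\<^bsub>M\<^esub>" using step(2) car by simp_all
    have 1: "a \<odot>\<^bsub>?F\<^esub> x \<in> ideal_times A ?F" by (rule ideal_times_smult[OF p(2) A_sub step(1) x(1)])
    have 2: "y \<in> ideal_times A ?F" by (rule ideal_times_image[OF p(3,2) A_sub incl step(3)])
    let ?s = "section_chain (\<lambda>x. x)"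
    have e: "?s (a \<odot>\<^bsub>?F\<^esub> x \<oplus>\<^bsub>?F\<^esub> y) = (?s (a \<odot>\<^bsub>?F\<^esub> x \<oplus>\<^bsub>?F\<^esub> y) - ?s (a \<odot>\<^bsub>?F\<^esub> x) - ?s y) +
       (?s (a \<odot>\<^bsub>?F\<^esub> x) - frag_of (a, \<zero>\<^bsub>M\<^esub>)) + frag_of (a, \<zero>\<^bsub>M\<^esub>) + ?s y" by simp
    have "?s (a \<odot>\<^bsub>?F\<^esub> x) - frag_of (a, \<zero>\<^bsub>M\<^esub>) \<in> null_chains M"
      using section_chain_smult[OF p(6,1) h step(1) x(1)] x(2) unfolding counit_def by simp
    then have "?s (a \<odot>\<^bsub>?F\<^esub> x \<oplus>\<^bsub>?F\<^esub> y) \<in> null_chains M"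
      by (subst e) (intro null_chains_intros(2)[OF null_chains_intros(2)[OF null_chains_intros(2)[OF
        section_chain_add[OF p(6,1) h 1 2]] null_zero_right[OF p(1) step(1)]] step.IH])
    then show ?case unfolding add .
  qed
qed

lemma unitary_iff:
  assumes M: "small_module U R M"
  shows "(\<exists>\<mu>\<in>iso (tensor R AR M) (add_monoid M).
      \<forall>a\<in>A. \<forall>m\<in>carrier M. \<mu> (pure_tensor R AR M a m) = a \<odot>\<^bsub>M\<^esub> m) \<longleftrightarrow>
    carrier M \<subseteq> ideal_times A M \<and> pure_presentation A (free_module (carrier M)) M (counit M)"
    (is "?L \<longleftrightarrow> ?R")
proof
  let ?F = "free_module (carrier M)" and ?T = "tensor R AR M" and ?c = "tensor_coset R AR M"
  note p = free_syzygy_props[OF M]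
  interpret M: left_module R M by (rule p(1))
  interpret T: comm_group ?T by (rule tensor_comm_group[OF p(1)])
  have syz: "kernel_module ?F M (counit M) = syzygy M" unfolding syzygy_def ..
  {
    assume ?L
    then obtain \<mu> where mu: "\<mu> \<in> iso ?T (add_monoid M)"
      and \<mu>: "\<And>a m. a \<in> A \<Longrightarrow> m \<in> carrier M \<Longrightarrow> \<mu> (?c (frag_of (a, m))) = a \<odot>\<^bsub>M\<^esub> m"
      unfolding pure_tensor_def by blast
    interpret mu: group_hom ?T "add_monoid M" \<mu>
      using mu M.M.a_group unfolding iso_def by unfold_locales auto
    have ev: "\<mu> (?c z) = eval_chain M z" if "z \<in> A_chains M" for z
      using that
    proof (induction rule: chains_induct)
      case zero show ?case using mu.hom_one by (simp add: tensor_one eval_chain_zero[OF p(1)])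
    next
      case (of a m) then show ?case by (simp add: \<mu> eval_chain_of[OF p(1)])
    next
      case (diff x y)
      have cl: "?c x \<in> carrier ?T" "?c y \<in> carrier ?T" "?c (x - y) \<in> carrier ?T"
        using diff chains_intros(5)[OF diff(1,2)] unfolding tensor_carrier by simp_all
      have "?c (x - y) \<otimes>\<^bsub>?T\<^esub> ?c y = ?c x"
        using tensor_mult[OF p(1) chains_intros(5)[OF diff(1,2)] diff(2)] by simp
      then have "\<mu> (?c (x - y)) \<oplus>\<^bsub>M\<^esub> \<mu> (?c y) = \<mu> (?c x)" using mu.hom_mult[OF cl(3,2)] by simp
      then have "\<mu> (?c (x - y)) = eval_chain M x \<ominus>\<^bsub>M\<^esub> eval_chain M y"
        using diff mu.hom_closed[OF cl(3)] eval_chain_closed[OF p(1)]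
        by (metis M.M.add.inv_solve_right a_minus_def partial_object.select_convs(1))
      then show ?case using eval_chain_diff[OF p(1) diff(1,2)] by simp
    qed
    have bij: "bij_betw \<mu> (carrier ?T) (carrier M)" using mu unfolding iso_def by simp
    show ?R
    proof
      show "carrier M \<subseteq> ideal_times A M"
      proof
        fix m assume "m \<in> carrier M"
        then have "m \<in> \<mu> ` carrier ?T" using bij unfolding bij_betw_def by simp
        then obtain z where "z \<in> A_chains M" "m = \<mu> (?c z)" unfolding tensor_carrier by auto
        then show "m \<in> ideal_times A M" using ev eval_chain_ideal_times[OF p(1)] by simp
      qed
      show "pure_presentation A ?F M (counit M)"
        unfolding pure_presentation_def syz
      proof (intro ballI impI)
        fix x assume x: "x \<in> ideal_times A ?F" "counit M x = \<zero>\<^bsub>M\<^esub>"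
        obtain z where z: "z \<in> A_chains M" "lift_chain M z = x" using lift_chain_onto[OF M x(1)] by blast
        have "\<mu> (?c z) = \<mu> (?c 0)"
          using ev[OF z(1)] ev[OF chains_intros(1)] counit_lift_chain[OF M z(1)] z(2) x(2) eval_chain_zero[OF p(1)] by simp
        then have "?c z = ?c 0"
          using bij z(1) chains_intros(1) unfolding bij_betw_def inj_on_def tensor_carrier by blast
        then have "z \<in> null_chains M" unfolding tensor_coset_eq_iff[OF p(1)] by simp
        then show "x \<in> ideal_times A (syzygy M)" using lift_chain_null[OF M] z(2) by blast
      qed
    qed
  }
  assume r: ?R
  have ker: "z \<in> null_chains M" if z: "z \<in> A_chains M" and e: "eval_chain M z = \<zero>\<^bsub>M\<^esub>" for z
  proof -
    have h: "(\<lambda>x. x) \<in> carrier M \<rightarrow> carrier M" by simp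
    have s: "lift_chain M z \<in> ideal_times A ?F \<and> section_chain (\<lambda>x. x) (lift_chain M z) - z \<in> null_chains M"
      by (rule section_chain_lift[OF p(6,1) h _ lift_chain_def[of M] z])
        (use basis_closed p(5) in \<open>auto simp: counit_def\<close>)
    then have "lift_chain M z \<in> ideal_times A (syzygy M)"
      using r counit_lift_chain[OF M z] e unfolding pure_presentation_def syz by simp
    then have "section_chain (\<lambda>x. x) (lift_chain M z) \<in> null_chains M" by (rule counit_section_null[OF M])
    from null_chains_diff[OF p(1) this conjunct2[OF s]] show ?thesis by simp
  qed
  have sub: "subgroup (null_chains M) (free_Abelian_group (A \<times> carrier M))" by (rule null_chains_sub[OF p(1)])
  define \<mu> where "\<mu> = (\<lambda>t. eval_chain M (SOME z. z \<in> A_chains M \<and> ?c z = t))"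
  have \<mu>: "\<mu> (?c z) = eval_chain M z" if z: "z \<in> A_chains M" for z
  proof -
    let ?z = "SOME y. y \<in> A_chains M \<and> ?c y = ?c z"
    have y: "?z \<in> A_chains M \<and> ?c ?z = ?c z" by (rule someI[of _ z]) (use z in simp)
    then have n: "?z - z \<in> null_chains M" unfolding tensor_coset_eq_iff[OF p(1)] by blast
    have "eval_chain M ?z = eval_chain M (?z - z) \<oplus>\<^bsub>M\<^esub> eval_chain M z"
      using eval_chain_add[OF p(1) chains_intros(5)[OF conjunct1[OF y] z] z] by simp
    then show ?thesis
      unfolding \<mu>_def using eval_chain_null[OF p(1) n] eval_chain_closed[OF p(1) z] by simp
  qed
  have "\<mu> \<in> iso ?T (add_monoid M)"
  proof (rule isoI)
    show "\<mu> \<in> hom ?T (add_monoid M)"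
    proof (rule homI)
      fix x assume "x \<in> carrier ?T"
      then show "\<mu> x \<in> carrier (add_monoid M)"
        unfolding tensor_carrier using \<mu> eval_chain_closed[OF p(1)] by auto
    next
      fix x y assume "x \<in> carrier ?T" "y \<in> carrier ?T"
      then obtain z z' where z: "z \<in> A_chains M" "z' \<in> A_chains M" "x = ?c z" "y = ?c z'"
        unfolding tensor_carrier by blast
      show "\<mu> (x \<otimes>\<^bsub>?T\<^esub> y) = \<mu> x \<otimes>\<^bsub>add_monoid M\<^esub> \<mu> y"
        unfolding z(3,4) tensor_mult[OF p(1) z(1,2)] \<mu>[OF z(1)] \<mu>[OF z(2)] \<mu>[OF chains_intros(3)[OF z(1,2)]]
        by (simp add: eval_chain_add[OF p(1) z(1,2)])
    qed
    show "bij_betw \<mu> (carrier ?T) (carrier (add_monoid M))"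
      unfolding bij_betw_def
    proof
      show "inj_on \<mu> (carrier ?T)"
      proof (rule inj_onI)
        fix x y assume "x \<in> carrier ?T" "y \<in> carrier ?T" and eq: "\<mu> x = \<mu> y"
        then obtain z z' where z: "z \<in> A_chains M" "z' \<in> A_chains M" "x = ?c z" "y = ?c z'"
          unfolding tensor_carrier by blast
        have "eval_chain M (z - z') = \<zero>\<^bsub>M\<^esub>"
          using eq z \<mu> eval_chain_closed[OF p(1)] by (simp add: eval_chain_diff[OF p(1)] a_minus_def M.M.r_neg)
        then show "x = y" unfolding z(3,4) tensor_coset_eq_iff[OF p(1)]
          using ker[OF chains_intros(5)[OF z(1,2)]] by blast
      qed
      show "\<mu> ` carrier ?T = carrier (add_monoid M)"
      proof
        show "\<mu> ` carrier ?T \<subseteq> carrier (add_monoid M)"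
          unfolding tensor_carrier using \<mu> eval_chain_closed[OF p(1)] by auto
        show "carrier (add_monoid M) \<subseteq> \<mu> ` carrier ?T"
        proof
          fix m assume "m \<in> carrier (add_monoid M)"
          then have "m \<in> ideal_times A M" using r by auto
          then obtain z where "z \<in> A_chains M" "eval_chain M z = m" using eval_chain_onto[OF p(1)] by blast
          then show "m \<in> \<mu> ` carrier ?T" unfolding tensor_carrier using \<mu> by (metis imageI)
        qed
      qed
    qed
  qed
  moreover have "\<forall>a\<in>A. \<forall>m\<in>carrier M. \<mu> (pure_tensor R AR M a m) = a \<odot>\<^bsub>M\<^esub> m"
    unfolding pure_tensor_def using \<mu> eval_chain_of[OF p(1)] chains_intros(2) by simp
  ultimately show ?L by blast
qed


lemma stable_retractI:
  assumes K: "small_module U R K" and K': "small_module U R K'" and K'': "small_module U R K''"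
    and l: "linear_map R K K' f" "linear_map R K' K g" "linear_map R K K'' f'" "linear_map R K'' K g'"
    and eq: "\<And>x. x \<in> carrier K \<Longrightarrow> x = g (f x) \<oplus>\<^bsub>K\<^esub> g' (f' x)"
  shows "stable_retract U R K K' K''"
  unfolding stable_retract_def
proof (intro exI conjI ballI)
  let ?Q = "free_module {} :: ('r, 'u) module"
  have e: "small U ({} :: 'u set)"
    using small_subset[OF small_module_carrier(2)[OF K]] by blast
  have Q: "left_module R ?Q" by (rule left_module_free) simp
  interpret K: left_module R K by (rule small_module_left[OF K])
  show "linear_map R K K' f" "linear_map R K' K g" "linear_map R K K'' f'" "linear_map R K'' K g'"
    by (rule l)+
  show "projective_module U R ?Q" by (rule projective_free[OF _ e]) simp
  show "linear_map R K ?Q (\<lambda>_. \<zero>\<^bsub>?Q\<^esub>)" by (rule linear_map_const_zero[OF Q])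
  show "linear_map R ?Q K (\<lambda>_. \<zero>\<^bsub>K\<^esub>)" by (rule linear_map_const_zero[OF K.left_module_axioms])
  show "x = g (f x) \<oplus>\<^bsub>K\<^esub> (g' (f' x) \<oplus>\<^bsub>K\<^esub> \<zero>\<^bsub>K\<^esub>)" if "x \<in> carrier K" for x
    using eq[OF that] linear_map_closed[OF l(4) linear_map_closed[OF l(3) that]] by simp
qed

lemma stable_retract_refl:
  assumes M: "small_module U R M" shows "stable_retract U R M M M"
proof -
  interpret M: left_module R M by (rule small_module_left[OF M])
  show ?thesis
    by (rule stable_retractI[OF M M M linear_map_ident linear_map_ident
          linear_map_const_zero[OF M.left_module_axioms] linear_map_ident]) simp
qed

lemma h_exact_summand:
  assumes K: "small_module U R K" and K': "small_module U R K'" and K'': "small_module U R K''"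
    and l: "linear_map R K K' f" "linear_map R K' K g" "linear_map R K K'' f'" "linear_map R K'' K g'"
    and eq: "\<And>x. x \<in> carrier K \<Longrightarrow> x = g (f x) \<oplus>\<^bsub>K\<^esub> g' (f' x)"
    and h: "h_exact K'" "h_exact K''"
  shows "h_exact K"
proof -
  note lm = small_module_left[OF K] small_module_left[OF K'] small_module_left[OF K'']
  have "carrier K \<subseteq> ideal_times A K"
  proof
    fix x assume x: "x \<in> carrier K"
    have "f x \<in> ideal_times A K'" "f' x \<in> ideal_times A K''"
      using h linear_map_closed[OF l(1) x] linear_map_closed[OF l(3) x] unfolding h_exact_def by blast+
    then have "g (f x) \<in> ideal_times A K" "g' (f' x) \<in> ideal_times A K"
      using ideal_times_image[OF lm(2,1) A_sub l(2)] ideal_times_image[OF lm(3,1) A_sub l(4)] by simp_all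
    then show "x \<in> ideal_times A K" by (subst eq[OF x]) (rule ideal_times_add[OF lm(1) A_sub])
  qed
  moreover have "pure_presentation A (free_module (carrier ((syzygy ^^ n) K))) ((syzygy ^^ n) K) (counit ((syzygy ^^ n) K))" for n
    by (rule presentation_sequence_compare[OF A_sub canonical_sequence[OF K] canonical_sequence[OF K']
          canonical_sequence[OF K''], of n])
      (use stable_retractI[OF K K' K'' l eq] h in \<open>simp_all add: h_exact_def\<close>)
  ultimately show ?thesis unfolding h_exact_def by blast
qed

lemma h_exact_retract:
  assumes K: "small_module U R K" and K': "small_module U R K'"
    and l: "linear_map R K K' f" "linear_map R K' K g" and eq: "\<And>x. x \<in> carrier K \<Longrightarrow> g (f x) = x"
    and h: "h_exact K'"
  shows "h_exact K"
proof -
  interpret K: left_module R K by (rule small_module_left[OF K])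
  show ?thesis
    by (rule h_exact_summand[OF K K' K' l linear_map_const_zero[OF small_module_left[OF K']]
          linear_map_const_zero[OF K.left_module_axioms] _ h h]) (simp add: eq)
qed

lemma h_exact_zero:
  assumes Z: "small_module U R Z" and c: "carrier Z = {\<zero>\<^bsub>Z\<^esub>}"
  shows "h_exact Z"
proof -
  have lz: "left_module R Z" by (rule small_module_left[OF Z])
  interpret Z: left_module R Z by (rule lz)
  have proj: "projective_module U R Z"
    unfolding projective_module_def
  proof (intro conjI allI impI)
    show "small_module U R Z" by (rule Z)
    fix M N :: "('r, 'u) module" and f g
    assume a: "small_module U R M \<and> small_module U R N \<and> f \<in> module_hom R M N \<and> f ` carrier M = carrier N \<and>
      g \<in> module_hom R Z N"
    have lm: "left_module R M" "left_module R N" using a small_module_left by metis+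
    have f: "linear_map R M N f" and g: "linear_map R Z N g" using a unfolding module_hom_iff by blast+
    have h: "restrict (\<lambda>_. \<zero>\<^bsub>M\<^esub>) (carrier Z) \<in> module_hom R Z M"
      by (rule linear_map_restrict[OF lz linear_map_const_zero[OF lm(1)]])
    have "compose (carrier Z) f (restrict (\<lambda>_. \<zero>\<^bsub>M\<^esub>) (carrier Z)) = g"
    proof
      fix x show "compose (carrier Z) f (restrict (\<lambda>_. \<zero>\<^bsub>M\<^esub>) (carrier Z)) x = g x"
        using a linear_map_zero[OF lm f] linear_map_zero[OF lz lm(2) g] c
        unfolding module_hom_iff extensional_def compose_def by auto
    qed
    then show "\<exists>h\<in>module_hom R Z M. compose (carrier Z) f h = g" using h by blast
  qed
  have k: "kernel_module Z Z (\<lambda>x. x) = Z"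
    unfolding kernel_module_def using c by (cases Z) auto
  have seq: "presentation_sequence U R (\<lambda>_. Z) (\<lambda>_. Z) (\<lambda>_ x. x)"
    unfolding presentation_sequence_def projective_presentation_def k using proj Z linear_map_ident by auto
  have pure: "pure_presentation A Z Z (\<lambda>x. x)" unfolding pure_presentation_def k by blast
  have "pure_presentation A (free_module (carrier ((syzygy ^^ n) Z))) ((syzygy ^^ n) Z) (counit ((syzygy ^^ n) Z))" for n
    by (rule presentation_sequence_compare[OF A_sub canonical_sequence[OF Z] seq seq, of n])
      (use stable_retract_refl[OF Z] pure in simp_all)
  moreover have "carrier Z \<subseteq> ideal_times A Z" using c ideal_times.zero[of Z A] by simp
  ultimately show ?thesis unfolding h_exact_def by blast
qed

lemma resolution_exists:
  assumes M: "small_module U R M"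
  shows "\<exists>P d e. projective_resolution U R M P d e"
proof -
  let ?K = "\<lambda>n. (syzygy ^^ n) M"
  let ?P = "\<lambda>n. free_module (carrier (?K n))"
  let ?p = "\<lambda>n. restrict (counit (?K n)) (carrier (?P n))"
  have sm: "small_module U R (?K n)" for n by (rule small_module_syzygies[OF M])
  note pp = counit_presentation[OF sm, unfolded projective_presentation_def]
  have lP: "left_module R (?P n)" for n by (rule free_syzygy_props(2)[OF sm])
  have c: "carrier (?K (Suc n)) = {x \<in> carrier (?P n). counit (?K n) x = \<zero>\<^bsub>?K n\<^esub>}"
    and z: "\<zero>\<^bsub>?K (Suc n)\<^esub> = \<zero>\<^bsub>?P n\<^esub>" for n
    by (simp_all add: syzygy_def)
  have l: "linear_map R (?P (Suc n)) (?P n) (counit (?K (Suc n)))" for n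
  proof -
    have "linear_map R (?K (Suc n)) (?P n) (\<lambda>x. x)"
      by (simp add: syzygy_def linear_map_from_kernel[OF linear_map_ident])
    from linear_map_comp[OF free_syzygy_props(4)[OF sm[of "Suc n"]] this] show ?thesis .
  qed
  have surj: "counit (?K n) ` carrier (?P n) = carrier (?K n)" for n using pp by blast
  have im: "?p n ` carrier (?P n) = carrier (?K n)" for n
    by (rule trans[OF image_restrict_eq surj])
  have kr: "carrier (?K (Suc n)) = {x \<in> carrier (?P n). ?p n x = \<zero>\<^bsub>?K n\<^esub>}" for n
    unfolding c by auto
  have "projective_resolution U R M ?P (\<lambda>n. ?p (Suc n)) (?p 0)"
    unfolding projective_resolution_def
  proof (intro conjI allI)
    fix n
    show "projective_module U R (?P n)" using pp by blast
    show "?p (Suc n) \<in> module_hom R (?P (Suc n)) (?P n)" by (rule linear_map_restrict[OF lP l])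
    show "?p (Suc (Suc n)) ` carrier (?P (Suc (Suc n))) = {x \<in> carrier (?P (Suc n)). ?p (Suc n) x = \<zero>\<^bsub>?P n\<^esub>}"
      by (rule trans[OF im kr[of "Suc n", unfolded z]])
  next
    have "?p 0 \<in> module_hom R (?P 0) (?K 0)"
      by (rule linear_map_restrict[OF lP free_syzygy_props(4)[OF sm]])
    then show "?p 0 \<in> module_hom R (?P 0) M" by simp
    show "?p 0 ` carrier (?P 0) = carrier M" using im[of 0] unfolding funpow_0 .
    show "?p (Suc 0) ` carrier (?P 1) = {x \<in> carrier (?P 0). ?p 0 x = \<zero>\<^bsub>M\<^esub>}"
      unfolding One_nat_def funpow_0 by (rule trans[OF im kr[of 0, unfolded funpow_0]])
  qed
  then show ?thesis by blast
qed

lemma resolution_sequence: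
  assumes M: "small_module U R M" and res: "projective_resolution U R M P d e"
  shows "\<exists>K p. presentation_sequence U R P K p \<and> K 0 = M \<and>
    (\<forall>n. pure_presentation A (P (Suc n)) (K (Suc n)) (p (Suc n)) \<longleftrightarrow> pure_presentation A (P (Suc n)) (P n) (d n))"
proof -
  define p where "p = (\<lambda>n. case n of 0 \<Rightarrow> e | Suc k \<Rightarrow> d k)"
  define K where "K = rec_nat M (\<lambda>n K. kernel_module (P n) K (p n))"
  have K: "K 0 = M" "K (Suc n) = kernel_module (P n) (K n) (p n)" for n
    unfolding K_def by simp_all
  have p: "p 0 = e" "p (Suc n) = d n" for n unfolding p_def by simp_all
  have k: "kernel_module (P (Suc n)) (K (Suc n)) f = kernel_module (P (Suc n)) (P n) f" for n f
    unfolding K(2) kernel_module_def by simp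
  have r: "projective_module U R (P n)" "d n \<in> module_hom R (P (Suc n)) (P n)"
      "d (Suc n) ` carrier (P (Suc (Suc n))) = {x \<in> carrier (P (Suc n)). d n x = \<zero>\<^bsub>P n\<^esub>}" for n
    using res unfolding projective_resolution_def by simp_all
  have r0: "e \<in> module_hom R (P 0) M" "e ` carrier (P 0) = carrier M"
     "d 0 ` carrier (P 1) = {x \<in> carrier (P 0). e x = \<zero>\<^bsub>M\<^esub>}"
    using res unfolding projective_resolution_def by simp_all
  have img: "d n ` carrier (P (Suc n)) = carrier (K (Suc n))" for n
    by (cases n) (use r0(3) r(3) in \<open>simp_all add: K(2) p K(1)\<close>)
  have sP: "small_module U R (P n)" for n using r(1)[of n] unfolding projective_module_def by blast
  have "projective_presentation U R (P n) (K n) (p n)" for n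
  proof (induction n)
    case 0
    show ?case
      unfolding projective_presentation_def K(1) p(1) using r(1) M r0 unfolding module_hom_iff by blast
  next
    case (Suc n)
    have "linear_map R (P n) (K n) (p n)" "left_module R (K n)"
      using Suc small_module_left unfolding projective_presentation_def by blast+
    then have sk: "small_module U R (K (Suc n))"
      unfolding K(2) using small_module_kernel[OF sP] by blast
    have l: "linear_map R (P (Suc n)) (P n) (d n)" using r(2)[of n] unfolding module_hom_iff by blast
    have "p n (d n x) = \<zero>\<^bsub>K n\<^esub>" if "x \<in> carrier (P (Suc n))" for x
    proof -
      have "d n x \<in> carrier (K (Suc n))" using img[of n] that by blast
      then show ?thesis unfolding K(2) by simp
    qed
    then have "linear_map R (P (Suc n)) (K (Suc n)) (d n)"
      unfolding K(2) by (rule linear_map_into_kernel[OF l])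
    then show ?case
      unfolding projective_presentation_def p(2) using r(1) sk img by blast
  qed
  then have "presentation_sequence U R P K p"
    unfolding presentation_sequence_def K(2) by blast
  moreover have "pure_presentation A (P (Suc n)) (K (Suc n)) (p (Suc n)) \<longleftrightarrow>
      pure_presentation A (P (Suc n)) (P n) (d n)" for n
    unfolding pure_presentation_def k p(2) unfolding K(2) by simp
  ultimately show ?thesis using K(1) by blast
qed

lemma h_unitary_iff:
  assumes M: "small_module U R M"
  shows "h_unitary U R A M \<longleftrightarrow> h_exact M"
proof -
  let ?s = "SOME (P, d, e). projective_resolution U R M P d e"
  obtain P d e where s: "?s = (P, d, e)" by (cases ?s) auto
  have "case ?s of (P, d, e) \<Rightarrow> projective_resolution U R M P d e"
    by (rule someI_ex) (use resolution_exists[OF M] in auto)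
  then have res: "projective_resolution U R M P d e" unfolding s by simp
  obtain K p where seq: "presentation_sequence U R P K p" "K 0 = M"
    and pure: "\<And>n. pure_presentation A (P (Suc n)) (K (Suc n)) (p (Suc n)) \<longleftrightarrow> pure_presentation A (P (Suc n)) (P n) (d n)"
    using resolution_sequence[OF M res] by metis
  let ?pc = "\<lambda>n. pure_presentation A (free_module (carrier ((syzygy ^^ n) M))) ((syzygy ^^ n) M) (counit ((syzygy ^^ n) M))"
  have ret: "stable_retract U R M M M" by (rule stable_retract_refl[OF M])
  note can = canonical_sequence[OF M]
  have cmp: "?pc n \<longleftrightarrow> pure_presentation A (P n) (K n) (p n)" for n
  proof
    show "pure_presentation A (P n) (K n) (p n)" if "?pc n"
      by (rule presentation_sequence_compare[OF A_sub seq(1) can can]) (use ret seq(2) that in simp_all)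
    show "?pc n" if "pure_presentation A (P n) (K n) (p n)"
      by (rule presentation_sequence_compare[OF A_sub can seq(1) seq(1)]) (use ret seq(2) that in simp_all)
  qed
  have tor: "trivial_group (Tor U R AR M (Suc n)) \<longleftrightarrow> ?pc (Suc n)" for n
  proof -
    have pm: "projective_module U R (P m)" "d m \<in> module_hom R (P (Suc m)) (P m)"
      "d (Suc m) ` carrier (P (Suc (Suc m))) = {x \<in> carrier (P (Suc m)). d m x = \<zero>\<^bsub>P m\<^esub>}" for m
      using res unfolding projective_resolution_def by simp_all
    have "left_module R (P (Suc (Suc n)))"
      using pm(1) unfolding projective_module_def small_module_def by blast
    then have "trivial_group (tensor_homology R AR P d (Suc n)) \<longleftrightarrow> pure_presentation A (P (Suc n)) (P n) (d n)"
      unfolding tensor_homology_def nat.case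
      by (rule trivial_homology_iff) (use pm in \<open>simp_all add: module_hom_iff\<close>)
    then show ?thesis unfolding Tor_def s Let_def prod.case cmp pure .
  qed
  have "(\<forall>i\<ge>1. trivial_group (Tor U R AR M i)) \<longleftrightarrow> (\<forall>n. ?pc (Suc n))"
    using tor by (metis One_nat_def Suc_le_D le_add1 plus_1_eq_Suc)
  moreover have "(\<forall>n. ?pc n) \<longleftrightarrow> ?pc 0 \<and> (\<forall>n. ?pc (Suc n))" by (metis not0_implies_Suc)
  ultimately show ?thesis
    unfolding h_unitary_def h_exact_def unitary_iff[OF M] by simp
qed


section \<open>Directed colimits\<close>


definition directed_colimit ::
    "'i set \<Rightarrow> 'i rel \<Rightarrow> ('i \<Rightarrow> ('r, 'u) module) \<Rightarrow> ('i \<Rightarrow> 'i \<Rightarrow> 'u \<Rightarrow> 'u) \<Rightarrow> ('r, 'u) module \<Rightarrow> ('i \<Rightarrow> 'u \<Rightarrow> 'u) \<Rightarrow> bool" where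
  "directed_colimit I r D t L c \<longleftrightarrow>
     preorder_on I r \<and> I \<noteq> {} \<and> (\<forall>i\<in>I. \<forall>j\<in>I. \<exists>k. (i, k) \<in> r \<and> (j, k) \<in> r) \<and>
     (\<forall>i\<in>I. small_module U R (D i)) \<and> small_module U R L \<and>
     (\<forall>i j. (i, j) \<in> r \<longrightarrow> linear_map R (D i) (D j) (t i j)) \<and>
     (\<forall>i\<in>I. linear_map R (D i) L (c i)) \<and>
     (\<forall>i j k. (i, j) \<in> r \<longrightarrow> (j, k) \<in> r \<longrightarrow> (\<forall>x\<in>carrier (D i). t j k (t i j x) = t i k x)) \<and>
     (\<forall>i j. (i, j) \<in> r \<longrightarrow> (\<forall>x\<in>carrier (D i). c j (t i j x) = c i x)) \<and>
     (\<forall>y\<in>carrier L. \<exists>i\<in>I. \<exists>x\<in>carrier (D i). c i x = y) \<and>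
     (\<forall>i\<in>I. \<forall>x\<in>carrier (D i). c i x = \<zero>\<^bsub>L\<^esub> \<longrightarrow> (\<exists>j. (i, j) \<in> r \<and> t i j x = \<zero>\<^bsub>D j\<^esub>))"

lemma directed_colimitD:
  assumes "directed_colimit I r D t L c"
  shows colim_preorder: "preorder_on I r"
    and colim_nonempty: "I \<noteq> {}"
    and colim_small: "i \<in> I \<Longrightarrow> small_module U R (D i)"
    and colim_small_lim: "small_module U R L"
    and colim_trans_map: "(i, j) \<in> r \<Longrightarrow> linear_map R (D i) (D j) (t i j)"
    and colim_map: "i \<in> I \<Longrightarrow> linear_map R (D i) L (c i)"
    and colim_comp: "(i, j) \<in> r \<Longrightarrow> (j, k) \<in> r \<Longrightarrow> x \<in> carrier (D i) \<Longrightarrow> t j k (t i j x) = t i k x"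
    and colim_compat: "(i, j) \<in> r \<Longrightarrow> x \<in> carrier (D i) \<Longrightarrow> c j (t i j x) = c i x"
    and colim_refl: "i \<in> I \<Longrightarrow> (i, i) \<in> r"
    and colim_trans: "(i, j) \<in> r \<Longrightarrow> (j, k) \<in> r \<Longrightarrow> (i, k) \<in> r"
    and colim_mem: "(i, j) \<in> r \<Longrightarrow> i \<in> I" "(i, j) \<in> r \<Longrightarrow> j \<in> I"
  using assms unfolding directed_colimit_def preorder_on_def refl_on_def
  by (simp_all) (auto dest: transD)

lemma colim_directed:
  "directed_colimit I r D t L c \<Longrightarrow> i \<in> I \<Longrightarrow> j \<in> I \<Longrightarrow> \<exists>k. (i, k) \<in> r \<and> (j, k) \<in> r"
  unfolding directed_colimit_def by simp

lemma colim_surj: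
  "directed_colimit I r D t L c \<Longrightarrow> y \<in> carrier L \<Longrightarrow> \<exists>i\<in>I. \<exists>x\<in>carrier (D i). c i x = y"
  unfolding directed_colimit_def by simp

lemma colim_kernel:
  "directed_colimit I r D t L c \<Longrightarrow> i \<in> I \<Longrightarrow> x \<in> carrier (D i) \<Longrightarrow> c i x = \<zero>\<^bsub>L\<^esub> \<Longrightarrow>
    \<exists>j. (i, j) \<in> r \<and> t i j x = \<zero>\<^bsub>D j\<^esub>"
  unfolding directed_colimit_def by simp

lemma colim_eq:
  assumes C: "directed_colimit I r D t L c" and i: "i \<in> I" and x: "x \<in> carrier (D i)" and y: "y \<in> carrier (D i)"
    and eq: "c i x = c i y"
  shows "\<exists>j. (i, j) \<in> r \<and> t i j x = t i j y"
proof -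
  have lD: "left_module R (D i)" and lL: "left_module R L"
    using small_module_left[OF colim_small[OF C i]] small_module_left[OF colim_small_lim[OF C]] .
  interpret D: left_module R "D i" by (rule lD)
  interpret L: left_module R L by (rule lL)
  have "c i (x \<ominus>\<^bsub>D i\<^esub> y) = \<zero>\<^bsub>L\<^esub>"
    using linear_map_diff[OF lD lL colim_map[OF C i] x y] eq linear_map_closed[OF colim_map[OF C i] y]
    by (simp add: a_minus_def L.M.r_neg)
  moreover have d: "x \<ominus>\<^bsub>D i\<^esub> y \<in> carrier (D i)" using x y by simp
  ultimately obtain j where j: "(i, j) \<in> r" "t i j (x \<ominus>\<^bsub>D i\<^esub> y) = \<zero>\<^bsub>D j\<^esub>"
    using colim_kernel[OF C i d] by blast
  have lj: "left_module R (D j)" by (rule small_module_left[OF colim_small[OF C colim_mem(2)[OF C j(1)]]])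
  interpret Dj: left_module R "D j" by (rule lj)
  note t = colim_trans_map[OF C j(1)]
  have "t i j x \<ominus>\<^bsub>D j\<^esub> t i j y = \<zero>\<^bsub>D j\<^esub>"
    using linear_map_diff[OF lD lj t x y] j(2) by simp
  then have "t i j x = t i j y"
    using Dj.M.minus_equality[of "t i j x" "\<ominus>\<^bsub>D j\<^esub> t i j y"] linear_map_closed[OF t x] linear_map_closed[OF t y]
    by (simp add: a_minus_def)
  then show ?thesis using j(1) by blast
qed

lemma colim_ideal_times:
  assumes C: "directed_colimit I r D t L c" and y: "y \<in> ideal_times A L"
  shows "\<exists>i\<in>I. \<exists>x\<in>ideal_times A (D i). c i x = y"
proof -
  note lm = small_module_left[OF colim_small[OF C]] and lL = small_module_left[OF colim_small_lim[OF C]]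
  show ?thesis
    using y
  proof induction
    case zero
    obtain i where i: "i \<in> I" using colim_nonempty[OF C] by blast
    show ?case
      using linear_map_zero[OF lm[OF i] lL colim_map[OF C i]] ideal_times.zero[of "D i" A] i by metis
  next
    case (step a x y)
    obtain i u where i: "i \<in> I" "u \<in> carrier (D i)" "c i u = x" using colim_surj[OF C step(2)] by blast
    obtain j v where j: "j \<in> I" "v \<in> ideal_times A (D j)" "c j v = y" using step.IH by blast
    obtain k where k: "(i, k) \<in> r" "(j, k) \<in> r" using colim_directed[OF C i(1) j(1)] by blast
    have kI: "k \<in> I" by (rule colim_mem(2)[OF C k(1)])
    interpret Dk: left_module R "D k" by (rule lm[OF kI])
    have vc: "v \<in> carrier (D j)" by (rule ideal_times_closed[OF lm[OF j(1)] A_sub j(2)])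
    have u': "t i k u \<in> carrier (D k)" by (rule linear_map_closed[OF colim_trans_map[OF C k(1)] i(2)])
    have v': "t j k v \<in> ideal_times A (D k)"
      by (rule ideal_times_image[OF lm[OF j(1)] lm[OF kI] A_sub colim_trans_map[OF C k(2)] j(2)])
    have v'': "t j k v \<in> carrier (D k)" by (rule ideal_times_closed[OF lm[OF kI] A_sub v'])
    have "c k (a \<odot>\<^bsub>D k\<^esub> t i k u \<oplus>\<^bsub>D k\<^esub> t j k v) = a \<odot>\<^bsub>L\<^esub> x \<oplus>\<^bsub>L\<^esub> y"
      using u' v'' A_closed(4)[OF step(1)] Dk.smult_closed colim_compat[OF C k(1) i(2)] colim_compat[OF C k(2) vc] i(3) j(3)
      by (simp add: linear_map_add[OF colim_map[OF C kI]] linear_map_smult[OF colim_map[OF C kI]])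
    then show ?case using ideal_times.step[OF step(1) u' v'] kI by blast
  qed
qed

lemma colim_ideal_times_reflect:
  assumes C: "directed_colimit I r D t L c" and i: "i \<in> I" and x: "x \<in> carrier (D i)" and cx: "c i x \<in> ideal_times A L"
  shows "\<exists>j. (i, j) \<in> r \<and> t i j x \<in> ideal_times A (D j)"
proof -
  note lm = small_module_left[OF colim_small[OF C]]
  obtain j y where j: "j \<in> I" "y \<in> ideal_times A (D j)" "c j y = c i x" using colim_ideal_times[OF C cx] by blast
  have yc: "y \<in> carrier (D j)" by (rule ideal_times_closed[OF lm[OF j(1)] A_sub j(2)])
  obtain k where k: "(i, k) \<in> r" "(j, k) \<in> r" using colim_directed[OF C i j(1)] by blast
  have kI: "k \<in> I" by (rule colim_mem(2)[OF C k(1)])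
  have "c k (t i k x) = c k (t j k y)"
    using colim_compat[OF C k(1) x] colim_compat[OF C k(2) yc] j(3) by simp
  then obtain l where l: "(k, l) \<in> r" "t k l (t i k x) = t k l (t j k y)"
    using colim_eq[OF C kI linear_map_closed[OF colim_trans_map[OF C k(1)] x]
        linear_map_closed[OF colim_trans_map[OF C k(2)] yc]] by blast
  have "t i l x = t j l y" using l(2) colim_comp[OF C k(1) l(1) x] colim_comp[OF C k(2) l(1) yc] by simp
  moreover have jl: "(j, l) \<in> r" by (rule colim_trans[OF C k(2) l(1)])
  ultimately have "t i l x \<in> ideal_times A (D l)"
    using ideal_times_image[OF lm[OF j(1)] lm[OF colim_mem(2)[OF C jl]] A_sub colim_trans_map[OF C jl] j(2)] by simp
  then show ?thesis using colim_trans[OF C k(1) l(1)] by blast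
qed

definition free_map :: "('r, 'u) module \<Rightarrow> ('u \<Rightarrow> 'u) \<Rightarrow> 'u \<Rightarrow> 'u" where
  "free_map N f = free_lift (free_module (carrier N)) (\<lambda>x. basis (f x))"

lemma free_map_linear:
  assumes M: "small_module U R M" and N: "small_module U R N" and f: "\<And>x. x \<in> carrier M \<Longrightarrow> f x \<in> carrier N"
  shows "linear_map R (free_module (carrier M)) (free_module (carrier N)) (free_map N f)"
    and "\<And>x. x \<in> carrier M \<Longrightarrow> free_map N f (basis x) = basis (f x)"
proof -
  have h: "(\<lambda>x. basis (f x)) \<in> carrier M \<rightarrow> carrier (free_module (carrier N))"
    using f basis_closed by blast
  note l = free_syzygy_props(6)[OF M] free_syzygy_props(2)[OF N] h
  show "linear_map R (free_module (carrier M)) (free_module (carrier N)) (free_map N f)"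
    unfolding free_map_def by (rule free_lift_linear[OF l])
  show "free_map N f (basis x) = basis (f x)" if "x \<in> carrier M" for x
    unfolding free_map_def by (rule free_lift_basis[OF l that])
qed

lemma free_lift_cong:
  assumes X: "X \<subseteq> U" and N: "left_module R N" and u: "u \<in> carrier (free_module X)"
    and h: "h \<in> X \<rightarrow> carrier N" and eq: "\<And>x. x \<in> X \<Longrightarrow> dec u x \<noteq> \<zero> \<Longrightarrow> g x = h x"
  shows "free_lift N g u = free_lift N h u"
proof -
  interpret N: left_module R N by (rule N)
  show ?thesis
    unfolding free_lift_def
    by (rule N.M.finsum_cong')
      (use eq dec_support[OF X u] h N.smult_closed dec_closed[OF X u] in \<open>auto simp: Pi_iff subset_iff\<close>)
qed

lemma free_map_comp:
  assumes M: "small_module U R M" and N: "small_module U R N" and P: "small_module U R P"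
    and f: "\<And>x. x \<in> carrier M \<Longrightarrow> f x \<in> carrier N" and g: "\<And>x. x \<in> carrier N \<Longrightarrow> g x \<in> carrier P"
    and u: "u \<in> carrier (free_module (carrier M))"
  shows "free_map P g (free_map N f u) = free_map P (\<lambda>x. g (f x)) u"
proof (rule free_map_unique[OF free_syzygy_props(6)[OF M] free_syzygy_props(2)[OF P] _ _ _ u])
  note F = free_map_linear[OF M N f] and G = free_map_linear[OF N P g]
    and H = free_map_linear[OF M P, of "\<lambda>x. g (f x)"]
  show "linear_map R (free_module (carrier M)) (free_module (carrier P)) (\<lambda>u. free_map P g (free_map N f u))"
    by (rule linear_map_comp[OF F(1) G(1)])
  show "linear_map R (free_module (carrier M)) (free_module (carrier P)) (free_map P (\<lambda>x. g (f x)))"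
    by (rule H(1)) (use f g in blast)
  show "free_map P g (free_map N f (basis x)) = free_map P (\<lambda>x. g (f x)) (basis x)" if "x \<in> carrier M" for x
    using that f g F(2) G(2) H(2) by simp
qed

lemma free_map_eq:
  assumes M: "small_module U R M" and N: "small_module U R N"
    and f: "\<And>x. x \<in> carrier M \<Longrightarrow> f x \<in> carrier N" and u: "u \<in> carrier (free_module (carrier M))"
    and eq: "\<And>x. x \<in> carrier M \<Longrightarrow> dec u x \<noteq> \<zero> \<Longrightarrow> g x = f x"
  shows "free_map N g u = free_map N f u"
  unfolding free_map_def
  by (rule free_lift_cong[OF free_syzygy_props(6)[OF M] free_syzygy_props(2)[OF N] u])
    (use f basis_closed eq in auto)

lemma counit_free_map:
  assumes M: "small_module U R M" and N: "small_module U R N" and f: "linear_map R M N f"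
    and u: "u \<in> carrier (free_module (carrier M))"
  shows "counit N (free_map N f u) = f (counit M u)"
proof (rule free_map_unique[OF free_syzygy_props(6)[OF M] small_module_left[OF N] _ _ _ u])
  note F = free_map_linear[OF M N linear_map_closed[OF f]]
  show "linear_map R (free_module (carrier M)) N (\<lambda>u. counit N (free_map N f u))"
    by (rule linear_map_comp[OF F(1) free_syzygy_props(4)[OF N]])
  show "linear_map R (free_module (carrier M)) N (\<lambda>u. f (counit M u))"
    by (rule linear_map_comp[OF free_syzygy_props(4)[OF M] f])
  show "counit N (free_map N f (basis x)) = f (counit M (basis x))" if "x \<in> carrier M" for x
    using that F(2) free_syzygy_props(5)[OF M that] free_syzygy_props(5)[OF N linear_map_closed[OF f that]] by simp
qed

lemma free_map_syzygy:
  assumes M: "small_module U R M" and N: "small_module U R N" and f: "linear_map R M N f"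
  shows "linear_map R (syzygy M) (syzygy N) (free_map N f)"
  unfolding syzygy_def
  by (rule linear_map_kernels[OF free_map_linear(1)[OF M N linear_map_closed[OF f]]])
    (use counit_free_map[OF M N f] linear_map_zero[OF small_module_left[OF M] small_module_left[OF N] f] in auto)

lemma syzygy_carrier:
  "carrier (syzygy M) = {x \<in> carrier (free_module (carrier M)). counit M x = \<zero>\<^bsub>M\<^esub>}"
  "\<zero>\<^bsub>syzygy M\<^esub> = \<zero>\<^bsub>free_module (carrier M)\<^esub>"
  unfolding syzygy_def by simp_all

lemma colim_finite_bound:
  assumes C: "directed_colimit I r D t L c" and i: "i \<in> I" and B: "finite B" "B \<subseteq> carrier (D i)"
  shows "\<exists>j. (i, j) \<in> r \<and> (\<forall>x\<in>B. \<forall>y\<in>B. c i x = c i y \<longrightarrow> t i j x = t i j y)"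
proof -
  have "\<exists>j. (i, j) \<in> r \<and> (\<forall>(x, y)\<in>S. c i x = c i y \<longrightarrow> t i j x = t i j y)"
    if "finite S" "S \<subseteq> carrier (D i) \<times> carrier (D i)" for S
    using that
  proof (induction rule: finite_induct)
    case empty then show ?case using colim_refl[OF C i] by blast
  next
    case (insert p S)
    obtain x y where p: "p = (x, y)" by (cases p)
    have xy: "x \<in> carrier (D i)" "y \<in> carrier (D i)" using insert.prems p by auto
    obtain j where j: "(i, j) \<in> r" "\<forall>(x, y)\<in>S. c i x = c i y \<longrightarrow> t i j x = t i j y"
      using insert by auto
    obtain k where k: "(i, k) \<in> r" "c i x = c i y \<longrightarrow> t i k x = t i k y"
      using colim_eq[OF C i xy] colim_refl[OF C i] by blast
    obtain l where l: "(j, l) \<in> r" "(k, l) \<in> r"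
      using colim_directed[OF C colim_mem(2)[OF C j(1)] colim_mem(2)[OF C k(1)]] by blast
    have "t i l a = t i l b" if "(a, b) \<in> insert p S" "c i a = c i b" for a b
    proof (cases "(a, b) = p")
      case True
      then have "t i k a = t i k b" using k(2) p that(2) by simp
      then show ?thesis
        using colim_comp[OF C k(1) l(2), of a] colim_comp[OF C k(1) l(2), of b] True p xy by simp
    next
      case False
      then have ab: "(a, b) \<in> S" using that(1) by simp
      then have "t i j a = t i j b" using j(2) that(2) by blast
      moreover have "a \<in> carrier (D i)" "b \<in> carrier (D i)" using ab insert.prems by auto
      ultimately show ?thesis using colim_comp[OF C j(1) l(1), of a] colim_comp[OF C j(1) l(1), of b] by simp
    qed
    then show ?case using colim_trans[OF C j(1) l(1)] by blast
  qed
  from this[of "B \<times> B", OF finite_cartesian_product[OF B(1) B(1)]] B(2)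
  obtain j where "(i, j) \<in> r" "\<forall>(x, y)\<in>B \<times> B. c i x = c i y \<longrightarrow> t i j x = t i j y"
    by blast
  then show ?thesis by blast
qed

lemma colim_free:
  assumes C: "directed_colimit I r D t L c"
  shows "directed_colimit I r (\<lambda>i. free_module (carrier (D i))) (\<lambda>i j. free_map (D j) (t i j))
    (free_module (carrier L)) (\<lambda>i. free_map L (c i))"
proof -
  let ?F = "\<lambda>i. free_module (carrier (D i))" and ?L = "free_module (carrier L)"
  note sm = colim_small[OF C] and sL = colim_small_lim[OF C] and mem = colim_mem[OF C]
  note tc = linear_map_closed[OF colim_trans_map[OF C]] and cc = linear_map_closed[OF colim_map[OF C]]
  have T: "linear_map R (?F i) (?F j) (free_map (D j) (t i j))" if "(i, j) \<in> r" for i j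
    by (rule free_map_linear(1)[OF sm[OF mem(1)[OF that]] sm[OF mem(2)[OF that]] tc[OF that]])
  have K: "linear_map R (?F i) ?L (free_map L (c i))"
    and Kb: "\<And>x. x \<in> carrier (D i) \<Longrightarrow> free_map L (c i) (basis x) = basis (c i x)" if "i \<in> I" for i
    using free_map_linear[OF sm[OF that] sL cc[OF that]] by simp_all
  have fin: "finite {x. dec u x \<noteq> \<zero>}" "{x. dec u x \<noteq> \<zero>} \<subseteq> carrier (D i)"
    if "i \<in> I" "u \<in> carrier (?F i)" for i u
    using finite_dec_support dec_support free_syzygy_props(6)[OF sm[OF that(1)]] that(2) by blast+
  have comp: "free_map (D k) (t j k) (free_map (D j) (t i j) u) = free_map (D k) (t i k) u"
    if "(i, j) \<in> r" "(j, k) \<in> r" "u \<in> carrier (?F i)" for i j k u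
  proof -
    have ik: "(i, k) \<in> r" by (rule colim_trans[OF C that(1,2)])
    have "free_map (D k) (t j k) (free_map (D j) (t i j) u) = free_map (D k) (\<lambda>x. t j k (t i j x)) u"
      by (rule free_map_comp[OF sm[OF mem(1)[OF that(1)]] sm[OF mem(1)[OF that(2)]] sm[OF mem(2)[OF that(2)]]
            tc[OF that(1)] tc[OF that(2)] that(3)])
    also have "\<dots> = free_map (D k) (t i k) u"
      by (rule free_map_eq[OF sm[OF mem(1)[OF that(1)]] sm[OF mem(2)[OF that(2)]] tc[OF ik] that(3)])
        (simp_all add: colim_comp[OF C that(1,2)])
    finally show ?thesis .
  qed
  have compat: "free_map L (c j) (free_map (D j) (t i j) u) = free_map L (c i) u"
    if "(i, j) \<in> r" "u \<in> carrier (?F i)" for i j u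
  proof -
    have "free_map L (c j) (free_map (D j) (t i j) u) = free_map L (\<lambda>x. c j (t i j x)) u"
      by (rule free_map_comp[OF sm[OF mem(1)[OF that(1)]] sm[OF mem(2)[OF that(1)]] sL
            tc[OF that(1)] cc[OF mem(2)[OF that(1)]] that(2)])
    also have "\<dots> = free_map L (c i) u"
      by (rule free_map_eq[OF sm[OF mem(1)[OF that(1)]] sL cc[OF mem(1)[OF that(1)]] that(2)])
        (simp_all add: colim_compat[OF C that(1)])
    finally show ?thesis .
  qed
  have surj: "\<exists>i\<in>I. \<exists>u\<in>carrier (?F i). free_map L (c i) u = v" if v: "v \<in> carrier ?L" for v
    using free_syzygy_props(6)[OF sL] v
  proof (induction rule: free_module_induct)
    case zero
    obtain i where i: "i \<in> I" using colim_nonempty[OF C] by blast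
    interpret F: left_module R "?F i" by (rule free_syzygy_props(2)[OF sm[OF i]])
    show ?case
      using linear_map_zero[OF F.left_module_axioms free_syzygy_props(2)[OF sL] K[OF i]] F.M.zero_closed i by metis
  next
    case (step a y w)
    obtain i x where i: "i \<in> I" "x \<in> carrier (D i)" "c i x = y" using colim_surj[OF C step(2)] by blast
    obtain j u where j: "j \<in> I" "u \<in> carrier (?F j)" "free_map L (c j) u = w" using step.IH by blast
    obtain k where k: "(i, k) \<in> r" "(j, k) \<in> r" using colim_directed[OF C i(1) j(1)] by blast
    have kI: "k \<in> I" by (rule mem(2)[OF k(1)])
    interpret F: left_module R "?F k" by (rule free_syzygy_props(2)[OF sm[OF kI]])
    have x': "t i k x \<in> carrier (D k)" by (rule tc[OF k(1) i(2)])
    have b: "basis (t i k x) \<in> carrier (?F k)" by (rule basis_closed[OF x'])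
    have u': "free_map (D k) (t j k) u \<in> carrier (?F k)"
      by (rule linear_map_closed[OF T[OF k(2)] j(2)])
    have "free_map L (c k) (a \<odot>\<^bsub>?F k\<^esub> basis (t i k x) \<oplus>\<^bsub>?F k\<^esub> free_map (D k) (t j k) u) = a \<odot>\<^bsub>?L\<^esub> basis y \<oplus>\<^bsub>?L\<^esub> w"
      using b u' step(1) F.smult_closed compat[OF k(2) j(2)] j(3) Kb[OF kI x'] colim_compat[OF C k(1) i(2)] i(3)
      by (simp add: linear_map_add[OF K[OF kI]] linear_map_smult[OF K[OF kI]])
    moreover have "a \<odot>\<^bsub>?F k\<^esub> basis (t i k x) \<oplus>\<^bsub>?F k\<^esub> free_map (D k) (t j k) u \<in> carrier (?F k)"
      using b u' step(1) F.smult_closed by simp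
    ultimately show ?case using kI by blast
  qed
  have ker: "\<exists>j. (i, j) \<in> r \<and> free_map (D j) (t i j) u = \<zero>\<^bsub>?F j\<^esub>"
    if i: "i \<in> I" and u: "u \<in> carrier (?F i)" and z: "free_map L (c i) u = \<zero>\<^bsub>?L\<^esub>" for i u
  proof -
    let ?B = "{x. dec u x \<noteq> \<zero>}"
    obtain j where j: "(i, j) \<in> r" "\<And>x y. x \<in> ?B \<Longrightarrow> y \<in> ?B \<Longrightarrow> c i x = c i y \<Longrightarrow> t i j x = t i j y"
      using colim_finite_bound[OF C i fin[OF i u]] by blast
    have jI: "j \<in> I" by (rule mem(2)[OF j(1)])
    interpret Dj: left_module R "D j" by (rule small_module_left[OF sm[OF jI]])
    \<comment> \<open>The free module functor is defined on arbitrary maps of sets, so a partial inverse \<open>s\<close> of \<open>c j\<close> need not be linear.\<close>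
    define s where "s y = (if \<exists>x\<in>?B. c i x = y then t i j (SOME x. x \<in> ?B \<and> c i x = y) else \<zero>\<^bsub>D j\<^esub>)" for y
    have wit: "(SOME x. x \<in> ?B \<and> c i x = y) \<in> ?B \<and> c i (SOME x. x \<in> ?B \<and> c i x = y) = y"
      if "\<exists>x\<in>?B. c i x = y" for y
      by (rule someI_ex) (use that in blast)
    have sc: "s y \<in> carrier (D j)" for y
      unfolding s_def using wit[of y] fin(2)[OF i u] tc[OF j(1)] by auto
    have "s (c i x) = t i j x" if "x \<in> ?B" for x
    proof -
      have ex: "\<exists>w\<in>?B. c i w = c i x" using that by blast
      then show ?thesis
        unfolding s_def if_P[OF ex] using wit[OF ex] j(2)[OF _ that] by blast
    qed
    then have "free_map (D j) (t i j) u = free_map (D j) (\<lambda>x. s (c i x)) u"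
      by (intro free_map_eq[OF sm[OF i] sm[OF jI] sc u]) simp
    also have "\<dots> = free_map (D j) s (free_map L (c i) u)"
      by (rule free_map_comp[OF sm[OF i] sL sm[OF jI] cc[OF i] sc u, symmetric])
    also have "\<dots> = \<zero>\<^bsub>?F j\<^esub>"
      unfolding z by (rule linear_map_zero[OF free_syzygy_props(2)[OF sL] free_syzygy_props(2)[OF sm[OF jI]]
            free_map_linear(1)[OF sL sm[OF jI] sc]])
    finally show ?thesis using j(1) by blast
  qed
  have sF: "small_module U R (free_module (carrier M))" if "small_module U R M" for M
    by (rule small_module_free[OF small_module_carrier[OF that]])
  show ?thesis
    unfolding directed_colimit_def
  proof (intro conjI allI impI ballI)
    show "preorder_on I r" by (rule colim_preorder[OF C])
    show "I \<noteq> {}" by (rule colim_nonempty[OF C])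
    show "\<exists>k. (i, k) \<in> r \<and> (j, k) \<in> r" if "i \<in> I" "j \<in> I" for i j by (rule colim_directed[OF C that])
    show "small_module U R (?F i)" if "i \<in> I" for i by (rule sF[OF sm[OF that]])
    show "small_module U R ?L" by (rule sF[OF sL])
  qed (rule T K comp compat surj ker; assumption)+
qed

lemma colim_syzygy:
  assumes C: "directed_colimit I r D t L c"
  shows "directed_colimit I r (\<lambda>i. syzygy (D i)) (\<lambda>i j. free_map (D j) (t i j)) (syzygy L) (\<lambda>i. free_map L (c i))"
proof -
  note F = colim_free[OF C]
  note sm = colim_small[OF C] and sL = colim_small_lim[OF C] and mem = colim_mem[OF C]
  have surj: "\<exists>i\<in>I. \<exists>u\<in>carrier (syzygy (D i)). free_map L (c i) u = v" if v: "v \<in> carrier (syzygy L)" for v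
  proof -
    have v': "v \<in> carrier (free_module (carrier L))" "counit L v = \<zero>\<^bsub>L\<^esub>" using v unfolding syzygy_carrier by simp_all
    obtain i u where i: "i \<in> I" "u \<in> carrier (free_module (carrier (D i)))" "free_map L (c i) u = v"
      using colim_surj[OF F v'(1)] by blast
    have cu: "counit (D i) u \<in> carrier (D i)" by (rule linear_map_closed[OF free_syzygy_props(4)[OF sm[OF i(1)]] i(2)])
    have "c i (counit (D i) u) = \<zero>\<^bsub>L\<^esub>"
      using counit_free_map[OF sm[OF i(1)] sL colim_map[OF C i(1)] i(2)] i(3) v'(2) by simp
    then obtain j where j: "(i, j) \<in> r" "t i j (counit (D i) u) = \<zero>\<^bsub>D j\<^esub>" using colim_kernel[OF C i(1) cu] by blast
    note jI = mem(2)[OF j(1)]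
    have "free_map (D j) (t i j) u \<in> carrier (syzygy (D j))"
      unfolding syzygy_carrier
      using counit_free_map[OF sm[OF i(1)] sm[OF jI] colim_trans_map[OF C j(1)] i(2)] j(2)
        linear_map_closed[OF colim_trans_map[OF F j(1)] i(2)] by simp
    then show ?thesis using jI colim_compat[OF F j(1) i(2)] i(3) by blast
  qed
  have sub: "x \<in> carrier (syzygy M) \<Longrightarrow> x \<in> carrier (free_module (carrier M))" for x M
    unfolding syzygy_carrier by simp
  show ?thesis
    unfolding directed_colimit_def
  proof (intro conjI allI impI ballI)
    show "preorder_on I r" by (rule colim_preorder[OF C])
    show "I \<noteq> {}" by (rule colim_nonempty[OF C])
    show "\<exists>k. (i, k) \<in> r \<and> (j, k) \<in> r" if "i \<in> I" "j \<in> I" for i j by (rule colim_directed[OF C that])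
    show "small_module U R (syzygy (D i))" if "i \<in> I" for i by (rule small_module_syzygy[OF sm[OF that]])
    show "small_module U R (syzygy L)" by (rule small_module_syzygy[OF sL])
    show "linear_map R (syzygy (D i)) (syzygy (D j)) (free_map (D j) (t i j))" if "(i, j) \<in> r" for i j
      by (rule free_map_syzygy[OF sm[OF mem(1)[OF that]] sm[OF mem(2)[OF that]] colim_trans_map[OF C that]])
    show "linear_map R (syzygy (D i)) (syzygy L) (free_map L (c i))" if "i \<in> I" for i
      by (rule free_map_syzygy[OF sm[OF that] sL colim_map[OF C that]])
    show "free_map (D k) (t j k) (free_map (D j) (t i j) x) = free_map (D k) (t i k) x"
      if "(i, j) \<in> r" "(j, k) \<in> r" "x \<in> carrier (syzygy (D i))" for i j k x
      by (rule colim_comp[OF F that(1,2) sub[OF that(3)]])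
    show "free_map L (c j) (free_map (D j) (t i j) x) = free_map L (c i) x"
      if "(i, j) \<in> r" "x \<in> carrier (syzygy (D i))" for i j x
      by (rule colim_compat[OF F that(1) sub[OF that(2)]])
    show "\<exists>i\<in>I. \<exists>u\<in>carrier (syzygy (D i)). free_map L (c i) u = v" if "v \<in> carrier (syzygy L)" for v
      by (rule surj[OF that])
    show "\<exists>j. (i, j) \<in> r \<and> free_map (D j) (t i j) x = \<zero>\<^bsub>syzygy (D j)\<^esub>"
      if "i \<in> I" "x \<in> carrier (syzygy (D i))" "free_map L (c i) x = \<zero>\<^bsub>syzygy L\<^esub>" for i x
      using colim_kernel[OF F that(1) sub[OF that(2)]] that(3) unfolding syzygy_carrier(2) .
  qed
qed

primrec syzygy_map :: "nat \<Rightarrow> ('r, 'u) module \<Rightarrow> ('u \<Rightarrow> 'u) \<Rightarrow> 'u \<Rightarrow> 'u" where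
  "syzygy_map 0 N f = f"
| "syzygy_map (Suc n) N f = free_map ((syzygy ^^ n) N) (syzygy_map n N f)"

lemma colim_syzygies:
  assumes C: "directed_colimit I r D t L c"
  shows "directed_colimit I r (\<lambda>i. (syzygy ^^ n) (D i)) (\<lambda>i j. syzygy_map n (D j) (t i j)) ((syzygy ^^ n) L)
    (\<lambda>i. syzygy_map n L (c i))"
proof (induction n)
  case 0 then show ?case using C by simp
next
  case (Suc n) then show ?case using colim_syzygy[OF Suc] by simp
qed

lemma syzygy_map_linear:
  assumes M: "small_module U R M" and N: "small_module U R N" and f: "linear_map R M N f"
  shows "linear_map R ((syzygy ^^ n) M) ((syzygy ^^ n) N) (syzygy_map n N f)"
proof (induction n)
  case 0 then show ?case using f by simp
next
  case (Suc n)
  then show ?case using free_map_syzygy[OF small_module_syzygies[OF M] small_module_syzygies[OF N] Suc] by simp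
qed

text \<open>All instances over \<open>M\<close> of the conditions in \<open>h_exact\<close> are solvable in \<open>N\<close>.\<close>

definition solves :: "('r, 'u) module \<Rightarrow> ('r, 'u) module \<Rightarrow> ('u \<Rightarrow> 'u) \<Rightarrow> bool" where
  "solves M N f \<longleftrightarrow> (\<forall>x\<in>carrier M. f x \<in> ideal_times A N) \<and>
     (\<forall>n. \<forall>x\<in>ideal_times A (free_module (carrier ((syzygy ^^ n) M))).
       counit ((syzygy ^^ n) M) x = \<zero>\<^bsub>(syzygy ^^ n) M\<^esub> \<longrightarrow> syzygy_map (Suc n) N f x \<in> ideal_times A ((syzygy ^^ Suc n) N))"

lemma h_exact_solves:
  assumes M: "small_module U R M" and N: "small_module U R N" and f: "linear_map R M N f" and h: "h_exact M"
  shows "solves M N f"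
  unfolding solves_def
proof (intro conjI allI ballI impI)
  fix x assume "x \<in> carrier M"
  then have "x \<in> ideal_times A M" using h unfolding h_exact_def by blast
  then show "f x \<in> ideal_times A N"
    by (rule ideal_times_image[OF small_module_left[OF M] small_module_left[OF N] A_sub f])
next
  fix n x
  assume x: "x \<in> ideal_times A (free_module (carrier ((syzygy ^^ n) M)))" "counit ((syzygy ^^ n) M) x = \<zero>\<^bsub>(syzygy ^^ n) M\<^esub>"
  have "pure_presentation A (free_module (carrier ((syzygy ^^ n) M))) ((syzygy ^^ n) M) (counit ((syzygy ^^ n) M))"
    using h unfolding h_exact_def by blast
  then have "x \<in> ideal_times A ((syzygy ^^ Suc n) M)"
    using x unfolding pure_presentation_def by (simp add: syzygy_def)
  then show "syzygy_map (Suc n) N f x \<in> ideal_times A ((syzygy ^^ Suc n) N)"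
    by (rule ideal_times_image[OF small_module_left[OF small_module_syzygies[OF M]]
          small_module_left[OF small_module_syzygies[OF N]] A_sub syzygy_map_linear[OF M N f]])
qed

lemma colim_h_exact:
  assumes C: "directed_colimit I r D t L c"
    and sol: "\<And>i. i \<in> I \<Longrightarrow> \<exists>j. (i, j) \<in> r \<and> solves (D i) (D j) (t i j)"
  shows "h_exact L"
  unfolding h_exact_def
proof (intro conjI allI)
  note sm = colim_small[OF C] and sL = colim_small_lim[OF C] and mem = colim_mem[OF C]
  show "carrier L \<subseteq> ideal_times A L"
  proof
    fix y assume "y \<in> carrier L"
    then obtain i x where i: "i \<in> I" "x \<in> carrier (D i)" "c i x = y" using colim_surj[OF C] by blast
    obtain j where j: "(i, j) \<in> r" "solves (D i) (D j) (t i j)" using sol[OF i(1)] by blast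
    have "t i j x \<in> ideal_times A (D j)" using j(2) i(2) unfolding solves_def by blast
    then have "c j (t i j x) \<in> ideal_times A L"
      by (rule ideal_times_image[OF small_module_left[OF sm[OF mem(2)[OF j(1)]]] small_module_left[OF sL] A_sub
            colim_map[OF C mem(2)[OF j(1)]]])
    then show "y \<in> ideal_times A L" using colim_compat[OF C j(1) i(2)] i(3) by simp
  qed
  fix n
  let ?s = "\<lambda>M. (syzygy ^^ n) M" and ?t = "\<lambda>i j. syzygy_map n (D j) (t i j)" and ?c = "\<lambda>i. syzygy_map n L (c i)"
  note S = colim_syzygies[OF C, of n]
  note F = colim_free[OF S]
  note S' = colim_syzygies[OF C, of "Suc n"]
  show "pure_presentation A (free_module (carrier (?s L))) (?s L) (counit (?s L))"
    unfolding pure_presentation_def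
  proof (intro ballI impI)
    fix y assume y: "y \<in> ideal_times A (free_module (carrier (?s L)))" and ey: "counit (?s L) y = \<zero>\<^bsub>?s L\<^esub>"
    obtain i x where i: "i \<in> I" "x \<in> ideal_times A (free_module (carrier (?s (D i))))" "free_map (?s L) (?c i) x = y"
      using colim_ideal_times[OF F y] by blast
    have xc: "x \<in> carrier (free_module (carrier (?s (D i))))"
      by (rule ideal_times_closed[OF free_syzygy_props(2)[OF colim_small[OF S i(1)]] A_sub i(2)])
    have ex: "counit (?s (D i)) x \<in> carrier (?s (D i))"
      by (rule linear_map_closed[OF free_syzygy_props(4)[OF colim_small[OF S i(1)]] xc])
    have "?c i (counit (?s (D i)) x) = \<zero>\<^bsub>?s L\<^esub>"
      using counit_free_map[OF colim_small[OF S i(1)] colim_small_lim[OF S] colim_map[OF S i(1)] xc] i(3) ey by simp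
    then obtain j where j: "(i, j) \<in> r" "?t i j (counit (?s (D i)) x) = \<zero>\<^bsub>?s (D j)\<^esub>"
      using colim_kernel[OF S i(1) ex] by blast
    note jI = mem(2)[OF j(1)]
    let ?x = "free_map (?s (D j)) (?t i j) x"
    have x': "?x \<in> ideal_times A (free_module (carrier (?s (D j))))"
      by (rule ideal_times_image[OF free_syzygy_props(2)[OF colim_small[OF S i(1)]]
            free_syzygy_props(2)[OF colim_small[OF S jI]] A_sub colim_trans_map[OF F j(1)] i(2)])
    have ex': "counit (?s (D j)) ?x = \<zero>\<^bsub>?s (D j)\<^esub>"
      using counit_free_map[OF colim_small[OF S i(1)] colim_small[OF S jI] colim_trans_map[OF S j(1)] xc] j(2) by simp
    obtain k where k: "(j, k) \<in> r" "solves (D j) (D k) (t j k)" using sol[OF jI] by blast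
    note kI = mem(2)[OF k(1)]
    have "syzygy_map (Suc n) (D k) (t j k) ?x \<in> ideal_times A ((syzygy ^^ Suc n) (D k))"
      using k(2) x' ex' unfolding solves_def by blast
    then have "syzygy_map (Suc n) L (c k) (syzygy_map (Suc n) (D k) (t j k) ?x) \<in> ideal_times A ((syzygy ^^ Suc n) L)"
      by (rule ideal_times_image[OF small_module_left[OF colim_small[OF S' kI]] small_module_left[OF colim_small_lim[OF S']]
            A_sub colim_map[OF S' kI]])
    moreover have "syzygy_map (Suc n) L (c k) (syzygy_map (Suc n) (D k) (t j k) ?x) = y"
      using colim_compat[OF F k(1) linear_map_closed[OF colim_trans_map[OF F j(1)] xc]] colim_compat[OF F j(1) xc] i(3)
      by simp
    ultimately show "y \<in> ideal_times A (kernel_module (free_module (carrier (?s L))) (?s L) (counit (?s L)))"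
      by (simp add: syzygy_def)
  qed
qed

corollary colim_h_exact_all:
  assumes C: "directed_colimit I r D t L c" and h: "\<And>i. i \<in> I \<Longrightarrow> h_exact (D i)"
  shows "h_exact L"
proof (rule colim_h_exact[OF C])
  fix i assume i: "i \<in> I"
  show "\<exists>j. (i, j) \<in> r \<and> solves (D i) (D j) (t i j)"
    using colim_refl[OF C i] h_exact_solves[OF colim_small[OF C i] colim_small[OF C i] colim_trans_map[OF C] h[OF i]]
    by blast
qed


section \<open>A Loewenheim-Skolem argument\<close>


lemma le_\<Lambda>_image: "|X| \<le>o |\<Lambda>| \<Longrightarrow> |f ` X| \<le>o |\<Lambda>|"
  by (rule ordLeq_transitive[OF card_of_image])

lemma le_\<Lambda>_subset: "|Y| \<le>o |\<Lambda>| \<Longrightarrow> X \<subseteq> Y \<Longrightarrow> |X| \<le>o |\<Lambda>|"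
  by (rule ordLeq_transitive[OF card_of_mono1])

lemma le_\<Lambda>_Un: "|X| \<le>o |\<Lambda>| \<Longrightarrow> |Y| \<le>o |\<Lambda>| \<Longrightarrow> |X \<union> Y| \<le>o |\<Lambda>|"
  by (rule card_of_Un_ordLeq_infinite[OF infinite_\<Lambda>])

lemma le_\<Lambda>_UNION: "|I| \<le>o |\<Lambda>| \<Longrightarrow> (\<And>i. i \<in> I \<Longrightarrow> |X i| \<le>o |\<Lambda>| ) \<Longrightarrow> |\<Union>i\<in>I. X i| \<le>o |\<Lambda>|"
  by (rule card_of_UNION_ordLeq_infinite[OF infinite_\<Lambda>]) auto

lemma le_\<Lambda>_countable: "|X :: nat set| \<le>o |\<Lambda>|"
  by (rule ordLeq_transitive[OF card_of_mono1 nat_le_\<Lambda>]) simp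

lemma le_\<Lambda>_finite:
  assumes "finite X" shows "|X| \<le>o |\<Lambda>|"
  by (rule ordLess_imp_ordLeq[OF finite_ordLess_infinite[OF card_of_Well_order card_of_Well_order]])
    (use assms infinite_\<Lambda> in simp_all)

lemma le_\<Lambda>_free: "|X| \<le>o |\<Lambda>| \<Longrightarrow> |carrier (free_module X)| \<le>o |\<Lambda>|"
  by (rule card_free_module[OF infinite_\<Lambda> _ R_le_\<Lambda>])

lemma le_\<Lambda>_syzygies:
  assumes "|carrier M| \<le>o |\<Lambda>|"
  shows "|carrier ((syzygy ^^ n) M)| \<le>o |\<Lambda>|"
proof (induction n)
  case 0 then show ?case using assms by simp
next
  case (Suc n)
  then show ?case
    using le_\<Lambda>_subset[OF le_\<Lambda>_free[OF Suc], of "carrier ((syzygy ^^ Suc n) M)"]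
    by (simp add: syzygy_carrier subset_iff)
qed

lemma colim_solves:
  assumes C: "directed_colimit I r D t L c" and h: "h_exact L" and i: "i \<in> I" and card: "|carrier (D i)| \<le>o |\<Lambda>|"
    and bound: "\<And>S. S \<subseteq> I \<Longrightarrow> |S| \<le>o |\<Lambda>| \<Longrightarrow> \<exists>u\<in>I. \<forall>s\<in>S. (s, u) \<in> r"
  shows "\<exists>j. (i, j) \<in> r \<and> solves (D i) (D j) (t i j)"
proof -
  let ?s = "\<lambda>n M. (syzygy ^^ n) M"
  note sm = colim_small[OF C] and sL = colim_small_lim[OF C] and mem = colim_mem[OF C]
  note lm = small_module_left[OF sm]
  define E where "E = (\<lambda>n. {x \<in> ideal_times A (free_module (carrier (?s n (D i)))). counit (?s n (D i)) x = \<zero>\<^bsub>?s n (D i)\<^esub>})"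
  have E_sub: "E n \<subseteq> carrier (?s (Suc n) (D i))" for n
  proof
    fix x assume "x \<in> E n"
    then show "x \<in> carrier (?s (Suc n) (D i))"
      unfolding E_def using ideal_times_closed[OF free_syzygy_props(2)[OF small_module_syzygies[OF sm[OF i]]] A_sub]
      by (simp add: syzygy_carrier)
  qed
  have "\<forall>x\<in>carrier (D i). \<exists>j. (i, j) \<in> r \<and> t i j x \<in> ideal_times A (D j)"
  proof
    fix x assume x: "x \<in> carrier (D i)"
    have "c i x \<in> ideal_times A L"
      using linear_map_closed[OF colim_map[OF C i] x] h unfolding h_exact_def by blast
    then show "\<exists>j. (i, j) \<in> r \<and> t i j x \<in> ideal_times A (D j)" by (rule colim_ideal_times_reflect[OF C i x])
  qed
  from bchoice[OF this] obtain j0 where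
    j0: "\<And>x. x \<in> carrier (D i) \<Longrightarrow> (i, j0 x) \<in> r \<and> t i (j0 x) x \<in> ideal_times A (D (j0 x))" by blast
  have "\<forall>x\<in>E n. \<exists>j. (i, j) \<in> r \<and> syzygy_map (Suc n) (D j) (t i j) x \<in> ideal_times A (?s (Suc n) (D j))" for n
  proof
    fix x assume x: "x \<in> E n"
    note S = colim_syzygies[OF C, of n] and S' = colim_syzygies[OF C, of "Suc n"]
    have xs: "x \<in> carrier (?s (Suc n) (D i))" using E_sub x by blast
    let ?y = "syzygy_map (Suc n) L (c i) x"
    have "?y \<in> ideal_times A (free_module (carrier (?s n L)))"
      using ideal_times_image[OF free_syzygy_props(2)[OF colim_small[OF S i]] free_syzygy_props(2)[OF colim_small_lim[OF S]]
          A_sub colim_map[OF colim_free[OF S] i], of x] x unfolding E_def by simp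
    moreover have ys: "?y \<in> carrier (?s (Suc n) L)" by (rule linear_map_closed[OF colim_map[OF S' i] xs])
    moreover have "pure_presentation A (free_module (carrier (?s n L))) (?s n L) (counit (?s n L))"
      using h unfolding h_exact_def by blast
    ultimately have "?y \<in> ideal_times A (?s (Suc n) L)"
      unfolding pure_presentation_def by (simp add: syzygy_def)
    then show "\<exists>j. (i, j) \<in> r \<and> syzygy_map (Suc n) (D j) (t i j) x \<in> ideal_times A (?s (Suc n) (D j))"
      by (rule colim_ideal_times_reflect[OF S' i xs])
  qed
  then have "\<forall>n. \<exists>f. \<forall>x\<in>E n. (i, f x) \<in> r \<and> syzygy_map (Suc n) (D (f x)) (t i (f x)) x \<in> ideal_times A (?s (Suc n) (D (f x)))"
    by (intro allI bchoice) blast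
  from choice[OF this] obtain j1 where
    j1: "\<And>n x. x \<in> E n \<Longrightarrow> (i, j1 n x) \<in> r \<and>
      syzygy_map (Suc n) (D (j1 n x)) (t i (j1 n x)) x \<in> ideal_times A (?s (Suc n) (D (j1 n x)))"
    by blast
  let ?J = "j0 ` carrier (D i) \<union> (\<Union>n\<in>UNIV. j1 n ` E n) \<union> {i}"
  have "|?J| \<le>o |\<Lambda>|"
    by (intro le_\<Lambda>_Un le_\<Lambda>_UNION le_\<Lambda>_image card le_\<Lambda>_countable le_\<Lambda>_finite finite.intros
        le_\<Lambda>_subset[OF le_\<Lambda>_syzygies[OF card] E_sub])
  moreover have "?J \<subseteq> I" using j0 j1 i mem(2) by blast
  ultimately obtain u where u: "u \<in> I" "\<And>s. s \<in> ?J \<Longrightarrow> (s, u) \<in> r" using bound[of ?J] by blast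
  have iu: "(i, u) \<in> r" using u(2) by blast
  have "solves (D i) (D u) (t i u)"
    unfolding solves_def
  proof (intro conjI allI ballI impI)
    fix x assume x: "x \<in> carrier (D i)"
    have j: "(i, j0 x) \<in> r" "t i (j0 x) x \<in> ideal_times A (D (j0 x))" and ju: "(j0 x, u) \<in> r"
      using j0[OF x] u(2) x by blast+
    have "t (j0 x) u (t i (j0 x) x) \<in> ideal_times A (D u)"
      by (rule ideal_times_image[OF lm[OF mem(2)[OF j(1)]] lm[OF u(1)] A_sub colim_trans_map[OF C ju] j(2)])
    then show "t i u x \<in> ideal_times A (D u)" using colim_comp[OF C j(1) ju x] by simp
  next
    fix n x
    assume x: "x \<in> ideal_times A (free_module (carrier (?s n (D i))))" "counit (?s n (D i)) x = \<zero>\<^bsub>?s n (D i)\<^esub>"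
    then have xE: "x \<in> E n" unfolding E_def by blast
    let ?j = "j1 n x"
    note S' = colim_syzygies[OF C, of "Suc n"]
    have j: "(i, ?j) \<in> r" "syzygy_map (Suc n) (D ?j) (t i ?j) x \<in> ideal_times A (?s (Suc n) (D ?j))" and ju: "(?j, u) \<in> r"
      using j1[OF xE] u(2) xE by blast+
    have "syzygy_map (Suc n) (D u) (t ?j u) (syzygy_map (Suc n) (D ?j) (t i ?j) x) \<in> ideal_times A (?s (Suc n) (D u))"
      by (rule ideal_times_image[OF small_module_left[OF colim_small[OF S' mem(2)[OF j(1)]]]
            small_module_left[OF colim_small[OF S' u(1)]] A_sub colim_trans_map[OF S' ju] j(2)])
    then show "syzygy_map (Suc n) (D u) (t i u) x \<in> ideal_times A (?s (Suc n) (D u))"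
      unfolding colim_comp[OF S' j(1) ju subsetD[OF E_sub xE]] .
  qed
  then show ?thesis using iu by blast
qed

definition submodules :: "('r, 'u) module \<Rightarrow> 'u set set" where
  "submodules M = {S. S \<subseteq> carrier M \<and> \<zero>\<^bsub>M\<^esub> \<in> S \<and> (\<forall>x\<in>S. \<forall>y\<in>S. x \<oplus>\<^bsub>M\<^esub> y \<in> S) \<and>
     (\<forall>a\<in>carrier R. \<forall>x\<in>S. a \<odot>\<^bsub>M\<^esub> x \<in> S)}"

lemma submodule_small:
  assumes M: "small_module U R M" and S: "S \<in> submodules M"
  shows "small_module U R (M\<lparr>carrier := S\<rparr>)"
proof -
  have sub: "S \<subseteq> carrier M" using S unfolding submodules_def by blast
  have "left_module R (M\<lparr>carrier := S\<rparr>)"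
    by (rule left_module_sub[OF small_module_left[OF M]]) (use S in \<open>auto simp: submodules_def\<close>)
  then show ?thesis
    using small_module_carrier[OF M] small_subset[OF _ sub] sub unfolding small_module_def by auto
qed

lemma submodule_inclusion:
  "S \<in> submodules M \<Longrightarrow> S \<subseteq> T \<Longrightarrow> linear_map R (M\<lparr>carrier := S\<rparr>) (M\<lparr>carrier := T\<rparr>) (\<lambda>x. x)"
  unfolding linear_map_def by auto

lemma submodule_generated:
  assumes M: "small_module U R M" and X: "X \<subseteq> carrier M" "|X| \<le>o |\<Lambda>|"
  shows "\<exists>S\<in>submodules M. X \<subseteq> S \<and> |S| \<le>o |\<Lambda>|"
proof -
  note lM = small_module_left[OF M]
  have XU: "X \<subseteq> U" using X(1) small_module_carrier(1)[OF M] by blast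
  have h: "(\<lambda>x. x) \<in> X \<rightarrow> carrier M" using X(1) by blast
  let ?F = "free_module X" and ?f = "free_lift M (\<lambda>x. x)"
  interpret F: left_module R ?F by (rule left_module_free[OF XU])
  have f: "linear_map R ?F M ?f" by (rule free_lift_linear[OF XU lM h])
  have "?f ` carrier ?F \<in> submodules M"
    unfolding submodules_def
  proof (intro CollectI conjI ballI)
    show "?f ` carrier ?F \<subseteq> carrier M" using linear_map_closed[OF f] by blast
    show "\<zero>\<^bsub>M\<^esub> \<in> ?f ` carrier ?F"
      using linear_map_zero[OF F.left_module_axioms lM f] F.M.zero_closed by (metis imageI)
    show "x \<oplus>\<^bsub>M\<^esub> y \<in> ?f ` carrier ?F" if xy: "x \<in> ?f ` carrier ?F" "y \<in> ?f ` carrier ?F" for x y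
    proof -
      obtain u v where "u \<in> carrier ?F" "x = ?f u" "v \<in> carrier ?F" "y = ?f v" using xy by blast
      then show ?thesis using linear_map_add[OF f] F.M.a_closed by (metis imageI)
    qed
    show "a \<odot>\<^bsub>M\<^esub> x \<in> ?f ` carrier ?F" if a: "a \<in> carrier R" and x: "x \<in> ?f ` carrier ?F" for a x
    proof -
      obtain u where "u \<in> carrier ?F" "x = ?f u" using x by blast
      then show ?thesis using linear_map_smult[OF f a] F.smult_closed[OF a] by (metis imageI)
    qed
  qed
  moreover have "X \<subseteq> ?f ` carrier ?F"
  proof
    fix x assume x: "x \<in> X"
    then show "x \<in> ?f ` carrier ?F"
      using free_lift_basis[OF XU lM h x] basis_closed[OF x] by (metis imageI)
  qed
  moreover have "|?f ` carrier ?F| \<le>o |\<Lambda>|" by (rule le_\<Lambda>_image[OF le_\<Lambda>_free[OF X(2)]])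
  ultimately show ?thesis by blast
qed

lemma colim_submodules:
  assumes M: "small_module U R M" and r: "preorder_on I r" "I \<noteq> {}"
    and dir: "\<And>i j. i \<in> I \<Longrightarrow> j \<in> I \<Longrightarrow> \<exists>k. (i, k) \<in> r \<and> (j, k) \<in> r"
    and S: "\<And>i. i \<in> I \<Longrightarrow> S i \<in> submodules M" and mono: "\<And>i j. (i, j) \<in> r \<Longrightarrow> S i \<subseteq> S j"
  shows "(\<Union>i\<in>I. S i) \<in> submodules M"
    and "directed_colimit I r (\<lambda>i. M\<lparr>carrier := S i\<rparr>) (\<lambda>_ _ x. x) (M\<lparr>carrier := \<Union>i\<in>I. S i\<rparr>) (\<lambda>_ x. x)"
proof -
  let ?T = "\<Union>i\<in>I. S i"
  have rI: "i \<in> I" "j \<in> I" if "(i, j) \<in> r" for i j using r(1) that unfolding preorder_on_def by blast+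
  have refl: "(i, i) \<in> r" if "i \<in> I" for i using r(1) that unfolding preorder_on_def refl_on_def by blast
  have s: "S i \<subseteq> carrier M" "\<zero>\<^bsub>M\<^esub> \<in> S i" "\<And>x y. x \<in> S i \<Longrightarrow> y \<in> S i \<Longrightarrow> x \<oplus>\<^bsub>M\<^esub> y \<in> S i"
    "\<And>a x. a \<in> carrier R \<Longrightarrow> x \<in> S i \<Longrightarrow> a \<odot>\<^bsub>M\<^esub> x \<in> S i" if "i \<in> I" for i
    using S[OF that] unfolding submodules_def by blast+
  show T: "?T \<in> submodules M"
    unfolding submodules_def
  proof (intro CollectI conjI ballI)
    show "?T \<subseteq> carrier M" using s(1) by blast
    show "\<zero>\<^bsub>M\<^esub> \<in> ?T" using s(2) r(2) by blast
    show "x \<oplus>\<^bsub>M\<^esub> y \<in> ?T" if xy: "x \<in> ?T" "y \<in> ?T" for x y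
    proof -
      obtain i j where ij: "i \<in> I" "x \<in> S i" "j \<in> I" "y \<in> S j" using xy by blast
      obtain k where k: "(i, k) \<in> r" "(j, k) \<in> r" using dir[OF ij(1,3)] by blast
      have "x \<oplus>\<^bsub>M\<^esub> y \<in> S k" by (rule s(3)[OF rI(2)[OF k(1)]]) (use mono[OF k(1)] mono[OF k(2)] ij in blast)+
      then show ?thesis using rI(2)[OF k(1)] by blast
    qed
    show "a \<odot>\<^bsub>M\<^esub> x \<in> ?T" if "a \<in> carrier R" "x \<in> ?T" for a x using that s(4) by blast
  qed
  show "directed_colimit I r (\<lambda>i. M\<lparr>carrier := S i\<rparr>) (\<lambda>_ _ x. x) (M\<lparr>carrier := ?T\<rparr>) (\<lambda>_ x. x)"
    unfolding directed_colimit_def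
  proof (intro conjI allI impI ballI)
    show "preorder_on I r" "I \<noteq> {}" by (rule r)+
    show "\<exists>k. (i, k) \<in> r \<and> (j, k) \<in> r" if "i \<in> I" "j \<in> I" for i j by (rule dir[OF that])
    show "small_module U R (M\<lparr>carrier := S i\<rparr>)" if "i \<in> I" for i by (rule submodule_small[OF M S[OF that]])
    show "small_module U R (M\<lparr>carrier := ?T\<rparr>)" by (rule submodule_small[OF M T])
    show "linear_map R (M\<lparr>carrier := S i\<rparr>) (M\<lparr>carrier := S j\<rparr>) (\<lambda>x. x)" if "(i, j) \<in> r" for i j
      by (rule submodule_inclusion[OF S[OF rI(1)[OF that]] mono[OF that]])
    show "linear_map R (M\<lparr>carrier := S i\<rparr>) (M\<lparr>carrier := ?T\<rparr>) (\<lambda>x. x)" if "i \<in> I" for i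
      by (rule submodule_inclusion[OF S[OF that]]) (use that in blast)
    show "\<exists>i\<in>I. \<exists>x\<in>carrier (M\<lparr>carrier := S i\<rparr>). x = y" if "y \<in> carrier (M\<lparr>carrier := ?T\<rparr>)" for y
      using that by simp
    show "\<exists>j. (i, j) \<in> r \<and> x = \<zero>\<^bsub>M\<lparr>carrier := S j\<rparr>\<^esub>"
      if "i \<in> I" "x = \<zero>\<^bsub>M\<lparr>carrier := ?T\<rparr>\<^esub>" for i x
      using that refl by auto
  qed simp_all
qed

lemma light_h_exact_submodule:
  assumes M: "small_module U R M" and h: "h_exact M" and X: "X \<subseteq> carrier M" "|X| \<le>o |\<Lambda>|"
  shows "\<exists>S\<in>submodules M. X \<subseteq> S \<and> |S| \<le>o |\<Lambda>| \<and> h_exact (M\<lparr>carrier := S\<rparr>)"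
proof -
  define J where "J = {S \<in> submodules M. |S| \<le>o |\<Lambda>|}"
  define q where "q = {(S, T). S \<in> J \<and> T \<in> J \<and> S \<subseteq> T}"
  have J: "S \<in> submodules M" "|S| \<le>o |\<Lambda>|" "S \<subseteq> carrier M" if "S \<in> J" for S
    using that unfolding J_def submodules_def by blast+
  have gen: "\<exists>S\<in>J. Y \<subseteq> S" if "Y \<subseteq> carrier M" "|Y| \<le>o |\<Lambda>|" for Y
    using submodule_generated[OF M that] unfolding J_def by blast
  have bound: "\<exists>T\<in>J. \<forall>S\<in>\<S>. (S, T) \<in> q" if "\<S> \<subseteq> J" "|\<S>| \<le>o |\<Lambda>|" for \<S>
  proof -
    have "|\<Union>S\<in>\<S>. S| \<le>o |\<Lambda>|" by (rule le_\<Lambda>_UNION[OF that(2)]) (use J(2) that(1) in blast)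
    moreover have "(\<Union>S\<in>\<S>. S) \<subseteq> carrier M" using J(3) that(1) by blast
    ultimately obtain T where "T \<in> J" "(\<Union>S\<in>\<S>. S) \<subseteq> T" using gen[of "\<Union>S\<in>\<S>. S"] by blast
    then show ?thesis unfolding q_def using that(1) by blast
  qed
  have dir: "\<exists>V. (S, V) \<in> q \<and> (T, V) \<in> q" if "S \<in> J" "T \<in> J" for S T
    using bound[of "{S, T}"] that le_\<Lambda>_finite[of "{S, T}"] by blast
  obtain S0 where S0: "S0 \<in> J" "X \<subseteq> S0" using gen[OF X] by blast
  have pre: "preorder_on J q"
    unfolding preorder_on_def refl_on_def trans_def q_def by auto
  have un: "(\<Union>S\<in>J. S) = carrier M"
  proof
    show "(\<Union>S\<in>J. S) \<subseteq> carrier M" using J(3) by blast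
    show "carrier M \<subseteq> (\<Union>S\<in>J. S)"
    proof
      fix x assume "x \<in> carrier M"
      then obtain S where "S \<in> J" "{x} \<subseteq> S" using gen[of "{x}"] le_\<Lambda>_finite[of "{x}"] by auto
      then show "x \<in> (\<Union>S\<in>J. S)" by blast
    qed
  qed
  have eqM: "M\<lparr>carrier := carrier M\<rparr> = M" by simp
  have C: "directed_colimit J q (\<lambda>S. M\<lparr>carrier := S\<rparr>) (\<lambda>_ _ x. x) M (\<lambda>_ x. x)"
    using colim_submodules(2)[OF M pre _ dir J(1), of "\<lambda>S. S"] S0(1) unfolding un eqM q_def by blast
  have step: "\<exists>T. (S, T) \<in> q \<and> solves (M\<lparr>carrier := S\<rparr>) (M\<lparr>carrier := T\<rparr>) (\<lambda>x. x)" if "S \<in> J" for S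
    by (rule colim_solves[OF C h that _ bound]) (use J(2)[OF that] in simp_all)
  have "\<exists>S. \<forall>n. (S n \<in> J \<and> (n = 0 \<longrightarrow> S n = S0)) \<and>
      ((S n, S (Suc n)) \<in> q \<and> solves (M\<lparr>carrier := S n\<rparr>) (M\<lparr>carrier := S (Suc n)\<rparr>) (\<lambda>x. x))"
    by (rule dependent_nat_choice[where P = "\<lambda>n S. S \<in> J \<and> (n = 0 \<longrightarrow> S = S0)" and
            Q = "\<lambda>n S T. (S, T) \<in> q \<and> solves (M\<lparr>carrier := S\<rparr>) (M\<lparr>carrier := T\<rparr>) (\<lambda>x. x)"])
        (use S0(1) step in \<open>auto simp: q_def\<close>)
  then obtain S where S: "\<And>n. S n \<in> J" "\<And>n. (S n, S (Suc n)) \<in> q"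
     "\<And>n. solves (M\<lparr>carrier := S n\<rparr>) (M\<lparr>carrier := S (Suc n)\<rparr>) (\<lambda>x. x)" "S 0 = S0"
    by metis
  let ?r = "{(m, n :: nat). m \<le> n}"
  have inc: "S m \<subseteq> S n" if "m \<le> n" for m n
    using that by (rule lift_Suc_mono_le[rotated]) (use S(2) q_def in blast)
  have pre': "preorder_on UNIV ?r" unfolding preorder_on_def refl_on_def trans_def by auto
  have dir': "\<exists>k. (i, k) \<in> ?r \<and> (j, k) \<in> ?r" for i j :: nat
    by (rule exI[of _ "max i j"]) simp
  note W = colim_submodules[OF M pre' _ dir' J(1)[OF S(1)], simplified, OF inc]
  have "h_exact (M\<lparr>carrier := \<Union>n. S n\<rparr>)"
    by (rule colim_h_exact[OF W(2)]) (use S(3) in \<open>auto intro!: exI[of _ "Suc _"]\<close>)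
  moreover have "|\<Union>n\<in>UNIV. S n| \<le>o |\<Lambda>|"
    by (rule le_\<Lambda>_UNION[OF le_\<Lambda>_countable]) (use J(2)[OF S(1)] in blast)
  moreover have "X \<subseteq> (\<Union>n. S n)" using S0(2) S(4) by blast
  ultimately show ?thesis using bexI[OF _ W(1)] by simp
qed

end


section \<open>Direct limits of modules\<close>

lemma set_direct_limit_equiv:
  assumes r: "preorder_on I r" and dir: "\<And>i j. i \<in> I \<Longrightarrow> j \<in> I \<Longrightarrow> \<exists>k. (i, k) \<in> r \<and> (j, k) \<in> r"
    and cl: "\<And>i j x. (i, j) \<in> r \<Longrightarrow> x \<in> S i \<Longrightarrow> t i j x \<in> S j"
    and comp: "\<And>i j k x. (i, j) \<in> r \<Longrightarrow> (j, k) \<in> r \<Longrightarrow> x \<in> S i \<Longrightarrow> t j k (t i j x) = t i k x"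
  shows "equiv (Sigma I S) {((i, x), (j, y)). (i, x) \<in> Sigma I S \<and> (j, y) \<in> Sigma I S \<and>
                     (\<exists>k\<in>I. (i, k) \<in> r \<and> (j, k) \<in> r \<and> t i k x = t j k y)}" (is "equiv _ ?E")
proof (rule equivI)
  have tr: "(i, k) \<in> r" if "(i, j) \<in> r" "(j, k) \<in> r" for i j k
    using r that unfolding preorder_on_def by (blast dest: transD)
  show "?E \<subseteq> Sigma I S \<times> Sigma I S" by auto
  show "refl_on (Sigma I S) ?E"
    using r unfolding refl_on_def preorder_on_def by auto
  show "sym ?E" unfolding sym_def by auto
  show "trans ?E"
  proof (rule transI)
    fix p q s assume pq: "(p, q) \<in> ?E" and qs: "(q, s) \<in> ?E"
    obtain i x j y l z where e: "p = (i, x)" "q = (j, y)" "s = (l, z)" by (cases p, cases q, cases s)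
    obtain k where k: "k \<in> I" "(i, k) \<in> r" "(j, k) \<in> r" "t i k x = t j k y" using pq e by auto
    obtain m where m: "m \<in> I" "(j, m) \<in> r" "(l, m) \<in> r" "t j m y = t l m z" using qs e by auto
    have mem: "i \<in> I" "x \<in> S i" "j \<in> I" "y \<in> S j" "l \<in> I" "z \<in> S l" using pq qs e by auto
    obtain n where n: "(k, n) \<in> r" "(m, n) \<in> r" using dir[OF k(1) m(1)] by blast
    have "n \<in> I" using n(1) r unfolding preorder_on_def by blast
    moreover have "t i n x = t l n z"
      using comp[OF k(2) n(1) mem(2)] comp[OF k(3) n(1) mem(4)] comp[OF m(2) n(2) mem(4)] comp[OF m(3) n(2) mem(6)] k(4) m(4)
      by simp
    ultimately show "(p, s) \<in> ?E" using e mem tr[OF k(2) n(1)] tr[OF m(3) n(2)] by auto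
  qed
qed

context ideal_in_universe
begin

definition module_system ::
    "'i set \<Rightarrow> 'i rel \<Rightarrow> ('i \<Rightarrow> ('r, 'u) module) \<Rightarrow> ('i \<Rightarrow> 'i \<Rightarrow> 'u \<Rightarrow> 'u) \<Rightarrow> bool" where
  "module_system I r D t \<longleftrightarrow>
     preorder_on I r \<and> I \<noteq> {} \<and> (\<forall>i\<in>I. \<forall>j\<in>I. \<exists>k. (i, k) \<in> r \<and> (j, k) \<in> r) \<and>
     (\<forall>i\<in>I. small_module U R (D i)) \<and>
     (\<forall>i j. (i, j) \<in> r \<longrightarrow> linear_map R (D i) (D j) (t i j)) \<and>
     (\<forall>i j k. (i, j) \<in> r \<longrightarrow> (j, k) \<in> r \<longrightarrow> (\<forall>x\<in>carrier (D i). t j k (t i j x) = t i k x))"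

lemma stable_U: "stable |U|"
  by (rule regularCard_stable[OF card_of_Card_order _ regular_U]) (use infinite_U in \<open>simp add: Field_card_of\<close>)

lemma small_Sigma:
  fixes I :: "'i set" and X :: "'i \<Rightarrow> 'a set"
  assumes "small U I" "\<And>i. i \<in> I \<Longrightarrow> small U (X i)"
  shows "small U (Sigma I X)"
  using stable_elim[OF stable_U] assms unfolding small_def by blast

lemma directed_colimit_exists:
  assumes S: "module_system I r D t" and I: "small U I"
  shows "\<exists>L c. directed_colimit I r D t L c"
proof -
  have r: "preorder_on I r" and ne: "I \<noteq> {}" and dir: "\<And>i j. i \<in> I \<Longrightarrow> j \<in> I \<Longrightarrow> \<exists>k. (i, k) \<in> r \<and> (j, k) \<in> r"
    and sm: "\<And>i. i \<in> I \<Longrightarrow> small_module U R (D i)"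
    and t: "\<And>i j. (i, j) \<in> r \<Longrightarrow> linear_map R (D i) (D j) (t i j)"
    and comp: "\<And>i j k x. (i, j) \<in> r \<Longrightarrow> (j, k) \<in> r \<Longrightarrow> x \<in> carrier (D i) \<Longrightarrow> t j k (t i j x) = t i k x"
    using S unfolding module_system_def by simp_all
  have mem: "(i, j) \<in> r \<Longrightarrow> i \<in> I" "(i, j) \<in> r \<Longrightarrow> j \<in> I" for i j
    using r unfolding preorder_on_def by auto
  have refl: "(i, i) \<in> r" if "i \<in> I" for i using r that unfolding preorder_on_def refl_on_def by blast
  have tr: "(i, k) \<in> r" if "(i, j) \<in> r" "(j, k) \<in> r" for i j k
    using r that unfolding preorder_on_def by (blast dest: transD)
  note lm = small_module_left[OF sm]
  note tc = linear_map_closed[OF t]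
  let ?S = "Sigma I (\<lambda>i. carrier (D i))"
  let ?E = "{((i, x), (j, y)). (i, x) \<in> ?S \<and> (j, y) \<in> ?S \<and> (\<exists>k\<in>I. (i, k) \<in> r \<and> (j, k) \<in> r \<and> t i k x = t j k y)}"
  have eqv: "equiv ?S ?E" by (rule set_direct_limit_equiv[OF r dir tc comp])
  have sS: "small U ?S" by (rule small_Sigma[OF I]) (rule small_module_carrier(2)[OF sm])
  have qe: "?S // ?E = (\<lambda>p. ?E `` {p}) ` ?S" unfolding quotient_def by blast
  have sQ: "small U (?S // ?E)" unfolding qe by (rule small_le[OF card_of_image sS])
  then have "|?S // ?E| \<le>o |U|" unfolding small_def by (rule ordLess_imp_ordLeq)
  then obtain \<phi> where \<phi>: "inj_on \<phi> (?S // ?E)" "\<phi> ` (?S // ?E) \<subseteq> U"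
    unfolding card_of_ordLeq[symmetric] by blast
  define c where "c = (\<lambda>i x. \<phi> (?E `` {(i, x)}))"
  have c_eq: "c i x = c j y \<longleftrightarrow> (\<exists>k. (i, k) \<in> r \<and> (j, k) \<in> r \<and> t i k x = t j k y)"
    if "i \<in> I" "x \<in> carrier (D i)" "j \<in> I" "y \<in> carrier (D j)" for i x j y
  proof -
    have q: "?E `` {(i, x)} \<in> ?S // ?E" "?E `` {(j, y)} \<in> ?S // ?E"
      by (rule quotientI, use that in simp)+
    have "c i x = c j y \<longleftrightarrow> ?E `` {(i, x)} = ?E `` {(j, y)}"
      unfolding c_def using inj_on_eq_iff[OF \<phi>(1) q] .
    also have "\<dots> \<longleftrightarrow> ((i, x), (j, y)) \<in> ?E"
      by (rule eq_equiv_class_iff[OF eqv]) (use that in auto)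
    also have "\<dots> \<longleftrightarrow> (\<exists>k. (i, k) \<in> r \<and> (j, k) \<in> r \<and> t i k x = t j k y)" using that mem(2) by auto
    finally show ?thesis .
  qed
  have c_t: "c k (t i k x) = c i x" if ik: "(i, k) \<in> r" and x: "x \<in> carrier (D i)" for i k x
    using c_eq[OF mem(2)[OF ik] tc[OF ik x] mem(1)[OF ik] x] refl[OF mem(2)[OF ik]] ik comp[OF ik refl[OF mem(2)[OF ik]] x]
    by blast
  define K where "K = (\<Union>i\<in>I. c i ` carrier (D i))"
  have cK: "c i x \<in> K" if "i \<in> I" "x \<in> carrier (D i)" for i x unfolding K_def using that by blast
  have KQ: "K \<subseteq> \<phi> ` (?S // ?E)"
  proof
    fix y assume "y \<in> K"
    then obtain i x where i: "(i, x) \<in> ?S" "y = c i x" unfolding K_def by blast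
    show "y \<in> \<phi> ` (?S // ?E)" unfolding i(2) c_def by (rule imageI[OF quotientI[OF i(1)]])
  qed
  have common: "\<exists>k\<in>I. \<exists>a\<in>carrier (D k). \<exists>b\<in>carrier (D k). u = c k a \<and> v = c k b" if "u \<in> K" "v \<in> K" for u v
  proof -
    obtain i x j y where e: "i \<in> I" "x \<in> carrier (D i)" "u = c i x" "j \<in> I" "y \<in> carrier (D j)" "v = c j y"
      using \<open>u \<in> K\<close> \<open>v \<in> K\<close> unfolding K_def by blast
    obtain k where k: "(i, k) \<in> r" "(j, k) \<in> r" using dir[OF e(1,4)] by blast
    show ?thesis
      using mem(2)[OF k(1)] tc[OF k(1) e(2)] tc[OF k(2) e(5)] c_t[OF k(1) e(2)] c_t[OF k(2) e(5)] e(3,6) by metis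
  qed
  have common3: "\<exists>k\<in>I. \<exists>a\<in>carrier (D k). \<exists>b\<in>carrier (D k). \<exists>d\<in>carrier (D k). u = c k a \<and> v = c k b \<and> w = c k d"
    if uvw: "u \<in> K" "v \<in> K" "w \<in> K" for u v w
  proof -
    obtain i x x' where e: "i \<in> I" "x \<in> carrier (D i)" "x' \<in> carrier (D i)" "u = c i x" "v = c i x'"
      using common[OF uvw(1,2)] by blast
    obtain j y where f: "j \<in> I" "y \<in> carrier (D j)" "w = c j y" using uvw(3) unfolding K_def by blast
    obtain k where k: "(i, k) \<in> r" "(j, k) \<in> r" using dir[OF e(1) f(1)] by blast
    show ?thesis
      using mem(2)[OF k(1)] tc[OF k(1) e(2)] tc[OF k(1) e(3)] tc[OF k(2) f(2)]
        c_t[OF k(1) e(2)] c_t[OF k(1) e(3)] c_t[OF k(2) f(2)] e(4,5) f(3) by metis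
  qed
  define ad where "ad = (\<lambda>u v. SOME w. \<exists>k a b. k \<in> I \<and> a \<in> carrier (D k) \<and> b \<in> carrier (D k) \<and>
     u = c k a \<and> v = c k b \<and> w = c k (a \<oplus>\<^bsub>D k\<^esub> b))"
  define sc where "sc = (\<lambda>s u. SOME w. \<exists>k a. k \<in> I \<and> a \<in> carrier (D k) \<and> u = c k a \<and> w = c k (s \<odot>\<^bsub>D k\<^esub> a))"
  obtain i0 where i0: "i0 \<in> I" using ne by blast
  define L :: "('r, 'u) module" where
    "L = \<lparr>carrier = K, mult = undefined, one = undefined, zero = c i0 \<zero>\<^bsub>D i0\<^esub>, add = ad, smult = sc\<rparr>"
  have L_add: "c k a \<oplus>\<^bsub>L\<^esub> c k b = c k (a \<oplus>\<^bsub>D k\<^esub> b)" if kab: "k \<in> I" "a \<in> carrier (D k)" "b \<in> carrier (D k)" for k a b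
  proof -
    have "\<exists>l x y. l \<in> I \<and> x \<in> carrier (D l) \<and> y \<in> carrier (D l) \<and>
        c k a = c l x \<and> c k b = c l y \<and> ad (c k a) (c k b) = c l (x \<oplus>\<^bsub>D l\<^esub> y)"
      unfolding ad_def by (rule someI[of _ "c k (a \<oplus>\<^bsub>D k\<^esub> b)"]) (use kab in blast)
    then obtain l x y where l: "l \<in> I" "x \<in> carrier (D l)" "y \<in> carrier (D l)" "c k a = c l x" "c k b = c l y"
      and w: "ad (c k a) (c k b) = c l (x \<oplus>\<^bsub>D l\<^esub> y)" by blast
    interpret Dk: left_module R "D k" by (rule lm[OF kab(1)])
    interpret Dl: left_module R "D l" by (rule lm[OF l(1)])
    obtain m where m: "(k, m) \<in> r" "(l, m) \<in> r" "t k m a = t l m x" using l(4) c_eq[OF kab(1,2) l(1,2)] by blast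
    obtain n where n: "(k, n) \<in> r" "(l, n) \<in> r" "t k n b = t l n y" using l(5) c_eq[OF kab(1,3) l(1,3)] by blast
    obtain q where q: "(m, q) \<in> r" "(n, q) \<in> r" using dir[OF mem(2)[OF m(1)] mem(2)[OF n(1)]] by blast
    have kq: "(k, q) \<in> r" and lq: "(l, q) \<in> r" using tr m q by blast+
    have "t k q a = t l q x" using m(3) comp[OF m(1) q(1) kab(2)] comp[OF m(2) q(1) l(2)] by simp
    moreover have "t k q b = t l q y" using n(3) comp[OF n(1) q(2) kab(3)] comp[OF n(2) q(2) l(3)] by simp
    ultimately have "t k q (a \<oplus>\<^bsub>D k\<^esub> b) = t l q (x \<oplus>\<^bsub>D l\<^esub> y)"
      using linear_map_add[OF t[OF kq] kab(2,3)] linear_map_add[OF t[OF lq] l(2,3)] by simp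
    then have "c k (a \<oplus>\<^bsub>D k\<^esub> b) = c l (x \<oplus>\<^bsub>D l\<^esub> y)"
      using c_eq[OF kab(1) Dk.M.a_closed[OF kab(2,3)] l(1) Dl.M.a_closed[OF l(2,3)]] kq lq by blast
    then show ?thesis unfolding L_def by (simp add: w)
  qed
  have L_smult: "s \<odot>\<^bsub>L\<^esub> c k a = c k (s \<odot>\<^bsub>D k\<^esub> a)" if ka: "k \<in> I" "a \<in> carrier (D k)" and s: "s \<in> carrier R" for s k a
  proof -
    have "\<exists>l x. l \<in> I \<and> x \<in> carrier (D l) \<and> c k a = c l x \<and> sc s (c k a) = c l (s \<odot>\<^bsub>D l\<^esub> x)"
      unfolding sc_def by (rule someI[of _ "c k (s \<odot>\<^bsub>D k\<^esub> a)"]) (use ka in blast)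
    then obtain l x where l: "l \<in> I" "x \<in> carrier (D l)" "c k a = c l x"
      and w: "sc s (c k a) = c l (s \<odot>\<^bsub>D l\<^esub> x)" by blast
    interpret Dk: left_module R "D k" by (rule lm[OF ka(1)])
    interpret Dl: left_module R "D l" by (rule lm[OF l(1)])
    obtain m where m: "(k, m) \<in> r" "(l, m) \<in> r" "t k m a = t l m x" using l(3) c_eq[OF ka l(1,2)] by blast
    have "t k m (s \<odot>\<^bsub>D k\<^esub> a) = t l m (s \<odot>\<^bsub>D l\<^esub> x)"
      using linear_map_smult[OF t[OF m(1)] s ka(2)] linear_map_smult[OF t[OF m(2)] s l(2)] m(3) by simp
    then have "c k (s \<odot>\<^bsub>D k\<^esub> a) = c l (s \<odot>\<^bsub>D l\<^esub> x)"
      using c_eq[OF ka(1) Dk.smult_closed[OF s ka(2)] l(1) Dl.smult_closed[OF s l(2)]] m by blast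
    then show ?thesis unfolding L_def by (simp add: w)
  qed
  have L_zero: "c k \<zero>\<^bsub>D k\<^esub> = \<zero>\<^bsub>L\<^esub>" if k: "k \<in> I" for k
  proof -
    interpret Dk: left_module R "D k" by (rule lm[OF k])
    interpret D0: left_module R "D i0" by (rule lm[OF i0])
    obtain m where m: "(k, m) \<in> r" "(i0, m) \<in> r" using dir[OF k i0] by blast
    have "t k m \<zero>\<^bsub>D k\<^esub> = t i0 m \<zero>\<^bsub>D i0\<^esub>"
      using linear_map_zero[OF lm[OF k] lm[OF mem(2)[OF m(1)]] t[OF m(1)]]
        linear_map_zero[OF lm[OF i0] lm[OF mem(2)[OF m(1)]] t[OF m(2)]] by simp
    then have "c k \<zero>\<^bsub>D k\<^esub> = c i0 \<zero>\<^bsub>D i0\<^esub>"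
      using c_eq[OF k Dk.M.zero_closed i0 D0.M.zero_closed] m by blast
    then show ?thesis unfolding L_def by simp
  qed
  have L_car: "carrier L = K" unfolding L_def by simp
  have "abelian_group L"
  proof (rule abelian_groupI)
    fix u v assume uv: "u \<in> carrier L" "v \<in> carrier L"
    obtain k a b where k: "k \<in> I" "a \<in> carrier (D k)" "b \<in> carrier (D k)" "u = c k a" "v = c k b"
      using common[of u v] uv unfolding L_car by blast
    interpret Dk: left_module R "D k" by (rule lm[OF k(1)])
    show "u \<oplus>\<^bsub>L\<^esub> v \<in> carrier L"
      unfolding k(4,5) L_add[OF k(1-3)] L_car by (rule cK[OF k(1) Dk.M.a_closed[OF k(2,3)]])
    show "u \<oplus>\<^bsub>L\<^esub> v = v \<oplus>\<^bsub>L\<^esub> u"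
      unfolding k(4,5) L_add[OF k(1-3)] L_add[OF k(1,3,2)] using Dk.M.a_comm k(2,3) by simp
  next
    interpret D0: left_module R "D i0" by (rule lm[OF i0])
    show "\<zero>\<^bsub>L\<^esub> \<in> carrier L" unfolding L_car L_zero[OF i0, symmetric] by (rule cK[OF i0]) simp
  next
    fix u v w assume "u \<in> carrier L" "v \<in> carrier L" "w \<in> carrier L"
    then obtain k a b d where k: "k \<in> I" "a \<in> carrier (D k)" "b \<in> carrier (D k)" "d \<in> carrier (D k)"
        "u = c k a" "v = c k b" "w = c k d"
      using common3[of u v w] unfolding L_car by blast
    interpret Dk: left_module R "D k" by (rule lm[OF k(1)])
    show "(u \<oplus>\<^bsub>L\<^esub> v) \<oplus>\<^bsub>L\<^esub> w = u \<oplus>\<^bsub>L\<^esub> (v \<oplus>\<^bsub>L\<^esub> w)"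
      unfolding k(5-7) using k(1-4) by (simp add: L_add Dk.M.a_assoc)
  next
    fix u assume "u \<in> carrier L"
    then obtain k a where k: "k \<in> I" "a \<in> carrier (D k)" "u = c k a" unfolding L_car K_def by blast
    interpret Dk: left_module R "D k" by (rule lm[OF k(1)])
    show "\<zero>\<^bsub>L\<^esub> \<oplus>\<^bsub>L\<^esub> u = u"
      unfolding k(3) L_zero[OF k(1), symmetric] using k by (simp add: L_add)
    show "\<exists>v\<in>carrier L. v \<oplus>\<^bsub>L\<^esub> u = \<zero>\<^bsub>L\<^esub>"
    proof (rule bexI)
      show "c k (\<ominus>\<^bsub>D k\<^esub> a) \<oplus>\<^bsub>L\<^esub> u = \<zero>\<^bsub>L\<^esub>"
        unfolding k(3) using k by (simp add: L_add L_zero Dk.M.l_neg)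
      show "c k (\<ominus>\<^bsub>D k\<^esub> a) \<in> carrier L" unfolding L_car by (rule cK[OF k(1)]) (use k in simp)
    qed
  qed
  moreover have "left_module_axioms R L"
  proof
    fix a b u assume ab: "a \<in> carrier R" "b \<in> carrier R" and u: "u \<in> carrier L"
    obtain k x where k: "k \<in> I" "x \<in> carrier (D k)" "u = c k x" using u unfolding L_car K_def by blast
    interpret Dk: left_module R "D k" by (rule lm[OF k(1)])
    note sc = Dk.smult_closed[OF ab(1) k(2)] Dk.smult_closed[OF ab(2) k(2)]
    show "(a \<oplus>\<^bsub>R\<^esub> b) \<odot>\<^bsub>L\<^esub> u = a \<odot>\<^bsub>L\<^esub> u \<oplus>\<^bsub>L\<^esub> b \<odot>\<^bsub>L\<^esub> u"
      unfolding k(3) using k ab sc by (simp add: L_add L_smult Dk.smult_l_distr)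
    show "(a \<otimes> b) \<odot>\<^bsub>L\<^esub> u = a \<odot>\<^bsub>L\<^esub> (b \<odot>\<^bsub>L\<^esub> u)"
      unfolding k(3) using k ab sc by (simp add: L_smult Dk.smult_assoc)
  next
    fix a u assume a: "a \<in> carrier R" and u: "u \<in> carrier L"
    obtain k x where k: "k \<in> I" "x \<in> carrier (D k)" "u = c k x" using u unfolding L_car K_def by blast
    interpret Dk: left_module R "D k" by (rule lm[OF k(1)])
    show "a \<odot>\<^bsub>L\<^esub> u \<in> carrier L"
      unfolding k(3) L_smult[OF k(1,2) a] L_car by (rule cK[OF k(1) Dk.smult_closed[OF a k(2)]])
  next
    fix a u v assume a: "a \<in> carrier R" and uv: "u \<in> carrier L" "v \<in> carrier L"
    obtain k x y where k: "k \<in> I" "x \<in> carrier (D k)" "y \<in> carrier (D k)" "u = c k x" "v = c k y"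
      using common[of u v] uv unfolding L_car by blast
    interpret Dk: left_module R "D k" by (rule lm[OF k(1)])
    note sc = Dk.smult_closed[OF a k(2)] Dk.smult_closed[OF a k(3)]
    show "a \<odot>\<^bsub>L\<^esub> (u \<oplus>\<^bsub>L\<^esub> v) = a \<odot>\<^bsub>L\<^esub> u \<oplus>\<^bsub>L\<^esub> a \<odot>\<^bsub>L\<^esub> v"
      unfolding k(4,5) using k a sc by (simp add: L_add L_smult Dk.smult_r_distr)
  next
    fix u assume u: "u \<in> carrier L"
    obtain k x where k: "k \<in> I" "x \<in> carrier (D k)" "u = c k x" using u unfolding L_car K_def by blast
    interpret Dk: left_module R "D k" by (rule lm[OF k(1)])
    show "\<one> \<odot>\<^bsub>L\<^esub> u = u" unfolding k(3) using k by (simp add: L_smult Dk.smult_one)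
  qed
  ultimately have lL: "left_module R L" unfolding left_module_def using R_ring by blast
  have "small U K" by (rule small_subset[OF _ KQ]) (rule small_le[OF card_of_image sQ])
  moreover have "K \<subseteq> U" using KQ \<phi>(2) by simp
  ultimately have sL: "small_module U R L" unfolding small_module_def L_car using lL by simp
  have "directed_colimit I r D t L c"
    unfolding directed_colimit_def
  proof (intro conjI allI impI ballI)
    show "preorder_on I r" "I \<noteq> {}" by (rule r ne)+
    show "\<exists>k. (i, k) \<in> r \<and> (j, k) \<in> r" if "i \<in> I" "j \<in> I" for i j by (rule dir[OF that])
    show "small_module U R (D i)" if "i \<in> I" for i by (rule sm[OF that])
    show "small_module U R L" by (rule sL)
    show "linear_map R (D i) (D j) (t i j)" if "(i, j) \<in> r" for i j by (rule t[OF that])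
    show "linear_map R (D i) L (c i)" if "i \<in> I" for i
      unfolding linear_map_def using that cK by (simp add: L_car L_add L_smult)
    show "t j k (t i j x) = t i k x" if "(i, j) \<in> r" "(j, k) \<in> r" "x \<in> carrier (D i)" for i j k x
      by (rule comp[OF that])
    show "c j (t i j x) = c i x" if "(i, j) \<in> r" "x \<in> carrier (D i)" for i j x by (rule c_t[OF that])
    show "\<exists>i\<in>I. \<exists>x\<in>carrier (D i). c i x = y" if "y \<in> carrier L" for y
      using that unfolding L_car K_def by blast
    show "\<exists>j. (i, j) \<in> r \<and> t i j x = \<zero>\<^bsub>D j\<^esub>" if i: "i \<in> I" "x \<in> carrier (D i)" "c i x = \<zero>\<^bsub>L\<^esub>" for i x
    proof -
      interpret Di: left_module R "D i" by (rule lm[OF i(1)])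
      have "c i x = c i \<zero>\<^bsub>D i\<^esub>" using i(3) L_zero[OF i(1)] by simp
      then obtain j where j: "(i, j) \<in> r" "t i j x = t i j \<zero>\<^bsub>D i\<^esub>"
        using c_eq[OF i(1,2,1) Di.M.zero_closed] by blast
      then show ?thesis using linear_map_zero[OF lm[OF i(1)] lm[OF mem(2)[OF j(1)]] t[OF j(1)]] by auto
    qed
  qed
  then show ?thesis by blast
qed


section \<open>The category of h-unitary modules\<close>


abbreviation HU :: "(('r, 'u) module, 'u \<Rightarrow> 'u) cat" where "HU \<equiv> h_unitary_category U R A"

lemma HU_simps:
  "X \<in> Ob HU \<longleftrightarrow> small_module U R X \<and> h_exact X"
  "Hom HU = module_hom R"
  "Idn HU X = (\<lambda>x\<in>carrier X. x)"
  "Comp HU X Y Z g f = compose (carrier X) g f"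
  unfolding h_unitary_category_def full_subcategory_def module_category_def
  using h_unitary_iff[of X] by auto

lemma module_hom_linear: "f \<in> module_hom R M N \<Longrightarrow> linear_map R M N f"
  unfolding module_hom_iff by blast

lemma module_hom_ext: "f \<in> module_hom R M N \<Longrightarrow> f \<in> extensional (carrier M)"
  unfolding module_hom_iff by blast

lemma module_hom_eqI:
  assumes "f \<in> module_hom R M N" "g \<in> module_hom R M N" "\<And>x. x \<in> carrier M \<Longrightarrow> f x = g x"
  shows "f = g"
  by (rule extensionalityI[OF module_hom_ext[OF assms(1)] module_hom_ext[OF assms(2)] assms(3)])

lemma module_hom_compose:
  assumes "left_module R L" "f \<in> module_hom R L M" "g \<in> module_hom R M N"
  shows "compose (carrier L) g f \<in> module_hom R L N"
  unfolding compose_def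
  by (rule linear_map_restrict[OF assms(1) linear_map_comp[OF module_hom_linear[OF assms(2)] module_hom_linear[OF assms(3)]]])

lemma HU_category: "is_category HU"
  unfolding is_category_def
proof (intro conjI ballI)
  fix X assume "X \<in> Ob HU"
  then have X: "left_module R X" using small_module_left unfolding HU_simps by blast
  show "Idn HU X \<in> Hom HU X X" unfolding HU_simps by (rule linear_map_restrict[OF X linear_map_ident])
next
  fix X Y Z f g assume "X \<in> Ob HU" and f: "f \<in> Hom HU X Y" "g \<in> Hom HU Y Z"
  then have X: "left_module R X" using small_module_left unfolding HU_simps by blast
  show "Comp HU X Y Z g f \<in> Hom HU X Z" unfolding HU_simps by (rule module_hom_compose[OF X]) (use f HU_simps in auto)
next
  fix X Y f assume f: "f \<in> Hom HU X Y"
  have f': "f \<in> extensional (carrier X)" "linear_map R X Y f"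
    using f module_hom_ext module_hom_linear unfolding HU_simps by blast+
  show "Comp HU X X Y f (Idn HU X) = f"
    unfolding HU_simps using f'(1) by (auto simp: compose_def extensional_def)
  show "Comp HU X Y Y (Idn HU Y) f = f"
    unfolding HU_simps using f' linear_map_closed[OF f'(2)] by (auto simp: compose_def extensional_def)
next
  fix W X Y Z f g h assume f: "f \<in> Hom HU W X" "g \<in> Hom HU X Y"
  show "Comp HU W X Z (Comp HU X Y Z h g) f = Comp HU W Y Z h (Comp HU W X Y g f)"
    unfolding HU_simps using linear_map_closed[OF module_hom_linear[OF f(1)[unfolded HU_simps]]]
    by (auto simp: compose_def restrict_def fun_eq_iff)
qed

lemma colim_eq_general:
  assumes C: "directed_colimit I r D t L c" and i: "i \<in> I" "x \<in> carrier (D i)" and j: "j \<in> I" "y \<in> carrier (D j)"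
    and eq: "c i x = c j y"
  shows "\<exists>k. (i, k) \<in> r \<and> (j, k) \<in> r \<and> t i k x = t j k y"
proof -
  obtain k where k: "(i, k) \<in> r" "(j, k) \<in> r" using colim_directed[OF C i(1) j(1)] by blast
  note cl = linear_map_closed[OF colim_trans_map[OF C k(1)] i(2)] linear_map_closed[OF colim_trans_map[OF C k(2)] j(2)]
  have "c k (t i k x) = c k (t j k y)"
    using colim_compat[OF C k(1) i(2)] colim_compat[OF C k(2) j(2)] eq by simp
  then obtain l where l: "(k, l) \<in> r" "t k l (t i k x) = t k l (t j k y)"
    using colim_eq[OF C colim_mem(2)[OF C k(1)] cl] by blast
  then have "t i l x = t j l y" using colim_comp[OF C k(1) l(1) i(2)] colim_comp[OF C k(2) l(1) j(2)] by simp
  then show ?thesis using colim_trans[OF C k(1) l(1)] colim_trans[OF C k(2) l(1)] by blast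
qed

lemma colim_universal:
  assumes C: "directed_colimit I r D t L c" and X: "left_module R X"
    and d: "\<And>i. i \<in> I \<Longrightarrow> linear_map R (D i) X (d i)"
    and compat: "\<And>i j x. (i, j) \<in> r \<Longrightarrow> x \<in> carrier (D i) \<Longrightarrow> d j (t i j x) = d i x"
  shows "\<exists>h. linear_map R L X h \<and> (\<forall>i\<in>I. \<forall>x\<in>carrier (D i). h (c i x) = d i x)"
proof -
  note lm = small_module_left[OF colim_small[OF C]] and lL = small_module_left[OF colim_small_lim[OF C]]
  note mem = colim_mem[OF C]
  define h where "h = (\<lambda>y. SOME z. \<exists>i x. i \<in> I \<and> x \<in> carrier (D i) \<and> c i x = y \<and> z = d i x)"
  have h: "h (c i x) = d i x" if i: "i \<in> I" "x \<in> carrier (D i)" for i x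
  proof -
    have "\<exists>j y. j \<in> I \<and> y \<in> carrier (D j) \<and> c j y = c i x \<and> h (c i x) = d j y"
      unfolding h_def by (rule someI[of _ "d i x"]) (use i in blast)
    then obtain j y where j: "j \<in> I" "y \<in> carrier (D j)" "c j y = c i x" and w: "h (c i x) = d j y" by blast
    obtain k where k: "(j, k) \<in> r" "(i, k) \<in> r" "t j k y = t i k x" using colim_eq_general[OF C j(1,2) i j(3)] by blast
    have "d j y = d i x" using compat[OF k(1) j(2)] compat[OF k(2) i(2)] k(3) by simp
    then show ?thesis unfolding w .
  qed
  have "linear_map R L X h"
    unfolding linear_map_def
  proof (intro conjI ballI)
    show "h \<in> carrier L \<rightarrow> carrier X"
    proof
      fix y assume "y \<in> carrier L"
      then obtain i x where i: "i \<in> I" "x \<in> carrier (D i)" "c i x = y" using colim_surj[OF C] by blast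
      then show "h y \<in> carrier X" using h[OF i(1,2)] linear_map_closed[OF d[OF i(1)] i(2)] by simp
    qed
    fix u v assume uv: "u \<in> carrier L" "v \<in> carrier L"
    obtain i x where i: "i \<in> I" "x \<in> carrier (D i)" "c i x = u" using colim_surj[OF C uv(1)] by blast
    obtain j y where j: "j \<in> I" "y \<in> carrier (D j)" "c j y = v" using colim_surj[OF C uv(2)] by blast
    obtain k where k: "(i, k) \<in> r" "(j, k) \<in> r" using colim_directed[OF C i(1) j(1)] by blast
    note kI = mem(2)[OF k(1)]
    interpret Dk: left_module R "D k" by (rule lm[OF kI])
    have x': "t i k x \<in> carrier (D k)" "c k (t i k x) = u"
      using linear_map_closed[OF colim_trans_map[OF C k(1)] i(2)] colim_compat[OF C k(1) i(2)] i(3) by simp_all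
    have y': "t j k y \<in> carrier (D k)" "c k (t j k y) = v"
      using linear_map_closed[OF colim_trans_map[OF C k(2)] j(2)] colim_compat[OF C k(2) j(2)] j(3) by simp_all
    have "u \<oplus>\<^bsub>L\<^esub> v = c k (t i k x \<oplus>\<^bsub>D k\<^esub> t j k y)"
      using linear_map_add[OF colim_map[OF C kI] x'(1) y'(1)] x'(2) y'(2) by simp
    then have "h (u \<oplus>\<^bsub>L\<^esub> v) = d k (t i k x \<oplus>\<^bsub>D k\<^esub> t j k y)"
      using h[OF kI Dk.M.a_closed[OF x'(1) y'(1)]] by simp
    also have "\<dots> = d k (t i k x) \<oplus>\<^bsub>X\<^esub> d k (t j k y)" by (rule linear_map_add[OF d[OF kI] x'(1) y'(1)])
    finally show "h (u \<oplus>\<^bsub>L\<^esub> v) = h u \<oplus>\<^bsub>X\<^esub> h v"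
      using h[OF kI x'(1)] h[OF kI y'(1)] x'(2) y'(2) by simp
  next
    fix a u assume a: "a \<in> carrier R" and u: "u \<in> carrier L"
    obtain i x where i: "i \<in> I" "x \<in> carrier (D i)" "c i x = u" using colim_surj[OF C u] by blast
    interpret Di: left_module R "D i" by (rule lm[OF i(1)])
    show "h (a \<odot>\<^bsub>L\<^esub> u) = a \<odot>\<^bsub>X\<^esub> h u"
      using h[OF i(1) Di.smult_closed[OF a i(2)]] h[OF i(1,2)] i(3) linear_map_smult[OF colim_map[OF C i(1)] a i(2)]
        linear_map_smult[OF d[OF i(1)] a i(2)] by simp
  qed
  then show ?thesis using h by blast
qed

lemma HU_direct_system:
  assumes "direct_system HU I r D t"
  shows "i \<in> I \<Longrightarrow> small_module U R (D i)" "i \<in> I \<Longrightarrow> h_exact (D i)"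
    "(i, j) \<in> r \<Longrightarrow> t i j \<in> module_hom R (D i) (D j)"
    "(i, j) \<in> r \<Longrightarrow> (j, k) \<in> r \<Longrightarrow> x \<in> carrier (D i) \<Longrightarrow> t j k (t i j x) = t i k x"
proof -
  show "i \<in> I \<Longrightarrow> small_module U R (D i)" "i \<in> I \<Longrightarrow> h_exact (D i)"
    "(i, j) \<in> r \<Longrightarrow> t i j \<in> module_hom R (D i) (D j)"
    using assms unfolding direct_system_def HU_simps by simp_all
  assume "(i, j) \<in> r" "(j, k) \<in> r" and x: "x \<in> carrier (D i)"
  then have "compose (carrier (D i)) (t j k) (t i j) = t i k"
    using assms unfolding direct_system_def HU_simps by blast
  from fun_cong[OF this, of x] show "t j k (t i j x) = t i k x" using x by (simp add: compose_def)
qed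

lemma HU_cocone:
  assumes "is_cocone HU I r D t X d"
  shows "small_module U R X" "h_exact X" "i \<in> I \<Longrightarrow> d i \<in> module_hom R (D i) X"
    "(i, j) \<in> r \<Longrightarrow> x \<in> carrier (D i) \<Longrightarrow> d j (t i j x) = d i x"
proof -
  show "small_module U R X" "h_exact X" "i \<in> I \<Longrightarrow> d i \<in> module_hom R (D i) X"
    using assms unfolding is_cocone_def HU_simps by simp_all
  assume "(i, j) \<in> r" and x: "x \<in> carrier (D i)"
  then have "compose (carrier (D i)) (d j) (t i j) = d i"
    using assms unfolding is_cocone_def HU_simps by blast
  from fun_cong[OF this, of x] show "d j (t i j x) = d i x" using x by (simp add: compose_def)
qed

lemma directed_colimit_is_colimit:
  assumes S: "direct_system HU I r D t" and C: "directed_colimit I r D t L c" and h: "h_exact L"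
  shows "is_colimit HU I r D t L (\<lambda>i. restrict (c i) (carrier (D i)))"
proof -
  let ?c = "\<lambda>i. restrict (c i) (carrier (D i))"
  note s = HU_direct_system[OF S] and mem = colim_mem[OF C]
  note lm = small_module_left[OF s(1)] and lL = small_module_left[OF colim_small_lim[OF C]]
  have c: "?c i \<in> module_hom R (D i) L" if "i \<in> I" for i
    by (rule linear_map_restrict[OF lm[OF that] colim_map[OF C that]])
  have coc: "is_cocone HU I r D t L ?c"
    unfolding is_cocone_def HU_simps
  proof (intro conjI ballI allI impI)
    show "small_module U R L" "h_exact L" by (rule colim_small_lim[OF C] h)+
    show "?c i \<in> module_hom R (D i) L" if "i \<in> I" for i by (rule c[OF that])
    show "compose (carrier (D i)) (?c j) (t i j) = ?c i" if ij: "(i, j) \<in> r" for i j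
      using linear_map_closed[OF colim_trans_map[OF C ij]] colim_compat[OF C ij] by (auto simp: compose_def)
  qed
  have "\<exists>!f. f \<in> Hom HU L X \<and> (\<forall>i\<in>I. Comp HU (D i) L X f (?c i) = d i)" if X: "is_cocone HU I r D t X d" for X d
  proof -
    note x = HU_cocone[OF X]
    obtain f where f: "linear_map R L X f" "\<And>i x. i \<in> I \<Longrightarrow> x \<in> carrier (D i) \<Longrightarrow> f (c i x) = d i x"
      using colim_universal[OF C small_module_left[OF x(1)] module_hom_linear[OF x(3)] x(4)] by blast
    let ?f = "restrict f (carrier L)"
    have fh: "?f \<in> module_hom R L X" by (rule linear_map_restrict[OF lL f(1)])
    have fc: "compose (carrier (D i)) ?f (?c i) = d i" if "i \<in> I" for i
    proof
      fix y show "compose (carrier (D i)) ?f (?c i) y = d i y"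
        using f(2)[OF that] linear_map_closed[OF colim_map[OF C that]] module_hom_ext[OF x(3)[OF that]]
        by (auto simp: compose_def extensional_def)
    qed
    have uniq: "g = ?f" if g: "g \<in> module_hom R L X" "\<forall>i\<in>I. compose (carrier (D i)) g (?c i) = d i" for g
    proof (rule module_hom_eqI[OF g(1) fh])
      fix y assume y: "y \<in> carrier L"
      obtain i z where i: "i \<in> I" "z \<in> carrier (D i)" "c i z = y" using colim_surj[OF C y] by blast
      have "compose (carrier (D i)) g (?c i) z = d i z" using g(2) i(1) by simp
      then show "g y = ?f y" using f(2)[OF i(1,2)] i y by (simp add: compose_def)
    qed
    show ?thesis unfolding HU_simps using fh fc uniq by blast
  qed
  then show ?thesis unfolding is_colimit_def using coc by blast
qed

lemma module_system_of_HU: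
  assumes S: "direct_system HU I r D t" and r: "preorder_on I r" "I \<noteq> {}"
    and dir: "\<And>i j. i \<in> I \<Longrightarrow> j \<in> I \<Longrightarrow> \<exists>k. (i, k) \<in> r \<and> (j, k) \<in> r"
  shows "module_system I r D t"
  unfolding module_system_def
  using r dir HU_direct_system(1,4)[OF S] module_hom_linear[OF HU_direct_system(3)[OF S]] by simp

lemma HU_colimit_factor:
  assumes col: "is_colimit HU I r D t L c" and coc: "is_cocone HU I r D t X d"
  shows "\<exists>f. f \<in> module_hom R L X \<and> (\<forall>i\<in>I. compose (carrier (D i)) f (c i) = d i)"
    and "f \<in> module_hom R L X \<Longrightarrow> (\<And>i. i \<in> I \<Longrightarrow> compose (carrier (D i)) f (c i) = d i) \<Longrightarrow>
      g \<in> module_hom R L X \<Longrightarrow> (\<And>i. i \<in> I \<Longrightarrow> compose (carrier (D i)) g (c i) = d i) \<Longrightarrow> f = g"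
proof -
  have "\<exists>!h. h \<in> Hom HU L X \<and> (\<forall>i\<in>I. Comp HU (D i) L X h (c i) = d i)"
    using col coc unfolding is_colimit_def by simp
  then have ex: "\<exists>!f. f \<in> module_hom R L X \<and> (\<forall>i\<in>I. compose (carrier (D i)) f (c i) = d i)"
    unfolding HU_simps .
  show "\<exists>f. f \<in> module_hom R L X \<and> (\<forall>i\<in>I. compose (carrier (D i)) f (c i) = d i)"
    by (rule ex1_implies_ex[OF ex])
  show "f = g" if "f \<in> module_hom R L X" "\<And>i. i \<in> I \<Longrightarrow> compose (carrier (D i)) f (c i) = d i"
    "g \<in> module_hom R L X" "\<And>i. i \<in> I \<Longrightarrow> compose (carrier (D i)) g (c i) = d i"
    by (rule trans[OF the1_equality[OF ex, symmetric] the1_equality[OF ex]]) (use that in blast)+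
qed

lemma is_colimit_directed_colimit:
  assumes S: "direct_system HU I r D t" and I: "small U I" and r: "preorder_on I r" "I \<noteq> {}"
    and dir: "\<And>i j. i \<in> I \<Longrightarrow> j \<in> I \<Longrightarrow> \<exists>k. (i, k) \<in> r \<and> (j, k) \<in> r"
    and col: "is_colimit HU I r D t L c"
  shows "directed_colimit I r D t L c"
proof -
  note s = HU_direct_system[OF S]
  obtain L' c' where C: "directed_colimit I r D t L' c'"
    using directed_colimit_exists[OF module_system_of_HU[OF S r dir] I] by blast
  note mem = colim_mem[OF C]
  have h': "h_exact L'" by (rule colim_h_exact_all[OF C s(2)])
  let ?c = "\<lambda>i. restrict (c' i) (carrier (D i))"
  have col': "is_colimit HU I r D t L' ?c" by (rule directed_colimit_is_colimit[OF S C h'])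
  have coc: "is_cocone HU I r D t L c" "is_cocone HU I r D t L' ?c"
    using col col' unfolding is_colimit_def by blast+
  note l = HU_cocone[OF coc(1)]
  note lL = small_module_left[OF l(1)] and lL' = small_module_left[OF colim_small_lim[OF C]]
  obtain f where f: "f \<in> module_hom R L L'" "\<And>i. i \<in> I \<Longrightarrow> compose (carrier (D i)) f (c i) = ?c i"
    using HU_colimit_factor(1)[OF col coc(2)] by blast
  obtain g where g: "g \<in> module_hom R L' L" "\<And>i. i \<in> I \<Longrightarrow> compose (carrier (D i)) g (?c i) = c i"
    using HU_colimit_factor(1)[OF col' coc(1)] by blast
  have fc: "f (c i x) = c' i x" if "i \<in> I" "x \<in> carrier (D i)" for i x
    using fun_cong[OF f(2)[OF that(1)], of x] that by (simp add: compose_def)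
  have gc: "g (c' i x) = c i x" if "i \<in> I" "x \<in> carrier (D i)" for i x
    using fun_cong[OF g(2)[OF that(1)], of x] that by (simp add: compose_def)
  have gf: "g (f y) = y" if y: "y \<in> carrier L" for y
  proof -
    let ?gf = "compose (carrier L) g f" and ?id = "restrict (\<lambda>x. x) (carrier L)"
    have hom: "?gf \<in> module_hom R L L" "?id \<in> module_hom R L L"
      by (rule module_hom_compose[OF lL f(1) g(1)], rule linear_map_restrict[OF lL linear_map_ident])
    have e: "compose (carrier (D i)) ?gf (c i) = c i" "compose (carrier (D i)) ?id (c i) = c i" if i: "i \<in> I" for i
      using linear_map_closed[OF module_hom_linear[OF l(3)[OF i]]] fc[OF i] gc[OF i] module_hom_ext[OF l(3)[OF i]]
      by (auto simp: compose_def extensional_def fun_eq_iff)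
    have "?gf = ?id"
      by (rule HU_colimit_factor(2)[OF col coc(1) hom(1) e(1) hom(2) e(2)])
    from fun_cong[OF this, of y] show ?thesis using y by (simp add: compose_def)
  qed
  show ?thesis
    unfolding directed_colimit_def
  proof (intro conjI allI impI ballI)
    show "preorder_on I r" "I \<noteq> {}" by (rule r)+
    show "\<exists>k. (i, k) \<in> r \<and> (j, k) \<in> r" if "i \<in> I" "j \<in> I" for i j by (rule dir[OF that])
    show "small_module U R (D i)" if "i \<in> I" for i by (rule s(1)[OF that])
    show "small_module U R L" by (rule l(1))
    show "linear_map R (D i) (D j) (t i j)" if "(i, j) \<in> r" for i j by (rule colim_trans_map[OF C that])
    show "linear_map R (D i) L (c i)" if "i \<in> I" for i by (rule module_hom_linear[OF l(3)[OF that]])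
    show "t j k (t i j x) = t i k x" if "(i, j) \<in> r" "(j, k) \<in> r" "x \<in> carrier (D i)" for i j k x
      by (rule s(4)[OF that])
    show "c j (t i j x) = c i x" if "(i, j) \<in> r" "x \<in> carrier (D i)" for i j x by (rule l(4)[OF that])
    show "\<exists>i\<in>I. \<exists>x\<in>carrier (D i). c i x = y" if y: "y \<in> carrier L" for y
    proof -
      obtain i x where i: "i \<in> I" "x \<in> carrier (D i)" "c' i x = f y"
        using colim_surj[OF C linear_map_closed[OF module_hom_linear[OF f(1)] y]] by blast
      then have "c i x = y" using gc[OF i(1,2)] gf[OF y] by simp
      then show ?thesis using i by blast
    qed
    show "\<exists>j. (i, j) \<in> r \<and> t i j x = \<zero>\<^bsub>D j\<^esub>" if i: "i \<in> I" "x \<in> carrier (D i)" "c i x = \<zero>\<^bsub>L\<^esub>" for i x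
      by (rule colim_kernel[OF C i(1,2)])
        (use fc[OF i(1,2)] i(3) linear_map_zero[OF lL lL' module_hom_linear[OF f(1)]] in simp)
  qed
qed


lemma le_\<Lambda>_Times: "|X| \<le>o |\<Lambda>| \<Longrightarrow> |Y| \<le>o |\<Lambda>| \<Longrightarrow> |X \<times> Y| \<le>o |\<Lambda>|"
  by (rule card_of_Times_ordLeq_infinite[OF infinite_\<Lambda>])

lemma directed_set_props:
  fixes I :: "'u set"
  assumes \<kappa>: "\<And>S :: 'u set. |S| \<le>o |\<Lambda>| \<Longrightarrow> |S| <o \<kappa>" and d: "directed_set \<kappa> I r"
  shows "preorder_on I r" "I \<noteq> {}" "\<And>i j. i \<in> I \<Longrightarrow> j \<in> I \<Longrightarrow> \<exists>k. (i, k) \<in> r \<and> (j, k) \<in> r"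
    "\<And>S. S \<subseteq> I \<Longrightarrow> |S| \<le>o |\<Lambda>| \<Longrightarrow> \<exists>u\<in>I. \<forall>s\<in>S. (s, u) \<in> r"
proof -
  show "preorder_on I r" using d unfolding directed_set_def by blast
  show b: "\<exists>u\<in>I. \<forall>s\<in>S. (s, u) \<in> r" if "S \<subseteq> I" "|S| \<le>o |\<Lambda>|" for S
    using d that(1) \<kappa>[OF that(2)] unfolding directed_set_def by blast
  show "I \<noteq> {}" using b[of "{}"] le_\<Lambda>_finite[of "{} :: 'u set"] by blast
  show "\<exists>k. (i, k) \<in> r \<and> (j, k) \<in> r" if "i \<in> I" "j \<in> I" for i j
    using b[of "{i, j}"] le_\<Lambda>_finite[of "{i, j}"] that by blast
qed

lemma light_factor:
  assumes C: "directed_colimit I r D t L c"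
    and bound: "\<And>S. S \<subseteq> I \<Longrightarrow> |S| \<le>o |\<Lambda>| \<Longrightarrow> \<exists>u\<in>I. \<forall>s\<in>S. (s, u) \<in> r"
    and X: "left_module R X" "|carrier X| \<le>o |\<Lambda>|" and f: "linear_map R X L f"
  shows "\<exists>i\<in>I. \<exists>g. linear_map R X (D i) g \<and> (\<forall>x\<in>carrier X. c i (g x) = f x)"
proof -
  interpret X: left_module R X by (rule X(1))
  note lm = small_module_left[OF colim_small[OF C]] and lL = small_module_left[OF colim_small_lim[OF C]]
  note mem = colim_mem[OF C]
  have "\<forall>x\<in>carrier X. \<exists>p. fst p \<in> I \<and> snd p \<in> carrier (D (fst p)) \<and> c (fst p) (snd p) = f x"
    using colim_surj[OF C linear_map_closed[OF f]] by fastforce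
  from bchoice[OF this] obtain p where
    p: "\<And>x. x \<in> carrier X \<Longrightarrow> fst (p x) \<in> I \<and> snd (p x) \<in> carrier (D (fst (p x))) \<and> c (fst (p x)) (snd (p x)) = f x"
    by blast
  have "(\<lambda>x. fst (p x)) ` carrier X \<subseteq> I" using p by blast
  from bound[OF this le_\<Lambda>_image[OF X(2)]] obtain i where
    i: "i \<in> I" "\<And>x. x \<in> carrier X \<Longrightarrow> (fst (p x), i) \<in> r" by blast
  define y where "y = (\<lambda>x. t (fst (p x)) i (snd (p x)))"
  have y: "y x \<in> carrier (D i)" "c i (y x) = f x" if x: "x \<in> carrier X" for x
    unfolding y_def using linear_map_closed[OF colim_trans_map[OF C i(2)[OF x]]] p[OF x] colim_compat[OF C i(2)[OF x]]
    by auto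
  interpret Di: left_module R "D i" by (rule lm[OF i(1)])
  have "\<forall>q\<in>carrier X \<times> carrier X. \<exists>j. (i, j) \<in> r \<and> t i j (y (fst q \<oplus>\<^bsub>X\<^esub> snd q)) = t i j (y (fst q) \<oplus>\<^bsub>D i\<^esub> y (snd q))"
  proof
    fix q assume "q \<in> carrier X \<times> carrier X"
    then have q: "fst q \<in> carrier X" "snd q \<in> carrier X" "fst q \<oplus>\<^bsub>X\<^esub> snd q \<in> carrier X" by auto
    have "c i (y (fst q \<oplus>\<^bsub>X\<^esub> snd q)) = c i (y (fst q) \<oplus>\<^bsub>D i\<^esub> y (snd q))"
      using y(2)[OF q(3)] linear_map_add[OF f q(1,2)] linear_map_add[OF colim_map[OF C i(1)] y(1)[OF q(1)] y(1)[OF q(2)]]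
        y(2)[OF q(1)] y(2)[OF q(2)] by simp
    then show "\<exists>j. (i, j) \<in> r \<and> t i j (y (fst q \<oplus>\<^bsub>X\<^esub> snd q)) = t i j (y (fst q) \<oplus>\<^bsub>D i\<^esub> y (snd q))"
      by (rule colim_eq[OF C i(1) y(1)[OF q(3)] Di.M.a_closed[OF y(1)[OF q(1)] y(1)[OF q(2)]]])
  qed
  from bchoice[OF this] obtain j1 where j1': "\<forall>q\<in>carrier X \<times> carrier X.
      (i, j1 q) \<in> r \<and> t i (j1 q) (y (fst q \<oplus>\<^bsub>X\<^esub> snd q)) = t i (j1 q) (y (fst q) \<oplus>\<^bsub>D i\<^esub> y (snd q))"
    by (rule exE)
  note j1 = bspec[OF j1']
  have "\<forall>q\<in>carrier R \<times> carrier X. \<exists>j. (i, j) \<in> r \<and> t i j (y (fst q \<odot>\<^bsub>X\<^esub> snd q)) = t i j (fst q \<odot>\<^bsub>D i\<^esub> y (snd q))"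
  proof
    fix q assume "q \<in> carrier R \<times> carrier X"
    then have q: "fst q \<in> carrier R" "snd q \<in> carrier X" "fst q \<odot>\<^bsub>X\<^esub> snd q \<in> carrier X" using X.smult_closed by auto
    have "c i (y (fst q \<odot>\<^bsub>X\<^esub> snd q)) = c i (fst q \<odot>\<^bsub>D i\<^esub> y (snd q))"
      using y(2)[OF q(3)] linear_map_smult[OF f q(1,2)] linear_map_smult[OF colim_map[OF C i(1)] q(1) y(1)[OF q(2)]]
        y(2)[OF q(2)] by simp
    then show "\<exists>j. (i, j) \<in> r \<and> t i j (y (fst q \<odot>\<^bsub>X\<^esub> snd q)) = t i j (fst q \<odot>\<^bsub>D i\<^esub> y (snd q))"
      by (rule colim_eq[OF C i(1) y(1)[OF q(3)] Di.smult_closed[OF q(1) y(1)[OF q(2)]]])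
  qed
  from bchoice[OF this] obtain j2 where j2': "\<forall>q\<in>carrier R \<times> carrier X.
      (i, j2 q) \<in> r \<and> t i (j2 q) (y (fst q \<odot>\<^bsub>X\<^esub> snd q)) = t i (j2 q) (fst q \<odot>\<^bsub>D i\<^esub> y (snd q))"
    by (rule exE)
  note j2 = bspec[OF j2']
  let ?J = "j1 ` (carrier X \<times> carrier X) \<union> j2 ` (carrier R \<times> carrier X) \<union> {i}"
  have "|?J| \<le>o |\<Lambda>|"
    by (intro le_\<Lambda>_Un le_\<Lambda>_image le_\<Lambda>_Times X(2) R_le_\<Lambda> le_\<Lambda>_finite finite.intros)
  moreover have "?J \<subseteq> I" using j1 j2 i(1) mem(2) by blast
  ultimately obtain u where u: "u \<in> I" "\<And>s. s \<in> ?J \<Longrightarrow> (s, u) \<in> r" using bound[of ?J] by blast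
  have iu: "(i, u) \<in> r" using u(2) by blast
  note tu = colim_trans_map[OF C iu]
  have push: "t i u a = t i u b" if "(i, j) \<in> r" "(j, u) \<in> r" "t i j a = t i j b" "a \<in> carrier (D i)" "b \<in> carrier (D i)" for j a b
    using colim_comp[OF C that(1,2,4)] colim_comp[OF C that(1,2,5)] that(3) by simp
  have "linear_map R X (D u) (\<lambda>x. t i u (y x))"
    unfolding linear_map_def
  proof (intro conjI ballI)
    show "(\<lambda>x. t i u (y x)) \<in> carrier X \<rightarrow> carrier (D u)" using linear_map_closed[OF tu y(1)] by blast
    fix a b assume ab: "a \<in> carrier X" "b \<in> carrier X"
    have "t i u (y (a \<oplus>\<^bsub>X\<^esub> b)) = t i u (y a \<oplus>\<^bsub>D i\<^esub> y b)"
      using j1[of "(a, b)"] ab y(1) u(2)[of "j1 (a, b)"] by (intro push[of "j1 (a, b)"]) auto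
    then show "t i u (y (a \<oplus>\<^bsub>X\<^esub> b)) = t i u (y a) \<oplus>\<^bsub>D u\<^esub> t i u (y b)"
      using linear_map_add[OF tu y(1)[OF ab(1)] y(1)[OF ab(2)]] by simp
  next
    fix s b assume sb: "s \<in> carrier R" "b \<in> carrier X"
    have "t i u (y (s \<odot>\<^bsub>X\<^esub> b)) = t i u (s \<odot>\<^bsub>D i\<^esub> y b)"
      using j2[of "(s, b)"] sb y(1) u(2)[of "j2 (s, b)"] X.smult_closed Di.smult_closed
      by (intro push[of "j2 (s, b)"]) auto
    then show "t i u (y (s \<odot>\<^bsub>X\<^esub> b)) = s \<odot>\<^bsub>D u\<^esub> t i u (y b)"
      using linear_map_smult[OF tu sb(1) y(1)[OF sb(2)]] by simp
  qed
  moreover have "c u (t i u (y x)) = f x" if "x \<in> carrier X" for x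
    using colim_compat[OF C iu y(1)[OF that]] y(2)[OF that] by simp
  ultimately show ?thesis using u(1) by blast
qed

lemma light_equalize:
  assumes C: "directed_colimit I r D t L c"
    and bound: "\<And>S. S \<subseteq> I \<Longrightarrow> |S| \<le>o |\<Lambda>| \<Longrightarrow> \<exists>u\<in>I. \<forall>s\<in>S. (s, u) \<in> r"
    and X: "|X| \<le>o |\<Lambda>|" and i: "i \<in> I" and j: "j \<in> I"
    and f: "\<And>x. x \<in> X \<Longrightarrow> f x \<in> carrier (D i)" and g: "\<And>x. x \<in> X \<Longrightarrow> g x \<in> carrier (D j)"
    and eq: "\<And>x. x \<in> X \<Longrightarrow> c i (f x) = c j (g x)"
  shows "\<exists>k\<in>I. (i, k) \<in> r \<and> (j, k) \<in> r \<and> (\<forall>x\<in>X. t i k (f x) = t j k (g x))"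
proof -
  have "\<forall>x\<in>X. \<exists>k. (i, k) \<in> r \<and> (j, k) \<in> r \<and> t i k (f x) = t j k (g x)"
    using colim_eq_general[OF C i f j g eq] by blast
  from bchoice[OF this] obtain k where
    k: "\<And>x. x \<in> X \<Longrightarrow> (i, k x) \<in> r \<and> (j, k x) \<in> r \<and> t i (k x) (f x) = t j (k x) (g x)" by blast
  let ?J = "k ` X \<union> {i, j}"
  have "|?J| \<le>o |\<Lambda>|" by (intro le_\<Lambda>_Un le_\<Lambda>_image X le_\<Lambda>_finite finite.intros)
  moreover have "?J \<subseteq> I" using k i j colim_mem(2)[OF C] by blast
  ultimately obtain u where u: "u \<in> I" "\<And>s. s \<in> ?J \<Longrightarrow> (s, u) \<in> r" using bound[of ?J] by blast
  have "t i u (f x) = t j u (g x)" if x: "x \<in> X" for x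
  proof -
    have kx: "(i, k x) \<in> r" "(j, k x) \<in> r" "t i (k x) (f x) = t j (k x) (g x)" "(k x, u) \<in> r"
      using k[OF x] u(2)[of "k x"] x by simp_all
    show ?thesis using colim_comp[OF C kx(1,4) f[OF x]] colim_comp[OF C kx(2,4) g[OF x]] kx(3) by simp
  qed
  then show ?thesis using u by blast
qed

lemma presentable_light:
  assumes \<kappa>: "\<And>S :: 'u set. |S| \<le>o |\<Lambda>| \<Longrightarrow> |S| <o \<kappa>"
    and X: "small_module U R X" "h_exact X" "|carrier X| \<le>o |\<Lambda>|"
  shows "presentable U \<kappa> HU X"
  unfolding presentable_def
proof (intro conjI allI impI)
  show "X \<in> Ob HU" unfolding HU_simps using X by simp
  fix I :: "'u set" and r D t L c
  assume a: "small U I \<and> directed_set \<kappa> I r \<and> direct_system HU I r D t \<and> is_colimit HU I r D t L c"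
  then have I: "small U I" and d: "directed_set \<kappa> I r" and S: "direct_system HU I r D t" and col: "is_colimit HU I r D t L c"
    by simp_all
  have dp: "preorder_on I r" "I \<noteq> {}" "\<And>i j. i \<in> I \<Longrightarrow> j \<in> I \<Longrightarrow> \<exists>k. (i, k) \<in> r \<and> (j, k) \<in> r"
    by (rule directed_set_props(1-3)[OF _ d], rule \<kappa>, assumption+)+
  have bound: "\<exists>u\<in>I. \<forall>s\<in>S. (s, u) \<in> r" if "S \<subseteq> I" "|S| \<le>o |\<Lambda>|" for S
    by (rule directed_set_props(4)[OF _ d that]) (rule \<kappa>)
  have C: "directed_colimit I r D t L c" by (rule is_colimit_directed_colimit[OF S I dp(1-3) col])
  note lX = small_module_left[OF X(1)] and mem = colim_mem[OF C]
  have cm: "c i \<in> module_hom R (D i) L" if "i \<in> I" for i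
    using col that HU_cocone(3)[of I r D t L c i] unfolding is_colimit_def by simp
  let ?H = "\<lambda>i. Hom HU X (D i)" and ?T = "\<lambda>i j f. Comp HU X (D i) (D j) (t i j) f"
  define E where "E = {((i, x), (j, y)). (i, x) \<in> Sigma I ?H \<and> (j, y) \<in> Sigma I ?H \<and> (\<exists>k\<in>I. (i, k) \<in> r \<and> (j, k) \<in> r \<and> ?T i k x = ?T j k y)}"
  define G where "G = (\<lambda>(i, f). Comp HU X (D i) L (c i) f)"
  have G: "G (i, f) = compose (carrier X) (c i) f" for i f unfolding G_def HU_simps by simp
  have HE: "f \<in> ?H i \<longleftrightarrow> f \<in> module_hom R X (D i)" for f i unfolding HU_simps ..
  have cl: "f x \<in> carrier (D i)" if "f \<in> ?H i" "x \<in> carrier X" for f i x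
    using linear_map_closed[OF module_hom_linear[OF that(1)[unfolded HU_simps]] that(2)] .
  have Tcl: "?T i j f \<in> ?H j" if "(i, j) \<in> r" "f \<in> ?H i" for i j f
    unfolding HU_simps
    by (rule module_hom_compose[OF lX that(2)[unfolded HU_simps] HU_direct_system(3)[OF S that(1)]])
  have Tcomp: "?T j k (?T i j f) = ?T i k f" if "(i, j) \<in> r" "(j, k) \<in> r" "f \<in> ?H i" for i j k f
    unfolding HU_simps using colim_comp[OF C that(1,2) cl[OF that(3)]] by (auto simp: compose_def)
  have eqv: "equiv (Sigma I ?H) E" unfolding E_def by (rule set_direct_limit_equiv[OF dp(1,3) Tcl Tcomp])
  have Gc: "G (j, ?T i j f) = G (i, f)" if "(i, j) \<in> r" "f \<in> ?H i" for i j f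
    using colim_compat[OF C that(1) cl[OF that(2)]] by (auto simp: compose_def HU_simps G)
  have const: "G p = G q" if pqE: "(p, q) \<in> E" for p q
  proof -
    obtain i f j g where pq: "p = (i, f)" "q = (j, g)" by (cases p, cases q)
    obtain k where k: "(i, k) \<in> r" "(j, k) \<in> r" "?T i k f = ?T j k g" and H: "f \<in> ?H i" "g \<in> ?H j"
      using pqE unfolding pq E_def by auto
    show ?thesis unfolding pq using Gc[OF k(1) H(1)] Gc[OF k(2) H(2)] k(3) by simp
  qed
  have val: "the_elem (G ` (E `` {p})) = G p" if p: "p \<in> Sigma I ?H" for p
  proof -
    have "(p, p) \<in> E" using equiv_class_self[OF eqv p] by blast
    then have pp: "p \<in> E `` {p}" by (rule ImageI) (rule singletonI)
    have "G ` (E `` {p}) = {G p}"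
    proof (intro equalityI subsetI)
      fix y assume "y \<in> G ` (E `` {p})"
      then obtain q where q: "q \<in> E `` {p}" "y = G q" by (rule imageE)
      have "(p, q) \<in> E" using q(1) unfolding Image_singleton_iff .
      then show "y \<in> {G p}" unfolding q(2) using const[of p q] by simp
    next
      fix y assume "y \<in> {G p}"
      then show "y \<in> G ` (E `` {p})" using imageI[OF pp, of G] by simp
    qed
    then show ?thesis by simp
  qed
  let ?F = "\<lambda>Q. the_elem (G ` Q)" and ?Q = "set_direct_limit I r ?H ?T"
  have Q: "?Q = Sigma I ?H // E" unfolding set_direct_limit_def E_def ..
  have "bij_betw ?F ?Q (Hom HU X L)"
    unfolding bij_betw_def
  proof
    show "inj_on ?F ?Q"
    proof (rule inj_onI)
      fix P P' assume P: "P \<in> ?Q" "P' \<in> ?Q" and eq: "?F P = ?F P'"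
      obtain p p' where p: "p \<in> Sigma I ?H" "P = E `` {p}" "p' \<in> Sigma I ?H" "P' = E `` {p'}"
        using P unfolding Q by (blast elim: quotientE)
      obtain i f j g where pq: "p = (i, f)" "p' = (j, g)" by (cases p, cases p')
      have i: "i \<in> I" "f \<in> ?H i" and j: "j \<in> I" "g \<in> ?H j" using p pq by auto
      have "G p = G p'" using eq val[OF p(1)] val[OF p(3)] unfolding p(2,4) by simp
      then have eq': "compose (carrier X) (c i) f = compose (carrier X) (c j) g" unfolding pq by (simp add: G)
      have "c i (f x) = c j (g x)" if "x \<in> carrier X" for x
        using fun_cong[OF eq', of x] that by (simp add: compose_def)
      then have "\<exists>k\<in>I. (i, k) \<in> r \<and> (j, k) \<in> r \<and> (\<forall>x\<in>carrier X. t i k (f x) = t j k (g x))"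
        by (intro light_equalize[OF C bound X(3) i(1) j(1)] cl[OF i(2)] cl[OF j(2)])
      then obtain k where k: "k \<in> I" "(i, k) \<in> r" "(j, k) \<in> r" "\<And>x. x \<in> carrier X \<Longrightarrow> t i k (f x) = t j k (g x)"
        by blast
      have "?T i k f = ?T j k g" unfolding HU_simps using k(4) by (auto simp: compose_def)
      then have "(p, p') \<in> E" using i j k unfolding pq E_def by auto
      then show "P = P'" unfolding p(2,4) by (rule equiv_class_eq[OF eqv])
    qed
    show "?F ` ?Q = Hom HU X L"
    proof
      show "?F ` ?Q \<subseteq> Hom HU X L"
      proof
        fix h assume "h \<in> ?F ` ?Q"
        then obtain p where p: "p \<in> Sigma I ?H" "h = ?F (E `` {p})" unfolding Q by (blast elim: quotientE)
        obtain i f where pq: "p = (i, f)" by (cases p)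
        have i: "i \<in> I" "f \<in> ?H i" using p pq by auto
        have h: "h = G p" unfolding p(2) by (rule val[OF p(1)])
        show "h \<in> Hom HU X L"
          unfolding h pq G HU_simps by (rule module_hom_compose[OF lX i(2)[unfolded HU_simps] cm[OF i(1)]])
      qed
      show "Hom HU X L \<subseteq> ?F ` ?Q"
      proof
        fix h assume "h \<in> Hom HU X L"
        then have h: "h \<in> module_hom R X L" unfolding HU_simps .
        obtain i g where g: "i \<in> I" "linear_map R X (D i) g" "\<And>x. x \<in> carrier X \<Longrightarrow> c i (g x) = h x"
          using light_factor[OF C bound lX X(3) module_hom_linear[OF h]] by blast
        let ?p = "(i, restrict g (carrier X))"
        have gh: "restrict g (carrier X) \<in> ?H i" unfolding HU_simps by (rule linear_map_restrict[OF lX g(2)])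
        then have p: "?p \<in> Sigma I ?H" using g(1) by simp
        have "G ?p = h"
          unfolding G using g(3) module_hom_ext[OF h]
          by (auto simp: compose_def extensional_def fun_eq_iff)
        then have "h = ?F (E `` {?p})" using val[OF p] by (simp only:)
        moreover have "E `` {?p} \<in> ?Q" unfolding Q by (rule quotientI[OF p])
        ultimately show "h \<in> ?F ` ?Q" by (rule image_eqI)
      qed
    qed
  qed
  then show "bij_betw (\<lambda>E. the_elem ((\<lambda>(i, f). Comp HU X (D i) L (c i) f) ` E)) ?Q (Hom HU X L)"
    unfolding G_def .
qed

lemma left_module_image:
  assumes N: "left_module R N" and im: "f ` carrier N = carrier M"
    and add: "\<And>x y. x \<in> carrier N \<Longrightarrow> y \<in> carrier N \<Longrightarrow> f x \<oplus>\<^bsub>M\<^esub> f y = f (x \<oplus>\<^bsub>N\<^esub> y)"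
    and sm: "\<And>a x. a \<in> carrier R \<Longrightarrow> x \<in> carrier N \<Longrightarrow> a \<odot>\<^bsub>M\<^esub> f x = f (a \<odot>\<^bsub>N\<^esub> x)"
    and z: "\<zero>\<^bsub>M\<^esub> = f \<zero>\<^bsub>N\<^esub>"
  shows "left_module R M"
proof -
  interpret N: left_module R N by (rule N)
  have ex: "\<exists>x\<in>carrier N. y = f x" if "y \<in> carrier M" for y using that im by (metis imageE)
  have fM: "f x \<in> carrier M" if "x \<in> carrier N" for x using im that by blast
  have "abelian_group M"
  proof (rule abelian_groupI)
    fix u v assume "u \<in> carrier M" "v \<in> carrier M"
    then obtain x y where e: "x \<in> carrier N" "u = f x" "y \<in> carrier N" "v = f y" using ex by metis
    show "u \<oplus>\<^bsub>M\<^esub> v \<in> carrier M" using e fM by (simp add: add)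
    show "u \<oplus>\<^bsub>M\<^esub> v = v \<oplus>\<^bsub>M\<^esub> u" using e by (simp add: add N.M.a_comm)
  next
    show "\<zero>\<^bsub>M\<^esub> \<in> carrier M" unfolding z by (rule fM) simp
  next
    fix u v w assume "u \<in> carrier M" "v \<in> carrier M" "w \<in> carrier M"
    then obtain x y q where e: "x \<in> carrier N" "u = f x" "y \<in> carrier N" "v = f y" "q \<in> carrier N" "w = f q" using ex by metis
    show "(u \<oplus>\<^bsub>M\<^esub> v) \<oplus>\<^bsub>M\<^esub> w = u \<oplus>\<^bsub>M\<^esub> (v \<oplus>\<^bsub>M\<^esub> w)" using e by (simp add: add N.M.a_assoc)
  next
    fix u assume "u \<in> carrier M"
    then obtain x where e: "x \<in> carrier N" "u = f x" using ex by metis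
    show "\<zero>\<^bsub>M\<^esub> \<oplus>\<^bsub>M\<^esub> u = u" using e by (simp add: z add)
    show "\<exists>v\<in>carrier M. v \<oplus>\<^bsub>M\<^esub> u = \<zero>\<^bsub>M\<^esub>"
      by (rule bexI[OF _ fM[of "\<ominus>\<^bsub>N\<^esub> x"]]) (use e in \<open>simp_all add: z add N.M.l_neg\<close>)
  qed
  moreover have "left_module_axioms R M"
  proof
    fix a b u assume ab: "a \<in> carrier R" "b \<in> carrier R" and u: "u \<in> carrier M"
    obtain x where e: "x \<in> carrier N" "u = f x" using ex u by metis
    note sc = N.smult_closed[OF ab(1) e(1)] N.smult_closed[OF ab(2) e(1)]
    show "(a \<oplus> b) \<odot>\<^bsub>M\<^esub> u = a \<odot>\<^bsub>M\<^esub> u \<oplus>\<^bsub>M\<^esub> b \<odot>\<^bsub>M\<^esub> u" using e ab sc by (simp add: sm add N.smult_l_distr)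
    show "(a \<otimes> b) \<odot>\<^bsub>M\<^esub> u = a \<odot>\<^bsub>M\<^esub> (b \<odot>\<^bsub>M\<^esub> u)" using e ab sc by (simp add: sm N.smult_assoc)
  next
    fix a u assume a: "a \<in> carrier R" and u: "u \<in> carrier M"
    obtain x where e: "x \<in> carrier N" "u = f x" using ex u by metis
    show "a \<odot>\<^bsub>M\<^esub> u \<in> carrier M" using e a fM N.smult_closed by (simp add: sm)
  next
    fix a u v assume a: "a \<in> carrier R" and uv: "u \<in> carrier M" "v \<in> carrier M"
    obtain x y where e: "x \<in> carrier N" "u = f x" "y \<in> carrier N" "v = f y" using ex uv by metis
    show "a \<odot>\<^bsub>M\<^esub> (u \<oplus>\<^bsub>M\<^esub> v) = a \<odot>\<^bsub>M\<^esub> u \<oplus>\<^bsub>M\<^esub> a \<odot>\<^bsub>M\<^esub> v"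
      using e a N.smult_closed by (simp add: sm add N.smult_r_distr)
  next
    fix u assume u: "u \<in> carrier M"
    obtain x where e: "x \<in> carrier N" "u = f x" using ex u by metis
    show "\<one> \<odot>\<^bsub>M\<^esub> u = u" using e by (simp add: sm N.smult_one)
  qed
  ultimately show ?thesis unfolding left_module_def using R_ring by blast
qed

text \<open>The fields of \<open>M\<close> are normalised outside the carrier, so that a set of bounded carriers supports only a
  small set of such modules.\<close>

definition normalised :: "'u set \<Rightarrow> ('r, 'u) module \<Rightarrow> bool" where
  "normalised W M \<longleftrightarrow> carrier M \<subseteq> W \<and> monoid.mult M = undefined \<and> one M = undefined \<and>
     (\<forall>x y. x \<notin> carrier M \<or> y \<notin> carrier M \<longrightarrow> x \<oplus>\<^bsub>M\<^esub> y = undefined) \<and>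
     (\<forall>a x. a \<notin> carrier R \<or> x \<notin> carrier M \<longrightarrow> a \<odot>\<^bsub>M\<^esub> x = undefined)"

lemma transport_module:
  assumes N: "small_module U R N" and \<phi>: "inj_on \<phi> (carrier N)" "\<phi> ` carrier N \<subseteq> W" and W: "W \<subseteq> U"
  shows "\<exists>M f g. small_module U R M \<and> normalised W M \<and> linear_map R M N f \<and> linear_map R N M g \<and>
    (\<forall>x\<in>carrier M. g (f x) = x) \<and> (\<forall>x\<in>carrier N. f (g x) = x)"
proof -
  interpret N: left_module R N by (rule small_module_left[OF N])
  let ?\<psi> = "inv_into (carrier N) \<phi>" and ?K = "\<phi> ` carrier N"
  define M :: "('r, 'u) module" where "M = \<lparr>carrier = ?K, mult = undefined, one = undefined, zero = \<phi> \<zero>\<^bsub>N\<^esub>,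
    add = (\<lambda>x y. if x \<in> ?K \<and> y \<in> ?K then \<phi> (?\<psi> x \<oplus>\<^bsub>N\<^esub> ?\<psi> y) else undefined),
    smult = (\<lambda>a x. if a \<in> carrier R \<and> x \<in> ?K then \<phi> (a \<odot>\<^bsub>N\<^esub> ?\<psi> x) else undefined)\<rparr>"
  have inv: "?\<psi> (\<phi> x) = x" if "x \<in> carrier N" for x by (rule inv_into_f_f[OF \<phi>(1) that])
  have M: "carrier M = ?K" "\<zero>\<^bsub>M\<^esub> = \<phi> \<zero>\<^bsub>N\<^esub>"
    "\<And>x y. x \<in> carrier N \<Longrightarrow> y \<in> carrier N \<Longrightarrow> \<phi> x \<oplus>\<^bsub>M\<^esub> \<phi> y = \<phi> (x \<oplus>\<^bsub>N\<^esub> y)"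
    "\<And>a x. a \<in> carrier R \<Longrightarrow> x \<in> carrier N \<Longrightarrow> a \<odot>\<^bsub>M\<^esub> \<phi> x = \<phi> (a \<odot>\<^bsub>N\<^esub> x)"
    unfolding M_def using inv by simp_all
  have "left_module R M" by (rule left_module_image[OF N.left_module_axioms M(1)[symmetric] M(3,4,2)])
  moreover have "small U ?K" by (rule small_le[OF card_of_image small_module_carrier(2)[OF N]])
  ultimately have sM: "small_module U R M" unfolding small_module_def M(1) using \<phi>(2) W by blast
  have nM: "normalised W M" unfolding normalised_def M(1) using \<phi>(2) unfolding M_def by auto
  have g: "linear_map R N M \<phi>" unfolding linear_map_def using M by simp
  have f: "linear_map R M N ?\<psi>"
    unfolding linear_map_def
  proof (intro conjI ballI)
    show "?\<psi> \<in> carrier M \<rightarrow> carrier N" unfolding M(1) using inv by auto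
    fix x y assume "x \<in> carrier M" "y \<in> carrier M"
    then obtain u v where "u \<in> carrier N" "x = \<phi> u" "v \<in> carrier N" "y = \<phi> v" unfolding M(1) by blast
    then show "?\<psi> (x \<oplus>\<^bsub>M\<^esub> y) = ?\<psi> x \<oplus>\<^bsub>N\<^esub> ?\<psi> y" using M(3) inv by simp
  next
    fix a x assume a: "a \<in> carrier R" and "x \<in> carrier M"
    then obtain u where "u \<in> carrier N" "x = \<phi> u" unfolding M(1) by blast
    then show "?\<psi> (a \<odot>\<^bsub>M\<^esub> x) = a \<odot>\<^bsub>N\<^esub> ?\<psi> x" using M(4) a inv N.smult_closed by simp
  qed
  have "\<forall>x\<in>carrier M. \<phi> (?\<psi> x) = x" unfolding M(1) using inv by auto
  then show ?thesis using sM nM f g inv by metis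
qed

lemma small_Func: "X \<subseteq> U \<Longrightarrow> small U X \<Longrightarrow> small U (Func \<Lambda> X)"
  using universe unfolding universe_for_def \<Lambda>_def by blast

lemma small_finite: "finite X \<Longrightarrow> small U X"
  unfolding small_def
  by (rule finite_ordLess_infinite[OF card_of_Well_order card_of_Well_order]) (use infinite_U in simp_all)

lemma small_Pow_\<Lambda>: "small U (Pow \<Lambda>)"
proof -
  obtain a b where ab: "a \<in> U" "b \<in> U" "a \<noteq> b"
    using infinite_U by (metis finite.emptyI finite_insert insertI1 subset_singletonD subsetI singletonI finite_subset)
  let ?f = "\<lambda>S x. if x \<in> \<Lambda> then (if x \<in> S then a else b) else undefined"
  have inj: "inj_on ?f (Pow \<Lambda>)"
  proof (rule inj_onI)
    fix S T assume S: "S \<in> Pow \<Lambda>" "T \<in> Pow \<Lambda>" and eq: "?f S = ?f T"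
    have "x \<in> S \<longleftrightarrow> x \<in> T" for x using fun_cong[OF eq, of x] S ab(3) by (cases "x \<in> \<Lambda>") (auto split: if_splits)
    then show "S = T" by blast
  qed
  have "?f ` Pow \<Lambda> \<subseteq> Func \<Lambda> {a, b}" unfolding Func_def by auto
  then have "|Pow \<Lambda>| \<le>o |Func \<Lambda> {a, b}|" using inj card_of_ordLeq by blast
  moreover have "small U (Func \<Lambda> {a, b})" by (rule small_Func[OF _ small_finite]) (use ab in simp_all)
  ultimately show ?thesis by (rule small_le)
qed

lemma small_Pow: "|W| \<le>o |\<Lambda>| \<Longrightarrow> small U (Pow W)"
  by (rule small_le[OF card_of_Pow_mono small_Pow_\<Lambda>])

lemma small_Times: "small U X \<Longrightarrow> small U Y \<Longrightarrow> small U (X \<times> Y)"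
  unfolding small_def by (rule card_of_Times_ordLess_infinite[OF infinite_U])

lemma small_normalised:
  assumes W: "|W| \<le>o |\<Lambda>|"
  shows "small U {M. normalised W M \<and> \<zero>\<^bsub>M\<^esub> \<in> carrier M \<and> left_module R M}" (is "small U ?C")
proof -
  define G1 where "G1 = (\<lambda>M :: ('r, 'u) module. {(x, y, z). x \<in> carrier M \<and> y \<in> carrier M \<and> z = x \<oplus>\<^bsub>M\<^esub> y})"
  define G2 where "G2 = (\<lambda>M :: ('r, 'u) module. {(a, x, z). a \<in> carrier R \<and> x \<in> carrier M \<and> z = a \<odot>\<^bsub>M\<^esub> x})"
  define G where "G = (\<lambda>M. (G1 M, G2 M, \<zero>\<^bsub>M\<^esub>))"
  have G1: "(x, y, z) \<in> G1 M \<longleftrightarrow> x \<in> carrier M \<and> y \<in> carrier M \<and> z = x \<oplus>\<^bsub>M\<^esub> y" for x y z M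
    unfolding G1_def by simp
  have G2: "(a, x, z) \<in> G2 M \<longleftrightarrow> a \<in> carrier R \<and> x \<in> carrier M \<and> z = a \<odot>\<^bsub>M\<^esub> x" for a x z M
    unfolding G2_def by simp
  have "inj_on G ?C"
  proof (rule inj_onI)
    fix M N assume M: "M \<in> ?C" and N: "N \<in> ?C" and eq: "G M = G N"
    have n: "normalised W M" "normalised W N" using M N by simp_all
    have g: "G1 M = G1 N" "G2 M = G2 N" "\<zero>\<^bsub>M\<^esub> = \<zero>\<^bsub>N\<^esub>" using eq unfolding G_def by simp_all
    have car: "x \<in> carrier M \<longleftrightarrow> x \<in> carrier N" for x
      using G1[of x x "x \<oplus>\<^bsub>M\<^esub> x" M] G1[of x x "x \<oplus>\<^bsub>M\<^esub> x" N] G1[of x x "x \<oplus>\<^bsub>N\<^esub> x" M]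
        G1[of x x "x \<oplus>\<^bsub>N\<^esub> x" N] unfolding g(1) by argo
    have "x \<oplus>\<^bsub>M\<^esub> y = x \<oplus>\<^bsub>N\<^esub> y" for x y
    proof (cases "x \<in> carrier M \<and> y \<in> carrier M")
      case True
      then have "(x, y, x \<oplus>\<^bsub>M\<^esub> y) \<in> G1 N" unfolding g(1)[symmetric] G1 by simp
      then show ?thesis unfolding G1 by simp
    next
      case False
      then show ?thesis using n car unfolding normalised_def by metis
    qed
    moreover have "a \<odot>\<^bsub>M\<^esub> x = a \<odot>\<^bsub>N\<^esub> x" for a x
    proof (cases "a \<in> carrier R \<and> x \<in> carrier M")
      case True
      then have "(a, x, a \<odot>\<^bsub>M\<^esub> x) \<in> G2 N" unfolding g(2)[symmetric] G2 by simp
      then show ?thesis unfolding G2 by simp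
    next
      case False
      then show ?thesis using n car unfolding normalised_def by metis
    qed
    moreover have "carrier M = carrier N" using car by blast
    moreover have "monoid.mult M = monoid.mult N" "one M = one N" using n unfolding normalised_def by simp_all
    ultimately show "M = N" using g(3) by (cases M, cases N) (auto simp: fun_eq_iff)
  qed
  moreover have "G ` ?C \<subseteq> Pow (W \<times> W \<times> W) \<times> Pow (carrier R \<times> W \<times> W) \<times> W"
  proof
    fix g assume "g \<in> G ` ?C"
    then obtain M where M: "M \<in> ?C" "g = G M" by blast
    interpret M: left_module R M using M(1) by simp
    have "carrier M \<subseteq> W" using M(1) unfolding normalised_def by blast
    then show "g \<in> Pow (W \<times> W \<times> W) \<times> Pow (carrier R \<times> W \<times> W) \<times> W"
      unfolding M(2) G_def G1_def G2_def using M.M.a_closed M.smult_closed M.M.zero_closed by auto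
  qed
  ultimately have "|?C| \<le>o |Pow (W \<times> W \<times> W) \<times> Pow (carrier R \<times> W \<times> W) \<times> W|" using card_of_ordLeq by blast
  moreover have "small U (Pow (W \<times> W \<times> W) \<times> Pow (carrier R \<times> W \<times> W) \<times> W)"
    by (intro small_Times small_Pow le_\<Lambda>_Times W R_le_\<Lambda> small_le[OF W small_\<Lambda>])
  ultimately show ?thesis by (rule small_le)
qed


lemma light_cardinal_exists:
  "\<exists>\<kappa> :: 'u rel. Card_order \<kappa> \<and> cinfinite \<kappa> \<and> regularCard \<kappa> \<and> \<kappa> <o |U| \<and>
     (\<forall>S :: 'u set. |S| <o \<kappa> \<longleftrightarrow> |S| \<le>o |\<Lambda>| )"
proof -
  let ?s = "cardSuc |\<Lambda>|"
  have C: "Cinfinite |\<Lambda>|" using infinite_\<Lambda> by (simp add: cinfinite_def Field_card_of card_of_Card_order)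
  have co: "Card_order ?s" by (simp add: cardSuc_Card_order card_of_Card_order)
  have F: "|Field ?s| =o ?s" by (rule card_of_Field_ordIso[OF co])
  have "?s \<le>o |Pow \<Lambda>|" by (rule cardSuc_least[OF card_of_Card_order card_of_Card_order card_of_Pow])
  then have "?s <o |U|" using small_Pow_\<Lambda> unfolding small_def by (rule ordLeq_ordLess_trans)
  then have FU: "|Field ?s| <o |U|" by (rule ordIso_ordLess_trans[OF F])
  then have "|Field ?s| \<le>o |U|" by (rule ordLess_imp_ordLeq)
  then obtain f where f: "inj_on f (Field ?s)" "f ` Field ?s \<subseteq> U" unfolding card_of_ordLeq[symmetric] by blast
  define \<kappa> where "\<kappa> = |f ` Field ?s|"
  have "|Field ?s| =o \<kappa>"
    unfolding \<kappa>_def by (rule card_of_ordIsoI[of f]) (simp add: bij_betw_def f(1))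
  then have iso: "?s =o \<kappa>" by (rule ordIso_transitive[OF ordIso_symmetric[OF F]])
  have Ck: "Card_order \<kappa>" unfolding \<kappa>_def by (rule card_of_Card_order)
  have "cinfinite \<kappa>"
    using Cinfinite_cong[OF iso Cinfinite_cardSuc[OF C]] by simp
  moreover have "regularCard \<kappa>"
    by (rule regularCard_ordIso[OF iso Cinfinite_cardSuc[OF C] regularCard_cardSuc[OF C]])
  moreover have "\<kappa> <o |U|"
    by (rule ordIso_ordLess_trans[OF ordIso_symmetric[OF iso] \<open>?s <o |U|\<close>])
  moreover have "|S| <o \<kappa> \<longleftrightarrow> |S| \<le>o |\<Lambda>|" for S :: "'u set"
  proof -
    have "|S| <o \<kappa> \<longleftrightarrow> |S| <o ?s"
      using ordLess_ordIso_trans[OF _ iso, of "|S|"] ordLess_ordIso_trans[OF _ ordIso_symmetric[OF iso], of "|S|"] by blast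
    also have "\<dots> \<longleftrightarrow> |S| \<le>o |\<Lambda>|"
      by (rule cardSuc_ordLeq_ordLess[OF card_of_Card_order card_of_Card_order])
    finally show ?thesis .
  qed
  ultimately show ?thesis using Ck by blast
qed

lemma small_light_subsets:
  assumes X: "X \<subseteq> U" "small U X" and J: "\<And>S. S \<in> J \<Longrightarrow> S \<subseteq> X \<and> S \<noteq> {} \<and> |S| \<le>o |\<Lambda>|"
  shows "small U J"
proof -
  have "J \<subseteq> (\<lambda>f. f ` \<Lambda>) ` Func \<Lambda> X"
  proof
    fix S assume S: "S \<in> J"
    then obtain g where g: "g ` \<Lambda> = S" using card_of_ordLeq2[of S \<Lambda>] J[OF S] by blast
    let ?f = "\<lambda>x. if x \<in> \<Lambda> then g x else undefined"
    have "?f \<in> Func \<Lambda> X" unfolding Func_def using g J[OF S] by auto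
    moreover have "S = ?f ` \<Lambda>" using g by auto
    ultimately show "S \<in> (\<lambda>f. f ` \<Lambda>) ` Func \<Lambda> X" by blast
  qed
  moreover have "small U ((\<lambda>f. f ` \<Lambda>) ` Func \<Lambda> X)" by (rule small_le[OF card_of_image small_Func[OF X]])
  ultimately show ?thesis using small_subset by blast
qed

lemma light_generation:
  assumes \<kappa>: "\<And>S :: 'u set. |S| <o \<kappa> \<Longrightarrow> |S| \<le>o |\<Lambda>|"
    and C0: "\<And>N. small_module U R N \<Longrightarrow> h_exact N \<Longrightarrow> |carrier N| \<le>o |\<Lambda>| \<Longrightarrow>
      \<exists>M f g. M \<in> C0 \<and> linear_map R M N f \<and> linear_map R N M g \<and>
        (\<forall>x\<in>carrier M. g (f x) = x) \<and> (\<forall>x\<in>carrier N. f (g x) = x)"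
    and C0': "C0 \<subseteq> Ob HU"
    and X: "small_module U R X" "h_exact X"
  shows "\<exists>(I :: 'u set) r D t c. small U I \<and> directed_set \<kappa> I r \<and> direct_system HU I r D t \<and> (\<forall>i\<in>I. D i \<in> C0) \<and>
    is_colimit HU I r D t X c"
proof -
  define J where "J = {S \<in> submodules X. |S| \<le>o |\<Lambda>| \<and> h_exact (X\<lparr>carrier := S\<rparr>)}"
  have J: "S \<in> submodules X" "|S| \<le>o |\<Lambda>|" "h_exact (X\<lparr>carrier := S\<rparr>)" "S \<subseteq> carrier X" "\<zero>\<^bsub>X\<^esub> \<in> S" if "S \<in> J" for S
    using that unfolding J_def submodules_def by blast+
  have LS: "\<exists>S\<in>J. Y \<subseteq> S" if "Y \<subseteq> carrier X" "|Y| \<le>o |\<Lambda>|" for Y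
    using light_h_exact_submodule[OF X that] unfolding J_def by blast
  have sJ: "small U J"
    by (rule small_light_subsets[OF small_module_carrier[OF X(1)]]) (use J in blast)
  then have "|J| \<le>o |U|" unfolding small_def by (rule ordLess_imp_ordLeq)
  then obtain e where e: "inj_on e J" "e ` J \<subseteq> U" unfolding card_of_ordLeq[symmetric] by blast
  define I where "I = e ` J"
  define s where "s = inv_into J e"
  have sI: "s i \<in> J" if "i \<in> I" for i using that unfolding s_def I_def by (rule inv_into_into)
  have es: "s (e S) = S" if "S \<in> J" for S unfolding s_def by (rule inv_into_f_f[OF e(1) that])
  define r where "r = {(i, j). i \<in> I \<and> j \<in> I \<and> s i \<subseteq> s j}"
  have rI: "i \<in> I" "j \<in> I" "s i \<subseteq> s j" if "(i, j) \<in> r" for i j using that unfolding r_def by simp_all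
  let ?N = "\<lambda>i. X\<lparr>carrier := s i\<rparr>"
  have N: "small_module U R (?N i)" "h_exact (?N i)" "|carrier (?N i)| \<le>o |\<Lambda>|" if "i \<in> I" for i
    using submodule_small[OF X(1) J(1)[OF sI[OF that]]] J(2,3)[OF sI[OF that]] by simp_all
  have "\<forall>i\<in>I. \<exists>p. fst p \<in> C0 \<and> linear_map R (fst p) (?N i) (fst (snd p)) \<and> linear_map R (?N i) (fst p) (snd (snd p)) \<and>
        (\<forall>x\<in>carrier (fst p). snd (snd p) (fst (snd p) x) = x) \<and> (\<forall>x\<in>carrier (?N i). fst (snd p) (snd (snd p) x) = x)"
    using C0[OF N] by fastforce
  from bchoice[OF this] obtain p where p: "\<forall>i\<in>I. fst (p i) \<in> C0 \<and> linear_map R (fst (p i)) (?N i) (fst (snd (p i))) \<and>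
      linear_map R (?N i) (fst (p i)) (snd (snd (p i))) \<and>
        (\<forall>x\<in>carrier (fst (p i)). snd (snd (p i)) (fst (snd (p i)) x) = x) \<and>
        (\<forall>x\<in>carrier (?N i). fst (snd (p i)) (snd (snd (p i)) x) = x)"
    by (rule exE)
  define D where "D = (\<lambda>i. fst (p i))"
  define f where "f = (\<lambda>i. fst (snd (p i)))"
  define g where "g = (\<lambda>i. snd (snd (p i)))"
  have D: "D i \<in> C0" "linear_map R (D i) (?N i) (f i)" "linear_map R (?N i) (D i) (g i)"
    "\<And>x. x \<in> carrier (D i) \<Longrightarrow> g i (f i x) = x" "\<And>x. x \<in> s i \<Longrightarrow> f i (g i x) = x" if "i \<in> I" for i
    using bspec[OF p that] unfolding D_def f_def g_def by simp_all
  have sD: "small_module U R (D i)" "h_exact (D i)" if "i \<in> I" for i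
    using D(1)[OF that] C0' HU_simps(1)[of "D i"] by blast+
  note lD = small_module_left[OF sD(1)]
  have fs: "f i x \<in> s i" if "i \<in> I" "x \<in> carrier (D i)" for i x
    using linear_map_closed[OF D(2)[OF that(1)] that(2)] by simp
  have gD: "g i x \<in> carrier (D i)" if "i \<in> I" "x \<in> s i" for i x
    using linear_map_closed[OF D(3)[OF that(1)]] that(2) by simp
  define t where "t = (\<lambda>i j. restrict (\<lambda>x. g j (f i x)) (carrier (D i)))"
  have t: "t i j x = g j (f i x)" if "x \<in> carrier (D i)" for i j x unfolding t_def using that by simp
  have tu: "t i j x = undefined" if "x \<notin> carrier (D i)" for i j x unfolding t_def using that by simp
  have fsj: "f i x \<in> s j" if "(i, j) \<in> r" "x \<in> carrier (D i)" for i j x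
    using fs[OF rI(1)[OF that(1)] that(2)] rI(3)[OF that(1)] by blast
  have tD: "t i j x \<in> carrier (D j)" if "(i, j) \<in> r" "x \<in> carrier (D i)" for i j x
    unfolding t[OF that(2)] by (rule gD[OF rI(2)[OF that(1)] fsj[OF that]])
  have tt: "t j k (t i j x) = t i k x" if "(i, j) \<in> r" "x \<in> carrier (D i)" for i j k x
    using t[OF tD[OF that]] t[OF that(2)] D(5)[OF rI(2)[OF that(1)] fsj[OF that]] by simp
  have th: "t i j \<in> module_hom R (D i) (D j)" if ij: "(i, j) \<in> r" for i j
    unfolding t_def
    by (rule linear_map_restrict[OF lD[OF rI(1)[OF ij]] linear_map_comp[OF linear_map_comp[OF D(2)[OF rI(1)[OF ij]]
          submodule_inclusion[OF J(1)[OF sI[OF rI(1)[OF ij]]] rI(3)[OF ij]]] D(3)[OF rI(2)[OF ij]]]])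
  have pre: "preorder_on I r"
    unfolding preorder_on_def refl_on_def trans_def r_def by auto
  have bound: "\<exists>u\<in>I. \<forall>i\<in>S. (i, u) \<in> r" if S: "S \<subseteq> I" "|S| \<le>o |\<Lambda>|" for S
  proof -
    have "|\<Union>i\<in>S. s i| \<le>o |\<Lambda>|" by (rule le_\<Lambda>_UNION[OF S(2)]) (use J(2)[OF sI] S(1) in blast)
    moreover have "(\<Union>i\<in>S. s i) \<subseteq> carrier X" using J(4)[OF sI] S(1) by blast
    ultimately obtain T where T: "T \<in> J" "(\<Union>i\<in>S. s i) \<subseteq> T" using LS by blast
    show ?thesis
      by (rule bexI[of _ "e T"]) (use T S(1) es[OF T(1)] in \<open>auto simp: r_def I_def\<close>)
  qed
  have dirset: "directed_set \<kappa> I r" unfolding directed_set_def using pre bound \<kappa> by blast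
  have dir: "\<exists>k. (i, k) \<in> r \<and> (j, k) \<in> r" if "i \<in> I" "j \<in> I" for i j
    using bound[of "{i, j}"] le_\<Lambda>_finite[of "{i, j}"] that by blast
  have ne: "I \<noteq> {}" using bound[of "{}"] le_\<Lambda>_finite[of "{} :: 'u set"] by blast
  have sys: "direct_system HU I r D t"
    unfolding direct_system_def HU_simps
  proof (intro conjI ballI allI impI)
    fix i assume i: "i \<in> I"
    show "small_module U R (D i)" "h_exact (D i)" using sD[OF i] .
    show "t i i = (\<lambda>x\<in>carrier (D i). x)" unfolding t_def using D(4)[OF i] by (auto simp: restrict_def)
  next
    show "t i j \<in> module_hom R (D i) (D j)" if "(i, j) \<in> r" for i j by (rule th[OF that])
    show "compose (carrier (D i)) (t j k) (t i j) = t i k" if ij: "(i, j) \<in> r" "(j, k) \<in> r" for i j k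
    proof
      fix x show "compose (carrier (D i)) (t j k) (t i j) x = t i k x"
        using tt[OF ij(1), of x k] by (cases "x \<in> carrier (D i)") (simp_all add: compose_def tu)
    qed
  qed
  have sub: "linear_map R (?N i) X (\<lambda>x. x)" if "i \<in> I" for i
    using submodule_inclusion[OF J(1)[OF sI[OF that]] J(4)[OF sI[OF that]]] by simp
  have "directed_colimit I r D t X f"
    unfolding directed_colimit_def
  proof (intro conjI allI impI ballI)
    show "preorder_on I r" "I \<noteq> {}" by (rule pre ne)+
    show "\<exists>k. (i, k) \<in> r \<and> (j, k) \<in> r" if "i \<in> I" "j \<in> I" for i j by (rule dir[OF that])
    show "small_module U R (D i)" if "i \<in> I" for i by (rule sD(1)[OF that])
    show "small_module U R X" by (rule X)
    show "linear_map R (D i) (D j) (t i j)" if "(i, j) \<in> r" for i j by (rule module_hom_linear[OF th[OF that]])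
    show "linear_map R (D i) X (f i)" if "i \<in> I" for i by (rule linear_map_comp[OF D(2)[OF that] sub[OF that]])
    show "t j k (t i j x) = t i k x" if "(i, j) \<in> r" "(j, k) \<in> r" "x \<in> carrier (D i)" for i j k x by (rule tt[OF that(1,3)])
    show "f j (t i j x) = f i x" if "(i, j) \<in> r" "x \<in> carrier (D i)" for i j x
      using t[OF that(2)] D(5)[OF rI(2)[OF that(1)] fsj[OF that]] by simp
    show "\<exists>i\<in>I. \<exists>x\<in>carrier (D i). f i x = y" if y: "y \<in> carrier X" for y
    proof -
      obtain S where S: "S \<in> J" "{y} \<subseteq> S" using LS[of "{y}"] le_\<Lambda>_finite[of "{y}"] y by auto
      have i: "e S \<in> I" unfolding I_def using S(1) by blast
      have ys: "y \<in> s (e S)" using S es by simp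
      show ?thesis using D(5)[OF i ys] gD[OF i ys] i by blast
    qed
    show "\<exists>j. (i, j) \<in> r \<and> t i j x = \<zero>\<^bsub>D j\<^esub>" if i: "i \<in> I" "x \<in> carrier (D i)" "f i x = \<zero>\<^bsub>X\<^esub>" for i x
    proof (intro exI conjI)
      show "(i, i) \<in> r" using i(1) unfolding r_def by simp
      show "t i i x = \<zero>\<^bsub>D i\<^esub>"
        unfolding t[OF i(2)] i(3)
        using linear_map_zero[OF small_module_left[OF N(1)[OF i(1)]] lD[OF i(1)] D(3)[OF i(1)]] by simp
    qed
  qed
  then have "is_colimit HU I r D t X (\<lambda>i. restrict (f i) (carrier (D i)))"
    by (rule directed_colimit_is_colimit[OF sys _ X(2)])
  moreover have "small U I" unfolding I_def by (rule small_le[OF card_of_image sJ])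
  ultimately show ?thesis using dirset sys D(1) by blast
qed

lemma HU_accessible: "accessible U HU"
proof -
  obtain \<kappa> :: "'u rel" where \<kappa>: "Card_order \<kappa>" "cinfinite \<kappa>" "regularCard \<kappa>" "\<kappa> <o |U|"
    and lt: "\<And>S :: 'u set. |S| <o \<kappa> \<longleftrightarrow> |S| \<le>o |\<Lambda>|"
    using light_cardinal_exists by blast
  have lim: "has_direct_limits U \<kappa> HU"
    unfolding has_direct_limits_def
  proof (intro allI impI)
    fix I :: "'u set" and r D t
    assume a: "small U I \<and> directed_set \<kappa> I r \<and> direct_system HU I r D t"
    then have d: "directed_set \<kappa> I r" and S: "direct_system HU I r D t" by simp_all
    have dp: "preorder_on I r" "I \<noteq> {}" "\<And>i j. i \<in> I \<Longrightarrow> j \<in> I \<Longrightarrow> \<exists>k. (i, k) \<in> r \<and> (j, k) \<in> r"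
      by (rule directed_set_props(1-3)[OF _ d], rule lt[THEN iffD2], assumption+)+
    obtain L c where C: "directed_colimit I r D t L c"
      using directed_colimit_exists[OF module_system_of_HU[OF S dp]] a by blast
    have "h_exact L" by (rule colim_h_exact_all[OF C HU_direct_system(2)[OF S]])
    from directed_colimit_is_colimit[OF S C this] show "\<exists>L c. is_colimit HU I r D t L c" by blast
  qed
  obtain w where w: "inj_on w \<Lambda>" "w ` \<Lambda> \<subseteq> U"
    using ordLess_imp_ordLeq[OF small_\<Lambda>[unfolded small_def]] unfolding card_of_ordLeq[symmetric] by blast
  let ?W = "w ` \<Lambda>"
  have W: "|?W| \<le>o |\<Lambda>|" by (rule card_of_image)
  define C0 where "C0 = {M. small_module U R M \<and> h_exact M \<and> normalised ?W M}"
  have "C0 \<subseteq> {M. normalised ?W M \<and> \<zero>\<^bsub>M\<^esub> \<in> carrier M \<and> left_module R M}"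
  proof
    fix M assume "M \<in> C0"
    then have M: "small_module U R M" "normalised ?W M" unfolding C0_def by simp_all
    interpret M: left_module R M by (rule small_module_left[OF M(1)])
    show "M \<in> {M. normalised ?W M \<and> \<zero>\<^bsub>M\<^esub> \<in> carrier M \<and> left_module R M}"
      using M(2) M.left_module_axioms by simp
  qed
  then have sC0: "small U C0" by (rule small_subset[OF small_normalised[OF W]])
  have pres: "presentable U \<kappa> HU M" if "M \<in> C0" for M
  proof (rule presentable_light)
    show "|S| <o \<kappa>" if "|S| \<le>o |\<Lambda>|" for S :: "'u set" using that lt by simp
    show "small_module U R M" "h_exact M" using that unfolding C0_def by simp_all
    have "carrier M \<subseteq> ?W" using that unfolding C0_def normalised_def by simp
    then show "|carrier M| \<le>o |\<Lambda>|" by (rule le_\<Lambda>_subset[OF W])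
  qed
  have C0': "C0 \<subseteq> Ob HU" unfolding C0_def using HU_simps(1) by blast
  have rep: "\<exists>M f g. M \<in> C0 \<and> linear_map R M N f \<and> linear_map R N M g \<and>
        (\<forall>x\<in>carrier M. g (f x) = x) \<and> (\<forall>x\<in>carrier N. f (g x) = x)"
    if N: "small_module U R N" "h_exact N" "|carrier N| \<le>o |\<Lambda>|" for N
  proof -
    obtain \<psi> where \<psi>: "inj_on \<psi> (carrier N)" "\<psi> ` carrier N \<subseteq> \<Lambda>"
      using N(3) unfolding card_of_ordLeq[symmetric] by blast
    have inj: "inj_on (\<lambda>x. w (\<psi> x)) (carrier N)"
      using comp_inj_on[OF \<psi>(1) inj_on_subset[OF w(1) \<psi>(2)]] by (simp add: comp_def)
    have im: "(\<lambda>x. w (\<psi> x)) ` carrier N \<subseteq> ?W" using \<psi>(2) by blast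
    obtain M f g where M: "small_module U R M" "normalised ?W M" "linear_map R M N f" "linear_map R N M g"
      "\<forall>x\<in>carrier M. g (f x) = x" "\<forall>x\<in>carrier N. f (g x) = x"
      using transport_module[OF N(1) inj im w(2)] by blast
    have "h_exact M" by (rule h_exact_retract[OF M(1) N(1) M(3,4) _ N(2)]) (use M(5) in blast)
    then show ?thesis unfolding C0_def using M by blast
  qed
  have "accessible_at U \<kappa> HU"
    unfolding accessible_at_def
  proof (intro conjI exI[of _ C0] ballI)
    show "has_direct_limits U \<kappa> HU" by (rule lim)
    show "small U C0" by (rule sC0)
    show "presentable U \<kappa> HU X" if "X \<in> C0" for X by (rule pres[OF that])
    show "\<exists>(I :: 'u set) r D t c. small U I \<and> directed_set \<kappa> I r \<and> direct_system HU I r D t \<and> (\<forall>i\<in>I. D i \<in> C0) \<and>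
        is_colimit HU I r D t X c" if "X \<in> Ob HU" for X
    proof (rule light_generation[OF _ _ C0'])
      show "|S| \<le>o |\<Lambda>|" if "|S| <o \<kappa>" for S :: "'u set" using that lt by simp
      show "small_module U R X" "h_exact X" using \<open>X \<in> Ob HU\<close> unfolding HU_simps by simp_all
    qed (rule rep)
  qed
  then show ?thesis unfolding accessible_def using HU_category \<kappa> by blast
qed

section \<open>Additivity\<close>

definition hom_group :: "('r, 'u) module \<Rightarrow> ('r, 'u) module \<Rightarrow> ('u \<Rightarrow> 'u) monoid" where
  "hom_group X Y = \<lparr>carrier = module_hom R X Y, monoid.mult = (\<lambda>f g. \<lambda>x\<in>carrier X. f x \<oplus>\<^bsub>Y\<^esub> g x),
     one = (\<lambda>x\<in>carrier X. \<zero>\<^bsub>Y\<^esub>)\<rparr>"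

lemma hom_group_simps [simp]:
  "carrier (hom_group X Y) = module_hom R X Y"
  "f \<otimes>\<^bsub>hom_group X Y\<^esub> g = (\<lambda>x\<in>carrier X. f x \<oplus>\<^bsub>Y\<^esub> g x)"
  "\<one>\<^bsub>hom_group X Y\<^esub> = (\<lambda>x\<in>carrier X. \<zero>\<^bsub>Y\<^esub>)"
  unfolding hom_group_def by simp_all

lemma hom_group_comm_group:
  assumes X: "left_module R X" and Y: "left_module R Y"
  shows "comm_group (hom_group X Y)"
proof (rule comm_groupI, unfold hom_group_simps)
  interpret Y: left_module R Y by (rule Y)
  note cl = linear_map_closed[OF module_hom_linear]
  show sum: "(\<lambda>x\<in>carrier X. f x \<oplus>\<^bsub>Y\<^esub> g x) \<in> module_hom R X Y" if "f \<in> module_hom R X Y" "g \<in> module_hom R X Y" for f g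
    by (rule linear_map_restrict[OF X linear_map_plus[OF Y module_hom_linear[OF that(1)] module_hom_linear[OF that(2)]]])
  show zero: "(\<lambda>x\<in>carrier X. \<zero>\<^bsub>Y\<^esub>) \<in> module_hom R X Y" by (rule linear_map_restrict[OF X linear_map_const_zero[OF Y]])
  fix f assume f: "f \<in> module_hom R X Y"
  show "(\<lambda>x\<in>carrier X. (\<lambda>x\<in>carrier X. \<zero>\<^bsub>Y\<^esub>) x \<oplus>\<^bsub>Y\<^esub> f x) = f"
    by (rule module_hom_eqI[OF sum[OF zero f] f]) (use cl[OF f] in simp)
  have m: "(\<lambda>x\<in>carrier X. \<ominus>\<^bsub>Y\<^esub> f x) \<in> module_hom R X Y"
    by (rule linear_map_restrict[OF X linear_map_uminus[OF Y module_hom_linear[OF f]]])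
  show "\<exists>g\<in>module_hom R X Y. (\<lambda>x\<in>carrier X. g x \<oplus>\<^bsub>Y\<^esub> f x) = (\<lambda>x\<in>carrier X. \<zero>\<^bsub>Y\<^esub>)"
  proof (rule bexI[OF _ m])
    show "(\<lambda>x\<in>carrier X. (\<lambda>x\<in>carrier X. \<ominus>\<^bsub>Y\<^esub> f x) x \<oplus>\<^bsub>Y\<^esub> f x) = (\<lambda>x\<in>carrier X. \<zero>\<^bsub>Y\<^esub>)"
      by (rule module_hom_eqI[OF sum[OF m f] zero]) (use cl[OF f] in \<open>simp add: Y.M.l_neg\<close>)
  qed
  fix g assume g: "g \<in> module_hom R X Y"
  show "(\<lambda>x\<in>carrier X. f x \<oplus>\<^bsub>Y\<^esub> g x) = (\<lambda>x\<in>carrier X. g x \<oplus>\<^bsub>Y\<^esub> f x)"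
    by (rule module_hom_eqI[OF sum[OF f g] sum[OF g f]]) (use cl[OF f] cl[OF g] in \<open>simp add: Y.M.a_comm\<close>)
  fix h assume h: "h \<in> module_hom R X Y"
  show "(\<lambda>x\<in>carrier X. (\<lambda>x\<in>carrier X. f x \<oplus>\<^bsub>Y\<^esub> g x) x \<oplus>\<^bsub>Y\<^esub> h x) =
      (\<lambda>x\<in>carrier X. f x \<oplus>\<^bsub>Y\<^esub> (\<lambda>x\<in>carrier X. g x \<oplus>\<^bsub>Y\<^esub> h x) x)"
    by (rule module_hom_eqI[OF sum[OF sum[OF f g] h] sum[OF f sum[OF g h]]])
      (use cl[OF f] cl[OF g] cl[OF h] in \<open>simp add: Y.M.a_assoc\<close>)
qed

lemma HU_preadditive: "preadditive HU hom_group"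
  unfolding preadditive_def
proof (intro conjI ballI)
  fix X Y assume "X \<in> Ob HU" "Y \<in> Ob HU"
  then have "left_module R X" "left_module R Y" unfolding HU_simps using small_module_left by metis+
  then show "comm_group (hom_group X Y)" by (rule hom_group_comm_group)
  show "carrier (hom_group X Y) = Hom HU X Y" unfolding HU_simps by simp
next
  fix X Y Z f f' g g'
  assume "f \<in> Hom HU X Y" "f' \<in> Hom HU X Y" "g \<in> Hom HU Y Z" "g' \<in> Hom HU Y Z"
  then have l: "linear_map R X Y f" "linear_map R X Y f'" "linear_map R Y Z g" unfolding HU_simps using module_hom_linear by metis+
  show "Comp HU X Y Z g (f \<otimes>\<^bsub>hom_group X Y\<^esub> f') = Comp HU X Y Z g f \<otimes>\<^bsub>hom_group X Z\<^esub> Comp HU X Y Z g f'"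
    unfolding HU_simps
    using linear_map_add[OF l(3) linear_map_closed[OF l(1)] linear_map_closed[OF l(2)]] by (auto simp: compose_def fun_eq_iff)
  show "Comp HU X Y Z (g \<otimes>\<^bsub>hom_group Y Z\<^esub> g') f = Comp HU X Y Z g f \<otimes>\<^bsub>hom_group X Z\<^esub> Comp HU X Y Z g' f"
    unfolding HU_simps using linear_map_closed[OF l(1)] by (auto simp: compose_def fun_eq_iff)
qed

lemma HU_zero_object: "\<exists>Z. zero_object HU Z"
proof -
  obtain z where z: "z \<in> U" using infinite_U by (metis finite.emptyI ex_in_conv)
  define Z :: "('r, 'u) module" where "Z = \<lparr>carrier = {z}, mult = undefined, one = undefined, zero = z,
    add = (\<lambda>_ _. z), smult = (\<lambda>_ _. z)\<rparr>"
  have Z: "carrier Z = {z}" "\<zero>\<^bsub>Z\<^esub> = z" "x \<oplus>\<^bsub>Z\<^esub> y = z" "a \<odot>\<^bsub>Z\<^esub> x = z" for a x y unfolding Z_def by simp_all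
  interpret F: left_module R "free_module {}" by (rule left_module_free) simp
  have lZ: "left_module R Z"
    by (rule left_module_image[OF F.left_module_axioms, of "\<lambda>_. z"]) (use F.M.zero_closed in \<open>auto simp: Z\<close>)
  have sZ: "small_module U R Z" unfolding small_module_def Z using lZ z small_finite[of "{z}"] by simp
  have hZ: "h_exact Z" by (rule h_exact_zero[OF sZ]) (simp add: Z)
  have uniq: "(\<exists>!f. f \<in> module_hom R X Z) \<and> (\<exists>!f. f \<in> module_hom R Z X)" if X: "left_module R X" for X :: "('r, 'u) module"
  proof
    have h: "(\<lambda>x\<in>carrier X. \<zero>\<^bsub>Z\<^esub>) \<in> module_hom R X Z" by (rule linear_map_restrict[OF X linear_map_const_zero[OF lZ]])
    have "f = (\<lambda>x\<in>carrier X. \<zero>\<^bsub>Z\<^esub>)" if f: "f \<in> module_hom R X Z" for f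
      by (rule module_hom_eqI[OF f h]) (use linear_map_closed[OF module_hom_linear[OF f]] Z in simp)
    then show "\<exists>!f. f \<in> module_hom R X Z" using h by blast
    have h': "(\<lambda>x\<in>carrier Z. \<zero>\<^bsub>X\<^esub>) \<in> module_hom R Z X" by (rule linear_map_restrict[OF lZ linear_map_const_zero[OF X]])
    have "f = (\<lambda>x\<in>carrier Z. \<zero>\<^bsub>X\<^esub>)" if f: "f \<in> module_hom R Z X" for f
      by (rule module_hom_eqI[OF f h']) (use linear_map_zero[OF lZ X module_hom_linear[OF f]] Z in simp)
    then show "\<exists>!f. f \<in> module_hom R Z X" using h' by blast
  qed
  have "zero_object HU Z"
    unfolding zero_object_def
  proof (intro conjI ballI)
    show "Z \<in> Ob HU" unfolding HU_simps using sZ hZ by simp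
    fix X assume "X \<in> Ob HU"
    then have "left_module R X" unfolding HU_simps using small_module_left[of U R X] by simp
    from uniq[OF this] show "\<exists>!f. f \<in> Hom HU X Z" "\<exists>!f. f \<in> Hom HU Z X" unfolding HU_simps by simp_all
  qed
  then show ?thesis by blast
qed

lemma direct_sum_exists:
  assumes X: "small_module U R X" and Y: "small_module U R Y"
  shows "\<exists>B i j p q. small_module U R B \<and> linear_map R X B i \<and> linear_map R Y B j \<and> linear_map R B X p \<and> linear_map R B Y q \<and>
    (\<forall>x\<in>carrier X. p (i x) = x \<and> q (i x) = \<zero>\<^bsub>Y\<^esub>) \<and> (\<forall>y\<in>carrier Y. q (j y) = y \<and> p (j y) = \<zero>\<^bsub>X\<^esub>) \<and>
    (\<forall>u\<in>carrier B. i (p u) \<oplus>\<^bsub>B\<^esub> j (q u) = u)"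
proof -
  interpret X: left_module R X by (rule small_module_left[OF X])
  interpret Y: left_module R Y by (rule small_module_left[OF Y])
  define N :: "('r, 'u \<times> 'u) module" where "N = \<lparr>carrier = carrier X \<times> carrier Y, mult = undefined, one = undefined,
    zero = (\<zero>\<^bsub>X\<^esub>, \<zero>\<^bsub>Y\<^esub>), add = (\<lambda>u v. (fst u \<oplus>\<^bsub>X\<^esub> fst v, snd u \<oplus>\<^bsub>Y\<^esub> snd v)),
    smult = (\<lambda>a u. (a \<odot>\<^bsub>X\<^esub> fst u, a \<odot>\<^bsub>Y\<^esub> snd u))\<rparr>"
  have N: "carrier N = carrier X \<times> carrier Y" "\<zero>\<^bsub>N\<^esub> = (\<zero>\<^bsub>X\<^esub>, \<zero>\<^bsub>Y\<^esub>)"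
    "u \<oplus>\<^bsub>N\<^esub> v = (fst u \<oplus>\<^bsub>X\<^esub> fst v, snd u \<oplus>\<^bsub>Y\<^esub> snd v)" "a \<odot>\<^bsub>N\<^esub> u = (a \<odot>\<^bsub>X\<^esub> fst u, a \<odot>\<^bsub>Y\<^esub> snd u)" for u v a
    unfolding N_def by simp_all
  have "abelian_group N"
  proof (rule abelian_groupI)
    fix u assume u: "u \<in> carrier N"
    show "\<exists>v\<in>carrier N. v \<oplus>\<^bsub>N\<^esub> u = \<zero>\<^bsub>N\<^esub>"
      by (rule bexI[of _ "(\<ominus>\<^bsub>X\<^esub> fst u, \<ominus>\<^bsub>Y\<^esub> snd u)"]) (use u in \<open>auto simp: N X.M.l_neg Y.M.l_neg\<close>)
  qed (auto simp: N X.M.a_ac Y.M.a_ac)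
  moreover have "left_module_axioms R N"
    by unfold_locales (auto simp: N X.smult_closed Y.smult_closed X.smult_l_distr Y.smult_l_distr X.smult_r_distr
        Y.smult_r_distr X.smult_assoc Y.smult_assoc X.smult_one Y.smult_one)
  ultimately have lN: "left_module R N" unfolding left_module_def using R_ring by blast
  have sN: "small U (carrier N)"
    unfolding N by (rule small_Times[OF small_module_carrier(2)[OF X] small_module_carrier(2)[OF Y]])
  then have "|carrier N| \<le>o |U|" unfolding small_def by (rule ordLess_imp_ordLeq)
  then obtain \<phi> where \<phi>: "inj_on \<phi> (carrier N)" "\<phi> ` carrier N \<subseteq> U" unfolding card_of_ordLeq[symmetric] by blast
  let ?\<psi> = "inv_into (carrier N) \<phi>"
  have inv: "?\<psi> (\<phi> u) = u" if "u \<in> carrier N" for u by (rule inv_into_f_f[OF \<phi>(1) that])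
  define B :: "('r, 'u) module" where "B = \<lparr>carrier = \<phi> ` carrier N, mult = undefined, one = undefined, zero = \<phi> \<zero>\<^bsub>N\<^esub>,
    add = (\<lambda>u v. \<phi> (?\<psi> u \<oplus>\<^bsub>N\<^esub> ?\<psi> v)), smult = (\<lambda>a u. \<phi> (a \<odot>\<^bsub>N\<^esub> ?\<psi> u))\<rparr>"
  have B: "carrier B = \<phi> ` carrier N" "\<zero>\<^bsub>B\<^esub> = \<phi> \<zero>\<^bsub>N\<^esub>"
    "\<And>u v. u \<in> carrier N \<Longrightarrow> v \<in> carrier N \<Longrightarrow> \<phi> u \<oplus>\<^bsub>B\<^esub> \<phi> v = \<phi> (u \<oplus>\<^bsub>N\<^esub> v)"
    "\<And>a u. u \<in> carrier N \<Longrightarrow> a \<odot>\<^bsub>B\<^esub> \<phi> u = \<phi> (a \<odot>\<^bsub>N\<^esub> u)"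
    unfolding B_def using inv by simp_all
  have lB: "left_module R B" by (rule left_module_image[OF lN B(1)[symmetric] B(3,4,2)])
  have sB: "small_module U R B"
    unfolding small_module_def B(1) using lB \<phi>(2) small_le[OF card_of_image sN] by blast
  have pairN: "(x, y) \<in> carrier N \<longleftrightarrow> x \<in> carrier X \<and> y \<in> carrier Y" for x y unfolding N by simp
  let ?i = "\<lambda>x. \<phi> (x, \<zero>\<^bsub>Y\<^esub>)" and ?j = "\<lambda>y. \<phi> (\<zero>\<^bsub>X\<^esub>, y)"
  let ?p = "\<lambda>u. fst (?\<psi> u)" and ?q = "\<lambda>u. snd (?\<psi> u)"
  have \<phi>B: "\<phi> (x, y) \<in> carrier B" if "x \<in> carrier X" "y \<in> carrier Y" for x y unfolding B(1) using that pairN by blast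
  have add: "\<phi> (x, y) \<oplus>\<^bsub>B\<^esub> \<phi> (x', y') = \<phi> (x \<oplus>\<^bsub>X\<^esub> x', y \<oplus>\<^bsub>Y\<^esub> y')"
    if "x \<in> carrier X" "y \<in> carrier Y" "x' \<in> carrier X" "y' \<in> carrier Y" for x y x' y'
    using B(3)[of "(x, y)" "(x', y')"] that pairN by (simp add: N(3))
  have sm: "a \<odot>\<^bsub>B\<^esub> \<phi> (x, y) = \<phi> (a \<odot>\<^bsub>X\<^esub> x, a \<odot>\<^bsub>Y\<^esub> y)" if "x \<in> carrier X" "y \<in> carrier Y" for a x y
    using B(4)[of "(x, y)"] that pairN by (simp add: N(4))
  have pq: "?p (\<phi> (x, y)) = x" "?q (\<phi> (x, y)) = y" if "x \<in> carrier X" "y \<in> carrier Y" for x y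
    using inv[of "(x, y)"] that pairN by simp_all
  have ex: "\<exists>x\<in>carrier X. \<exists>y\<in>carrier Y. u = \<phi> (x, y)" if "u \<in> carrier B" for u
    using that unfolding B(1) N(1) by blast
  have li: "linear_map R X B ?i" unfolding linear_map_def by (simp add: \<phi>B add sm module_smult_zero[OF Y.left_module_axioms])
  have lj: "linear_map R Y B ?j" unfolding linear_map_def by (simp add: \<phi>B add sm module_smult_zero[OF X.left_module_axioms])
  have lpq: "linear_map R B X ?p" "linear_map R B Y ?q"
    unfolding linear_map_def
  proof (safe)
    fix u assume "u \<in> carrier B"
    then obtain x y where e: "x \<in> carrier X" "y \<in> carrier Y" "u = \<phi> (x, y)" using ex by blast
    show "?p u \<in> carrier X" "?q u \<in> carrier Y" unfolding e(3) pq[OF e(1,2)] by (rule e)+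
    fix a assume "a \<in> carrier R"
    then show "?p (a \<odot>\<^bsub>B\<^esub> u) = a \<odot>\<^bsub>X\<^esub> ?p u" "?q (a \<odot>\<^bsub>B\<^esub> u) = a \<odot>\<^bsub>Y\<^esub> ?q u"
      unfolding e(3) sm[OF e(1,2)] pq[OF e(1,2)] using e X.smult_closed Y.smult_closed pq by simp_all
  next
    fix u v assume "u \<in> carrier B" "v \<in> carrier B"
    then obtain x y x' y' where e: "x \<in> carrier X" "y \<in> carrier Y" "u = \<phi> (x, y)" "x' \<in> carrier X" "y' \<in> carrier Y" "v = \<phi> (x', y')"
      using ex by metis
    show "?p (u \<oplus>\<^bsub>B\<^esub> v) = ?p u \<oplus>\<^bsub>X\<^esub> ?p v" "?q (u \<oplus>\<^bsub>B\<^esub> v) = ?q u \<oplus>\<^bsub>Y\<^esub> ?q v"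
      unfolding e(3,6) add[OF e(1,2,4,5)] pq[OF e(1,2)] pq[OF e(4,5)] using e pq by simp_all
  qed
  have id: "?i (?p u) \<oplus>\<^bsub>B\<^esub> ?j (?q u) = u" if u: "u \<in> carrier B" for u
  proof -
    obtain x y where e: "x \<in> carrier X" "y \<in> carrier Y" "u = \<phi> (x, y)" using ex[OF u] by blast
    show ?thesis unfolding e(3) pq[OF e(1,2)] using e(1,2) by (simp add: add)
  qed
  show ?thesis
    by (intro exI[of _ B] exI[of _ ?i] exI[of _ ?j] exI[of _ ?p] exI[of _ ?q] conjI sB li lj lpq ballI id)
      (simp_all add: pq)
qed

lemma HU_biproduct:
  assumes "X \<in> Ob HU" "Y \<in> Ob HU"
  shows "has_biproduct HU hom_group X Y"
proof -
  have X: "small_module U R X" "h_exact X" and Y: "small_module U R Y" "h_exact Y" using assms unfolding HU_simps by simp_all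
  obtain B i j p q where B: "small_module U R B" and l: "linear_map R X B i" "linear_map R Y B j" "linear_map R B X p" "linear_map R B Y q"
    and e: "\<forall>x\<in>carrier X. p (i x) = x \<and> q (i x) = \<zero>\<^bsub>Y\<^esub>" "\<forall>y\<in>carrier Y. q (j y) = y \<and> p (j y) = \<zero>\<^bsub>X\<^esub>"
      "\<forall>u\<in>carrier B. i (p u) \<oplus>\<^bsub>B\<^esub> j (q u) = u"
    using direct_sum_exists[OF X(1) Y(1)] by (elim exE conjE)
  have "h_exact B"
    by (rule h_exact_summand[OF B X(1) Y(1) l(3,1,4,2) _ X(2) Y(2)]) (use e(3) in simp)
  then have BO: "B \<in> Ob HU" unfolding HU_simps using B by simp
  note lX = small_module_left[OF X(1)] and lY = small_module_left[OF Y(1)] and lB = small_module_left[OF B]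
  note cl = linear_map_closed[OF l(1)] linear_map_closed[OF l(2)] linear_map_closed[OF l(3)] linear_map_closed[OF l(4)]
  show ?thesis
    unfolding has_biproduct_def HU_simps(2-4) hom_group_simps
    by (rule bexI[OF _ BO], rule bexI[OF _ linear_map_restrict[OF lX l(1)]], rule bexI[OF _ linear_map_restrict[OF lY l(2)]],
        rule bexI[OF _ linear_map_restrict[OF lB l(3)]], rule bexI[OF _ linear_map_restrict[OF lB l(4)]])
      (use e cl in \<open>auto simp: compose_def restrict_def fun_eq_iff\<close>)
qed

lemma HU_additive: "additive_category HU"
  unfolding additive_category_def
  using HU_category HU_preadditive HU_zero_object HU_biproduct by blast

end

theorem corollary2p1:
  fixes R :: "('r, 'x) ring_scheme" and A :: "'r set" and U :: "'u set"
  assumes "ring R" and "ideal A R" and "universe_for R U"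
  shows "additive_category (h_unitary_category U R A) \<and> accessible U (h_unitary_category U R A)"
proof -
  interpret ideal_in_universe R A U by (rule ideal_in_universe.intro[OF assms])
  show ?thesis using HU_additive HU_accessible by blast
qed

end
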